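(* Let $M$ be a smooth Riemannian manifold, $\sigma>0$, $V:M\to\mathbb{R}$ a $\mathcal{C}^2$ potential function, $S\subset M$ a regular submanifold (the obstacle boundary), $x_0,x_1,\dots,x_N\in M$ distinct points not lying on $S$, $0=T_0<T_1<\dots<T_N=T$ fixed times, and $v_0\in T_{x_0}M$, $v_N\in T_{x_N}M$. Let $\overline{\Omega}$ be the associated set of admissible curves and let $$J(x)=\int_0^T\frac12\left(\Big\|\frac{D^2x}{dt^2}(t)\Big\|^2+\sigma\Big\|\frac{dx}{dt}(t)\Big\|^2+V(x(t))\right)dt .$$ If $x\in\overline{\Omega}$ is an extremizer of $J$ over $\overline{\Omega}$, then $x$ is $\mathcal{C}^2$ on $[0,T]$ and on each interval $[T_{i-1},T_i]$, $i=1,\dots,N$, it satisfies $$\frac{D^4x}{dt^4}+R\left(\frac{D^2x}{dt^2},\frac{dx}{dt}\right)\frac{dx}{dt}-\sigma\frac{D^2x}{dt^2}+\frac12\,\mathrm{grad}\,V(x)=0 .$$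
   Context: $\langle\cdot,\cdot\rangle$ is the metric, $\nabla$ the Levi-Civita connection, $R(X,Y)Z=\nabla_X\nabla_YZ-\nabla_Y\nabla_XZ-\nabla_{[X,Y]}Z$ the curvature tensor. For a curve $x$, $\frac{D^{s+1}x}{dt^{s+1}}$ denotes the $s$-th covariant derivative along $x$ of the velocity field $\frac{dx}{dt}$. $V$ is the artificial potential used to repel curves from the obstacle bounded by $S$. Admissible set $\overline{\Omega}$: all $\mathcal{C}^1$ curves $x:[0,T]\to M$ that are smooth on each $[T_{i-1},T_i]$, $i=1,\dots,N$, and satisfy $x(T_i)=x_i$ for $i=1,\dots,N-1$, $x(0)=x_0$, $x(T)=x_N$, $\frac{dx}{dt}(0)=v_0$, $\frac{dx}{dt}(T)=v_N$. Admissible variation of $x\in\overline{\Omega}$: a $\mathcal{C}^1$ map $\alpha:(-\epsilon,\epsilon)\times[0,T]\to M$, $(r,t)\mapsto\alpha_r(t)$, smooth on each $(-\epsilon,\epsilon)\times[T_{i-1},T_i]$, with $\alpha_0=x$ and $\alpha_r\in\overline{\Omega}$ for every $r$. A curve $x\in\overline{\Omega}$ is an extremizer of a functional $J$ over $\overline{\Omega}$ if $\frac{d}{dr}J(\alpha_r)\big|_{r=0}=0$ for every admissible variation $\alpha$ of $x$. *)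

theory Defs
  imports "HOL-Analysis.Analysis" "HOL-Library.Extended_Nat"
begin

section \<open>Maps of class $C^k$ between Euclidean spaces\<close>

primrec Ck_open :: "nat \<Rightarrow> ('a::euclidean_space) set \<Rightarrow> ('a \<Rightarrow> 'b::euclidean_space) \<Rightarrow> bool" where
  "Ck_open 0 W f \<longleftrightarrow> continuous_on W f"
| "Ck_open (Suc k) W f \<longleftrightarrow> (\<forall>p\<in>W. f differentiable at p) \<and>
     (\<forall>v. Ck_open k W (\<lambda>p. frechet_derivative f (at p) v))"

text \<open>On an arbitrary subset \<open>S\<close> (for instance a closed interval, or an open interval times a closed
  one), \<open>f\<close> is of class $C^k$ if near each point of \<open>S\<close> it has a $C^k$ extension to an open set.
  The value \<open>k = \<infinity>\<close> means smooth.\<close>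

definition Ck_on :: "enat \<Rightarrow> ('a::euclidean_space) set \<Rightarrow> ('a \<Rightarrow> 'b::euclidean_space) \<Rightarrow> bool" where
  "Ck_on k S f \<longleftrightarrow> (\<forall>p\<in>S. \<exists>W h. open W \<and> p \<in> W \<and>
     (\<forall>j. enat j \<le> k \<longrightarrow> Ck_open j W h) \<and> (\<forall>q\<in>W \<inter> S. f q = h q))"


section \<open>Smooth manifolds\<close>

text \<open>The manifold is the type \<open>'m\<close>, assumed to be a Hausdorff second countable space in the theorem.
  A chart is its domain together with the coordinate map, whose values off the domain are
  irrelevant.  The dimension of the manifold is \<open>DIM('e)\<close>.\<close>

type_synonym ('m, 'e) chart = "'m set \<times> ('m \<Rightarrow> 'e)"

abbreviation dom_of :: "('m, 'e) chart \<Rightarrow> 'm set" where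
  "dom_of c \<equiv> fst c"

abbreviation coords :: "('m, 'e) chart \<Rightarrow> 'm \<Rightarrow> 'e" where
  "coords c \<equiv> snd c"

definition param :: "('m, 'e) chart \<Rightarrow> 'e \<Rightarrow> 'm" where
  "param c = inv_into (dom_of c) (coords c)"

definition is_chart :: "('m::topological_space, 'e::euclidean_space) chart \<Rightarrow> bool" where
  "is_chart c \<longleftrightarrow> open (dom_of c) \<and> open (coords c ` dom_of c) \<and>
     homeomorphism (dom_of c) (coords c ` dom_of c) (coords c) (param c)"

definition transition :: "('m, 'e) chart \<Rightarrow> ('m, 'e) chart \<Rightarrow> 'e \<Rightarrow> 'e" where
  "transition c d = coords d \<circ> param c"

definition compatible ::
    "('m, 'e::euclidean_space) chart \<Rightarrow> ('m, 'e) chart \<Rightarrow> bool" where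
  "compatible c d \<longleftrightarrow>
     Ck_on \<infinity> (coords c ` (dom_of c \<inter> dom_of d)) (transition c d) \<and>
     Ck_on \<infinity> (coords d ` (dom_of c \<inter> dom_of d)) (transition d c)"

text \<open>A smooth structure is a maximal smooth atlas.\<close>

definition smooth_structure ::
    "('m::topological_space, 'e::euclidean_space) chart set \<Rightarrow> bool" where
  "smooth_structure A \<longleftrightarrow>
     (\<forall>c\<in>A. is_chart c) \<and> (\<Union>c\<in>A. dom_of c) = UNIV \<and>
     (\<forall>c\<in>A. \<forall>d\<in>A. compatible c d) \<and>
     (\<forall>c. is_chart c \<and> (\<forall>d\<in>A. compatible c d) \<longrightarrow> c \<in> A)"

definition charts_at :: "('m, 'e) chart set \<Rightarrow> 'm \<Rightarrow> ('m, 'e) chart set" where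
  "charts_at A p = {c \<in> A. p \<in> dom_of c}"

definition Ck_fun ::
    "('m, 'e::euclidean_space) chart set \<Rightarrow> enat \<Rightarrow> 'm set \<Rightarrow> ('m \<Rightarrow> real) \<Rightarrow> bool" where
  "Ck_fun A k U f \<longleftrightarrow> (\<forall>c\<in>A. Ck_on k (coords c ` (dom_of c \<inter> U)) (f \<circ> param c))"

definition Ck_map ::
    "('m::topological_space, 'e::euclidean_space) chart set \<Rightarrow> enat \<Rightarrow>
     ('a::euclidean_space) set \<Rightarrow> ('a \<Rightarrow> 'm) \<Rightarrow> bool" where
  "Ck_map A k S f \<longleftrightarrow> continuous_on S f \<and>
     (\<forall>c\<in>A. Ck_on k (S \<inter> f -` dom_of c) (coords c \<circ> f))"

text \<open>Regular (that is, embedded) submanifolds, described by slice charts; the dimension \<open>k\<close> is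
  arbitrary.\<close>

definition regular_submanifold ::
    "('m, 'e::euclidean_space) chart set \<Rightarrow> 'm set \<Rightarrow> bool" where
  "regular_submanifold A S \<longleftrightarrow> (\<exists>k. \<forall>p\<in>S. \<exists>c\<in>charts_at A p. \<exists>L. subspace L \<and> dim L = k \<and>
     coords c ` (dom_of c \<inter> S) = coords c ` dom_of c \<inter> L)"


section \<open>Tangent vectors and vector fields\<close>

text \<open>A tangent vector at \<open>p\<close> is the family of its components in all charts around \<open>p\<close>; components in
  different charts are related by the differential of the transition map.  Components in charts
  that do not contain \<open>p\<close> are set to zero.\<close>

type_synonym ('m, 'e) tvec = "('m, 'e) chart \<Rightarrow> 'e"

definition tangent_space ::
    "('m, 'e::euclidean_space) chart set \<Rightarrow> 'm \<Rightarrow> ('m, 'e) tvec set" where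
  "tangent_space A p = {v.
     (\<forall>c\<in>charts_at A p. \<forall>d\<in>charts_at A p.
        v d = frechet_derivative (transition c d) (at (coords c p)) (v c)) \<and>
     (\<forall>c. c \<notin> charts_at A p \<longrightarrow> v c = 0)}"

text \<open>The vector field on \<open>dom_of c\<close> whose components in the chart \<open>c\<close> are constantly \<open>u\<close>.  For
  \<open>u\<close> a basis vector this is a coordinate vector field.\<close>

definition coord_field ::
    "('m, 'e::euclidean_space) chart set \<Rightarrow> ('m, 'e) chart \<Rightarrow> 'e \<Rightarrow> 'm \<Rightarrow> ('m, 'e) tvec" where
  "coord_field A c u = (\<lambda>p d. if d \<in> charts_at A p
     then frechet_derivative (transition c d) (at (coords c p)) u else 0)"

definition vector_fields ::
    "('m, 'e::euclidean_space) chart set \<Rightarrow> 'm set \<Rightarrow> ('m \<Rightarrow> ('m, 'e) tvec) set" where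
  "vector_fields A U = {X. (\<forall>p\<in>U. X p \<in> tangent_space A p) \<and>
     (\<forall>c\<in>A. Ck_on \<infinity> (coords c ` (dom_of c \<inter> U)) (\<lambda>q. X (param c q) c))}"

text \<open>The derivative of the function \<open>f\<close> at \<open>p\<close> along the tangent vector \<open>v\<close>; for \<open>f\<close> differentiable
  at \<open>p\<close> it does not depend on the chart.\<close>

definition differential ::
    "('m, 'e::euclidean_space) chart set \<Rightarrow> ('m \<Rightarrow> real) \<Rightarrow> 'm \<Rightarrow> ('m, 'e) tvec \<Rightarrow> real" where
  "differential A f p v = (let c = (SOME c. c \<in> charts_at A p) in
     frechet_derivative (f \<circ> param c) (at (coords c p)) (v c))"

definition lie_bracket ::
    "('m, 'e::euclidean_space) chart set \<Rightarrow> ('m \<Rightarrow> ('m, 'e) tvec) \<Rightarrow> ('m \<Rightarrow> ('m, 'e) tvec) \<Rightarrow>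
     'm \<Rightarrow> ('m, 'e) tvec" where
  "lie_bracket A X Y = (\<lambda>p c. if c \<in> charts_at A p
     then frechet_derivative (\<lambda>q. Y (param c q) c) (at (coords c p)) (X p c)
        - frechet_derivative (\<lambda>q. X (param c q) c) (at (coords c p)) (Y p c)
     else 0)"


section \<open>Riemannian metrics, the Levi-Civita connection and curvature\<close>

definition riemannian_metric ::
    "('m, 'e::euclidean_space) chart set \<Rightarrow>
     ('m \<Rightarrow> ('m, 'e) tvec \<Rightarrow> ('m, 'e) tvec \<Rightarrow> real) \<Rightarrow> bool" where
  "riemannian_metric A g \<longleftrightarrow>
     (\<forall>p. \<forall>u\<in>tangent_space A p. \<forall>v\<in>tangent_space A p. \<forall>w\<in>tangent_space A p. \<forall>a b :: real.
        g p (\<lambda>c. a *\<^sub>R u c + b *\<^sub>R v c) w = a * g p u w + b * g p v w) \<and>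
     (\<forall>p. \<forall>u\<in>tangent_space A p. \<forall>v\<in>tangent_space A p. g p u v = g p v u) \<and>
     (\<forall>p. \<forall>u\<in>tangent_space A p. u \<noteq> (\<lambda>c. 0) \<longrightarrow> g p u u > 0) \<and>
     (\<forall>c\<in>A. \<forall>u v. Ck_fun A \<infinity> (dom_of c) (\<lambda>p. g p (coord_field A c u p) (coord_field A c v p)))"

definition tnorm ::
    "('m \<Rightarrow> ('m, 'e) tvec \<Rightarrow> ('m, 'e) tvec \<Rightarrow> real) \<Rightarrow> 'm \<Rightarrow> ('m, 'e) tvec \<Rightarrow> real" where
  "tnorm g p v = sqrt (g p v v)"

definition grad ::
    "('m, 'e::euclidean_space) chart set \<Rightarrow>
     ('m \<Rightarrow> ('m, 'e) tvec \<Rightarrow> ('m, 'e) tvec \<Rightarrow> real) \<Rightarrow>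
     ('m \<Rightarrow> real) \<Rightarrow> 'm \<Rightarrow> ('m, 'e) tvec" where
  "grad A g f p = (THE w. w \<in> tangent_space A p \<and>
     (\<forall>v\<in>tangent_space A p. g p w v = differential A f p v))"

text \<open>A connection acts on vector fields defined on open subsets.  All conditions below are on the
  values in the open set \<open>U\<close> where the fields are smooth.  Taking a function \<open>f\<close> that vanishes
  on \<open>U\<close> in the two product rules shows that \<open>nab X Y\<close> on \<open>U\<close> depends only on the
  restrictions of \<open>X\<close> and \<open>Y\<close> to \<open>U\<close>.\<close>

definition affine_connection ::
    "('m::topological_space, 'e::euclidean_space) chart set \<Rightarrow>
     (('m \<Rightarrow> ('m, 'e) tvec) \<Rightarrow> ('m \<Rightarrow> ('m, 'e) tvec) \<Rightarrow> 'm \<Rightarrow> ('m, 'e) tvec) \<Rightarrow> bool" where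
  "affine_connection A nab \<longleftrightarrow> (\<forall>U. open U \<longrightarrow>
     (\<forall>X\<in>vector_fields A U. \<forall>Y\<in>vector_fields A U. nab X Y \<in> vector_fields A U) \<and>
     (\<forall>X\<in>vector_fields A U. \<forall>Y\<in>vector_fields A U. \<forall>Z\<in>vector_fields A U. \<forall>p\<in>U. \<forall>c.
        nab (\<lambda>p c. X p c + Y p c) Z p c = nab X Z p c + nab Y Z p c \<and>
        nab X (\<lambda>p c. Y p c + Z p c) p c = nab X Y p c + nab X Z p c) \<and>
     (\<forall>X\<in>vector_fields A U. \<forall>Y\<in>vector_fields A U. \<forall>f. Ck_fun A \<infinity> U f \<longrightarrow> (\<forall>p\<in>U. \<forall>c.
        nab (\<lambda>p c. f p *\<^sub>R X p c) Y p c = f p *\<^sub>R nab X Y p c \<and>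
        nab X (\<lambda>p c. f p *\<^sub>R Y p c) p c =
          differential A f p (X p) *\<^sub>R Y p c + f p *\<^sub>R nab X Y p c)))"

definition levi_civita ::
    "('m::topological_space, 'e::euclidean_space) chart set \<Rightarrow>
     ('m \<Rightarrow> ('m, 'e) tvec \<Rightarrow> ('m, 'e) tvec \<Rightarrow> real) \<Rightarrow>
     (('m \<Rightarrow> ('m, 'e) tvec) \<Rightarrow> ('m \<Rightarrow> ('m, 'e) tvec) \<Rightarrow> 'm \<Rightarrow> ('m, 'e) tvec) \<Rightarrow> bool" where
  "levi_civita A g nab \<longleftrightarrow> affine_connection A nab \<and> (\<forall>U. open U \<longrightarrow>
     (\<forall>X\<in>vector_fields A U. \<forall>Y\<in>vector_fields A U. \<forall>p\<in>U. \<forall>c.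
        nab X Y p c - nab Y X p c = lie_bracket A X Y p c) \<and>
     (\<forall>X\<in>vector_fields A U. \<forall>Y\<in>vector_fields A U. \<forall>Z\<in>vector_fields A U. \<forall>p\<in>U.
        differential A (\<lambda>p. g p (Y p) (Z p)) p (X p) =
          g p (nab X Y p) (Z p) + g p (Y p) (nab X Z p)))"

definition curvature_field ::
    "('m, 'e::euclidean_space) chart set \<Rightarrow>
     (('m \<Rightarrow> ('m, 'e) tvec) \<Rightarrow> ('m \<Rightarrow> ('m, 'e) tvec) \<Rightarrow> 'm \<Rightarrow> ('m, 'e) tvec) \<Rightarrow>
     ('m \<Rightarrow> ('m, 'e) tvec) \<Rightarrow> ('m \<Rightarrow> ('m, 'e) tvec) \<Rightarrow> ('m \<Rightarrow> ('m, 'e) tvec) \<Rightarrow>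
     'm \<Rightarrow> ('m, 'e) tvec" where
  "curvature_field A nab X Y Z = (\<lambda>p c.
     nab X (nab Y Z) p c - nab Y (nab X Z) p c - nab (lie_bracket A X Y) Z p c)"

text \<open>The curvature tensor on tangent vectors at \<open>p\<close>: extend the vectors to vector fields near \<open>p\<close>.
  By tensoriality the extension is immaterial.  For the component in the chart \<open>c\<close> the
  extensions with constant components in \<open>c\<close> are used.\<close>

definition curvature ::
    "('m, 'e::euclidean_space) chart set \<Rightarrow>
     (('m \<Rightarrow> ('m, 'e) tvec) \<Rightarrow> ('m \<Rightarrow> ('m, 'e) tvec) \<Rightarrow> 'm \<Rightarrow> ('m, 'e) tvec) \<Rightarrow>
     'm \<Rightarrow> ('m, 'e) tvec \<Rightarrow> ('m, 'e) tvec \<Rightarrow> ('m, 'e) tvec \<Rightarrow> ('m, 'e) tvec" where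
  "curvature A nab p u v w = (\<lambda>c. if c \<in> charts_at A p
     then curvature_field A nab
       (coord_field A c (u c)) (coord_field A c (v c)) (coord_field A c (w c)) p c
     else 0)"


section \<open>Curves\<close>

text \<open>Derivatives are taken within the parameter interval \<open>I\<close>, hence are one-sided at its end points.\<close>

definition velocity ::
    "('m, 'e::euclidean_space) chart set \<Rightarrow> real set \<Rightarrow> (real \<Rightarrow> 'm) \<Rightarrow> real \<Rightarrow> ('m, 'e) tvec" where
  "velocity A I x = (\<lambda>t c. if c \<in> charts_at A (x t)
     then vector_derivative (coords c \<circ> x) (at t within I) else 0)"

text \<open>Covariant derivative of a field \<open>Y\<close> along the curve \<open>x\<close>.  If $Y = \sum_j Y^j E_j$ in the
  coordinate frame of \<open>c\<close>, then
  $DY/dt = \sum_j (dY^j/dt) E_j + \sum_j Y^j \nabla_{dx/dt} E_j$; the second sum is the covariant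
  derivative of the field having constant components \<open>Y t c\<close> in the chart \<open>c\<close>.\<close>

definition cov_deriv ::
    "('m, 'e::euclidean_space) chart set \<Rightarrow>
     (('m \<Rightarrow> ('m, 'e) tvec) \<Rightarrow> ('m \<Rightarrow> ('m, 'e) tvec) \<Rightarrow> 'm \<Rightarrow> ('m, 'e) tvec) \<Rightarrow>
     real set \<Rightarrow> (real \<Rightarrow> 'm) \<Rightarrow> (real \<Rightarrow> ('m, 'e) tvec) \<Rightarrow> real \<Rightarrow> ('m, 'e) tvec" where
  "cov_deriv A nab I x Y = (\<lambda>t c. if c \<in> charts_at A (x t)
     then vector_derivative (\<lambda>s. Y s c) (at t within I)
        + nab (coord_field A c (velocity A I x t c)) (coord_field A c (Y t c)) (x t) c
     else 0)"

text \<open>$D^k x/dt^k$ for \<open>k \<ge> 1\<close>, the \<open>(k - 1)\<close>-st covariant derivative of the velocity.\<close>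

definition cov_power ::
    "('m, 'e::euclidean_space) chart set \<Rightarrow>
     (('m \<Rightarrow> ('m, 'e) tvec) \<Rightarrow> ('m \<Rightarrow> ('m, 'e) tvec) \<Rightarrow> 'm \<Rightarrow> ('m, 'e) tvec) \<Rightarrow>
     real set \<Rightarrow> (real \<Rightarrow> 'm) \<Rightarrow> nat \<Rightarrow> real \<Rightarrow> ('m, 'e) tvec" where
  "cov_power A nab I x k = ((cov_deriv A nab I x) ^^ (k - 1)) (velocity A I x)"


section \<open>The variational problem\<close>

text \<open>\<open>T i\<close> are the times $T_0 < \dots < T_N$, with $T_0 = 0$, and \<open>pt i\<close> are the interpolation points.\<close>

definition admissible ::
    "('m::topological_space, 'e::euclidean_space) chart set \<Rightarrow> nat \<Rightarrow> (nat \<Rightarrow> real) \<Rightarrow>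
     (nat \<Rightarrow> 'm) \<Rightarrow> ('m, 'e) tvec \<Rightarrow> ('m, 'e) tvec \<Rightarrow> (real \<Rightarrow> 'm) set" where
  "admissible A N T pt v0 vN = {x.
     Ck_map A 1 {0..T N} x \<and> (\<forall>i\<in>{1..N}. Ck_map A \<infinity> {T (i - 1)..T i} x) \<and>
     (\<forall>i\<in>{1..<N}. x (T i) = pt i) \<and> x 0 = pt 0 \<and> x (T N) = pt N \<and>
     velocity A {0..T N} x 0 = v0 \<and> velocity A {0..T N} x (T N) = vN}"

definition admissible_variation ::
    "('m::topological_space, 'e::euclidean_space) chart set \<Rightarrow> nat \<Rightarrow> (nat \<Rightarrow> real) \<Rightarrow>
     (nat \<Rightarrow> 'm) \<Rightarrow> ('m, 'e) tvec \<Rightarrow> ('m, 'e) tvec \<Rightarrow> (real \<Rightarrow> 'm) \<Rightarrow>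
     (real \<Rightarrow> real \<Rightarrow> 'm) \<Rightarrow> bool" where
  "admissible_variation A N T pt v0 vN x \<alpha> \<longleftrightarrow> (\<exists>\<epsilon>>0.
     Ck_map A 1 ({-\<epsilon><..<\<epsilon>} \<times> {0..T N}) (\<lambda>(r, t). \<alpha> r t) \<and>
     (\<forall>i\<in>{1..N}. Ck_map A \<infinity> ({-\<epsilon><..<\<epsilon>} \<times> {T (i - 1)..T i}) (\<lambda>(r, t). \<alpha> r t)) \<and>
     (\<forall>t\<in>{0..T N}. \<alpha> 0 t = x t) \<and>
     (\<forall>r\<in>{-\<epsilon><..<\<epsilon>}. \<alpha> r \<in> admissible A N T pt v0 vN))"

definition extremizer ::
    "('m::topological_space, 'e::euclidean_space) chart set \<Rightarrow> nat \<Rightarrow> (nat \<Rightarrow> real) \<Rightarrow>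
     (nat \<Rightarrow> 'm) \<Rightarrow> ('m, 'e) tvec \<Rightarrow> ('m, 'e) tvec \<Rightarrow> ((real \<Rightarrow> 'm) \<Rightarrow> real) \<Rightarrow>
     (real \<Rightarrow> 'm) \<Rightarrow> bool" where
  "extremizer A N T pt v0 vN J x \<longleftrightarrow> x \<in> admissible A N T pt v0 vN \<and>
     (\<forall>\<alpha>. admissible_variation A N T pt v0 vN x \<alpha> \<longrightarrow>
        ((\<lambda>r. J (\<alpha> r)) has_real_derivative 0) (at 0))"

text \<open>The functional \<open>J\<close> on curves defined on \<open>[0, b]\<close>.  For an admissible curve $D^2x/dt^2$ may fail
  to exist at the finitely many times \<open>T i\<close>, which does not affect the integral.\<close>

definition action ::
    "('m, 'e::euclidean_space) chart set \<Rightarrow>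
     ('m \<Rightarrow> ('m, 'e) tvec \<Rightarrow> ('m, 'e) tvec \<Rightarrow> real) \<Rightarrow>
     (('m \<Rightarrow> ('m, 'e) tvec) \<Rightarrow> ('m \<Rightarrow> ('m, 'e) tvec) \<Rightarrow> 'm \<Rightarrow> ('m, 'e) tvec) \<Rightarrow>
     real \<Rightarrow> ('m \<Rightarrow> real) \<Rightarrow> real \<Rightarrow> (real \<Rightarrow> 'm) \<Rightarrow> real" where
  "action A g nab \<sigma> V b x = integral {0..b} (\<lambda>t. 1/2 *
     ((tnorm g (x t) (cov_power A nab {0..b} x 2 t))\<^sup>2
      + \<sigma> * (tnorm g (x t) (cov_power A nab {0..b} x 1 t))\<^sup>2
      + V (x t)))"

end

theory Submission
  imports Defs "HOL-Real_Asymp.Real_Asymp"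
begin

text \<open>The curve is varied inside one chart and over a short time interval.  If \<open>x\<close> maps \<open>[a, b]\<close> into
  the domain of a chart \<open>c\<close> and \<open>y\<close> is its coordinate expression, then \<open>y + r\<phi>\<close> for a smooth \<open>\<phi>\<close>
  supported in \<open>(a, b)\<close> and vanishing at the interior knots is an admissible variation for small \<open>r\<close>
  (lemma \<open>vary_admissible\<close>), so that the derivative of the action along it vanishes.

  In the chart the Levi-Civita connection is $D_tP = P' + \Gamma(y', P)$ with \<open>\<Gamma>\<close> symmetric and
  compatible with the metric coefficients \<open>G\<close>.  Write \<open>Y\<close>, \<open>A\<close>, \<open>B\<close>, \<open>C\<close> for the
  components of $D^kx/dt^k$, $k = 1, \dots, 4$.  Exchanging the derivatives in \<open>r\<close> and \<open>t\<close> costs a curvature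
  term, which the pair symmetry of the curvature moves off \<open>\<phi>\<close>, and the derivative of the action is
  \[ \int G(A, D_t^2\phi) + G(R(A, Y)Y, \phi) + \sigma\, G(Y, D_t\phi) + \frac12 dV(\phi)\,dt . \]
  Two integrations by parts on each side of a knot turn this into
  \[ \Big[G(A, D_t\phi) - G(B, \phi) + \sigma\, G(Y, \phi)\Big]
     + \int G\big(C + R(A, Y)Y - \sigma A + \frac12 \mathrm{grad}\,V, \phi\big)\,dt \]
  (lemma \<open>first_variation\<close>).  A bump function times a constant vector, supported inside a cell
  between two knots, yields the equation in the interior of the cell (\<open>el_interior\<close>), and continuity
  extends it to the closed cell (\<open>el_zero\<close>).  At an interior knot \<open>\<phi>\<close> must vanish but its derivative
  is free; since the integrals are now known to vanish, the boundary terms force \<open>A\<close> to be the same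
  from both sides (\<open>no_corner\<close>).  As \<open>x\<close> is $C^1$, its second derivative in the chart is then
  continuous, that is, \<open>x\<close> is $C^2$.

  The link between the manifold and the chart is made by three facts: the connection, being local
  and a derivation, is determined by its Christoffel symbols (\<open>nab_chart\<close>); these satisfy the
  hypotheses of the computation in coordinates (\<open>chart_geometry\<close>); and the components of
  $D^2x/dt^2$ in different charts form a tangent vector, so that the integrand of the action may be
  computed in any one chart (\<open>integrand_chart\<close>).\<close>


section \<open>Calculus of $C^k$ maps\<close>

lemma frechet_derivative_cong_open:
  assumes "open W" "p \<in> W" "\<And>q. q \<in> W \<Longrightarrow> f q = g q"
  shows "frechet_derivative f (at p) = frechet_derivative g (at p)"
proof -
  have "(f has_derivative D) (at p) \<longleftrightarrow> (g has_derivative D) (at p)" for D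
    using assms has_derivative_transform_within_open[of f D p UNIV W g]
      has_derivative_transform_within_open[of g D p UNIV W f] by auto
  then show ?thesis unfolding frechet_derivative_def by simp
qed

lemma differentiable_cong_open:
  assumes "open W" "p \<in> W" "\<And>q. q \<in> W \<Longrightarrow> f q = g q"
  shows "f differentiable (at p) \<longleftrightarrow> g differentiable (at p)"
  using assms has_derivative_transform_within_open[of f _ p UNIV W g]
      has_derivative_transform_within_open[of g _ p UNIV W f]
  unfolding differentiable_def by metis

lemma has_derivative_frechet:
  "f differentiable (at p) \<Longrightarrow> (f has_derivative frechet_derivative f (at p)) (at p)"
  by (simp add: frechet_derivative_works)

lemma frechet_derivativeI:
  "(f has_derivative D) (at p) \<Longrightarrow> frechet_derivative f (at p) = D"
  using frechet_derivative_at by metis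

lemma Ck_open_cong:
  assumes "open W" "\<And>p. p \<in> W \<Longrightarrow> f p = g p"
  shows "Ck_open k W f \<longleftrightarrow> Ck_open k W g"
  using assms(2)
proof (induction k arbitrary: f g)
  case 0
  then show ?case by (simp cong: continuous_on_cong)
next
  case (Suc k)
  have "Ck_open k W (\<lambda>p. frechet_derivative f (at p) v)
      = Ck_open k W (\<lambda>p. frechet_derivative g (at p) v)" for v
    by (rule Suc.IH) (use frechet_derivative_cong_open[OF assms(1) _ Suc.prems] in simp)
  moreover have "(\<forall>p\<in>W. f differentiable at p) = (\<forall>p\<in>W. g differentiable at p)"
    using differentiable_cong_open[OF assms(1) _ Suc.prems] by auto
  ultimately show ?case by simp
qed

lemma Ck_open_subset: "Ck_open k W f \<Longrightarrow> W' \<subseteq> W \<Longrightarrow> Ck_open k W' f"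
  by (induction k arbitrary: f) (auto intro: continuous_on_subset)

lemma Ck_open_continuous_on: "Ck_open k W f \<Longrightarrow> continuous_on W f"
proof (cases k)
  case (Suc j)
  assume "Ck_open k W f"
  with Suc show ?thesis
    by (auto intro!: differentiable_imp_continuous_on differentiable_at_imp_differentiable_on)
qed simp

lemma Ck_open_SucD: "Ck_open (Suc k) W f \<Longrightarrow> Ck_open k W f"
proof (induction k arbitrary: f)
  case 0
  then show ?case by (simp add: Ck_open_continuous_on[of "Suc 0"])
next
  case (Suc k)
  have "Ck_open (Suc k) W (\<lambda>p. frechet_derivative f (at p) v)" for v
    using Suc.prems by (simp only: Ck_open.simps(2)[of "Suc k"])
  moreover have "\<forall>p\<in>W. f differentiable at p"
    using Suc.prems by (rule Ck_open.simps(2)[THEN iffD1, THEN conjunct1])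
  ultimately show ?case using Suc.IH by simp
qed

lemma Ck_open_mono: "Ck_open k W f \<Longrightarrow> j \<le> k \<Longrightarrow> Ck_open j W f"
  by (induction k) (auto simp: le_Suc_eq dest: Ck_open_SucD simp del: Ck_open.simps)

lemma Ck_open_const: "Ck_open k W (\<lambda>p. c)"
  by (induction k arbitrary: c) auto

lemma Ck_open_SucI:
  assumes "open W" "\<And>p. p \<in> W \<Longrightarrow> (f has_derivative D p) (at p)"
    and "\<And>v. Ck_open k W (\<lambda>p. D p v)"
  shows "Ck_open (Suc k) W f"
proof -
  have "Ck_open k W (\<lambda>p. frechet_derivative f (at p) v)" for v
    using Ck_open_cong[OF assms(1), of "\<lambda>p. frechet_derivative f (at p) v" "\<lambda>p. D p v" k]
      frechet_derivativeI[OF assms(2)] assms(3) by simp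
  then show ?thesis using assms(2) by (auto simp: differentiable_def)
qed

lemma Ck_open_Suc_derivative:
  assumes "Ck_open (Suc k) W f" "p \<in> W"
  shows "(f has_derivative frechet_derivative f (at p)) (at p)"
  using assms by (simp add: has_derivative_frechet)

lemma Ck_open_frechet:
  assumes "Ck_open (Suc k) W f"
  shows "Ck_open k W (\<lambda>p. frechet_derivative f (at p) v)"
  using assms by simp

lemma Ck_open_bounded_linear:
  assumes "open W" "bounded_linear L" "Ck_open k W f"
  shows "Ck_open k W (\<lambda>p. L (f p))"
  using assms(3)
proof (induction k arbitrary: f)
  case 0
  then show ?case
    using bounded_linear.continuous_on[OF assms(2)] by auto
next
  case (Suc k)
  show ?case
    by (rule Ck_open_SucI[OF assms(1)
          bounded_linear.has_derivative[OF assms(2) Ck_open_Suc_derivative[OF Suc.prems]]])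
       (auto intro: Suc.IH Ck_open_frechet[OF Suc.prems])
qed

lemma Ck_open_add:
  assumes "open W" "Ck_open k W f" "Ck_open k W g"
  shows "Ck_open k W (\<lambda>p. f p + g p)"
  using assms(2,3)
proof (induction k arbitrary: f g)
  case 0
  then show ?case by (auto intro: continuous_on_add)
next
  case (Suc k)
  show ?case
    by (rule Ck_open_SucI[OF assms(1)
          has_derivative_add[OF Ck_open_Suc_derivative[OF Suc.prems(1)]
            Ck_open_Suc_derivative[OF Suc.prems(2)]]])
       (auto intro: Suc.IH Ck_open_frechet[OF Suc.prems(1)] Ck_open_frechet[OF Suc.prems(2)])
qed

lemma Ck_open_sum:
  assumes "open W" "\<And>i. i \<in> I \<Longrightarrow> Ck_open k W (f i)"
  shows "Ck_open k W (\<lambda>p. \<Sum>i\<in>I. f i p)"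
  using assms(2)
  by (induction I rule: infinite_finite_induct) (auto intro!: Ck_open_const Ck_open_add[OF assms(1)])

lemma Ck_open_bounded_bilinear:
  assumes "open W" "bounded_bilinear B" "Ck_open k W f" "Ck_open k W g"
  shows "Ck_open k W (\<lambda>p. B (f p) (g p))"
  using assms(3,4)
proof (induction k arbitrary: f g)
  case 0
  then show ?case
    using bounded_bilinear.continuous_on[OF assms(2)] by auto
next
  case (Suc k)
  show ?case
    by (rule Ck_open_SucI[OF assms(1)
          bounded_bilinear.FDERIV[OF assms(2) Ck_open_Suc_derivative[OF Suc.prems(1)]
            Ck_open_Suc_derivative[OF Suc.prems(2)]]])
       (auto intro!: Suc.IH Ck_open_add[OF assms(1)] Ck_open_frechet[OF Suc.prems(1)]
         Ck_open_frechet[OF Suc.prems(2)] intro: Ck_open_SucD Suc.prems)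
qed

text \<open>By induction on \<open>k\<close>: the chain rule writes the directional derivative of \<open>f \<circ> g\<close> as a sum over a
  basis of products of a component of the derivative of \<open>g\<close> and a composite
  of one order less.\<close>

lemma Ck_open_compose:
  assumes "open W" "open W'" "Ck_open k W g" "Ck_open k W' f" "g ` W \<subseteq> W'"
  shows "Ck_open k W (\<lambda>p. f (g p))"
  using assms(3,4)
proof (induction k arbitrary: f)
  case 0
  then show ?case using assms(5) by (auto intro: continuous_on_compose2)
next
  case (Suc k)
  let ?D = "\<lambda>p v. \<Sum>i\<in>Basis. (frechet_derivative g (at p) v \<bullet> i) *\<^sub>R frechet_derivative f (at (g p)) i"
  have der: "((\<lambda>p. f (g p)) has_derivative ?D p) (at p)" if "p \<in> W" for p
  proof -
    have f': "(f has_derivative frechet_derivative f (at (g p))) (at (g p))"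
      using Ck_open_Suc_derivative[OF Suc.prems(2)] that assms(5) by auto
    interpret f': bounded_linear "frechet_derivative f (at (g p))"
      using f' has_derivative_bounded_linear by blast
    have "frechet_derivative f (at (g p)) w = (\<Sum>i\<in>Basis. (w \<bullet> i) *\<^sub>R frechet_derivative f (at (g p)) i)" for w
      by (subst euclidean_representation[of w, symmetric]) (simp only: f'.sum f'.scaleR)
    from this[symmetric] have "?D p = (\<lambda>v. frechet_derivative f (at (g p)) (frechet_derivative g (at p) v))"
      by (rule ext)
    then show ?thesis
      using has_derivative_compose[OF Ck_open_Suc_derivative[OF Suc.prems(1) that] f'] by simp
  qed
  show ?case
    by (rule Ck_open_SucI[OF assms(1) der])
       (auto intro!: Ck_open_sum[OF assms(1)] Ck_open_bounded_bilinear[OF assms(1) bounded_bilinear_scaleR]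
          Ck_open_bounded_linear[OF assms(1) bounded_linear_inner_left] Ck_open_frechet[OF Suc.prems(1)]
          Suc.IH Ck_open_frechet[OF Suc.prems(2)] Ck_open_SucD[OF Suc.prems(1)])
qed

lemma Ck_open_ident: "open W \<Longrightarrow> Ck_open k W (\<lambda>p. p)"
  by (cases k) (auto intro: Ck_open_const)

lemma Ck_open_SucI_vector:
  fixes W :: "real set"
  assumes "open W" "\<And>t. t \<in> W \<Longrightarrow> (f has_vector_derivative f' t) (at t)" "Ck_open k W f'"
  shows "Ck_open (Suc k) W f"
  by (rule Ck_open_SucI[OF assms(1) assms(2)[unfolded has_vector_derivative_def]])
     (auto intro: Ck_open_bounded_linear[OF assms(1) bounded_linear_scaleR_right assms(3)])


lemma Ck_onI_open:
  assumes "open W" "\<And>j. enat j \<le> k \<Longrightarrow> Ck_open j W f"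
  shows "Ck_on k W f"
  unfolding Ck_on_def
proof
  fix p assume "p \<in> W"
  with assms show "\<exists>W' h. open W' \<and> p \<in> W' \<and>
     (\<forall>j. enat j \<le> k \<longrightarrow> Ck_open j W' h) \<and> (\<forall>q\<in>W' \<inter> W. f q = h q)"
    by (intro exI[of _ W] exI[of _ f]) simp
qed

lemma Ck_onE:
  assumes "Ck_on k S f" "p \<in> S"
  obtains W h where "open W" "p \<in> W" "\<And>j. enat j \<le> k \<Longrightarrow> Ck_open j W h"
    "\<And>q. q \<in> W \<Longrightarrow> q \<in> S \<Longrightarrow> f q = h q"
proof -
  from assms(1)[unfolded Ck_on_def, rule_format, OF assms(2)]
  obtain W h where "open W" "p \<in> W" "\<forall>j. enat j \<le> k \<longrightarrow> Ck_open j W h" "\<forall>q\<in>W \<inter> S. f q = h q"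
    by (elim exE conjE)
  then show thesis by (intro that[of W h]) simp_all
qed

lemma Ck_onI:
  assumes "\<And>p. p \<in> S \<Longrightarrow> \<exists>W h. open W \<and> p \<in> W \<and>
     (\<forall>j. enat j \<le> k \<longrightarrow> Ck_open j W h) \<and> (\<forall>q\<in>W \<inter> S. f q = h q)"
  shows "Ck_on k S f"
  unfolding Ck_on_def by (rule ballI) (rule assms)

lemma Ck_open_local:
  assumes "\<And>p. p \<in> W \<Longrightarrow> \<exists>W'. open W' \<and> p \<in> W' \<and> Ck_open k W' f"
  shows "Ck_open k W f"
  using assms
proof (induction k arbitrary: f)
  case 0
  have "continuous (at p) f" if "p \<in> W" for p
    using 0[OF that] by (auto simp: continuous_on_eq_continuous_at)
  then show ?case by (simp add: continuous_at_imp_continuous_on)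
next
  case (Suc k)
  have "f differentiable at p" if "p \<in> W" for p
    using Suc.prems[OF that] by auto
  moreover have "Ck_open k W (\<lambda>p. frechet_derivative f (at p) v)" for v
  proof (rule Suc.IH)
    fix p assume "p \<in> W"
    from Suc.prems[OF this] obtain W' where "open W'" "p \<in> W'" "Ck_open (Suc k) W' f"
      by (elim exE conjE)
    then show "\<exists>W'. open W' \<and> p \<in> W' \<and> Ck_open k W' (\<lambda>p. frechet_derivative f (at p) v)"
      by (intro exI[of _ W']) simp
  qed
  ultimately show ?case by simp
qed

text \<open>On an open set the local extensions agree with the map itself near each point.\<close>

lemma Ck_on_open_imp_Ck_open:
  assumes "open W" "Ck_on k W f" "enat j \<le> k"
  shows "Ck_open j W f"
proof (rule Ck_open_local)
  fix p assume "p \<in> W"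
  from Ck_onE[OF assms(2) this] obtain W' h where h: "open W'" "p \<in> W'"
    "\<And>j. enat j \<le> k \<Longrightarrow> Ck_open j W' h" "\<And>q. q \<in> W' \<Longrightarrow> q \<in> W \<Longrightarrow> f q = h q" by metis
  have "Ck_open j (W' \<inter> W) f"
    using Ck_open_cong[of "W' \<inter> W" f h j] Ck_open_subset[OF h(3)[OF assms(3)], of "W' \<inter> W"] h(1,4) assms(1)
    by (auto simp: open_Int)
  then show "\<exists>W'. open W' \<and> p \<in> W' \<and> Ck_open j W' f"
    using h(1,2) assms(1) \<open>p \<in> W\<close> by (intro exI[of _ "W' \<inter> W"]) auto
qed

lemma Ck_on_subset:
  assumes "Ck_on k S f" "S' \<subseteq> S"
  shows "Ck_on k S' f"
proof (rule Ck_onI)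
  fix p assume "p \<in> S'"
  with assms(2) have "p \<in> S" by blast
  then obtain W h where "open W" "p \<in> W" "\<And>j. enat j \<le> k \<Longrightarrow> Ck_open j W h"
    "\<And>q. q \<in> W \<Longrightarrow> q \<in> S \<Longrightarrow> f q = h q" using Ck_onE[OF assms(1)] by metis
  with assms(2) show "\<exists>W h. open W \<and> p \<in> W \<and>
     (\<forall>j. enat j \<le> k \<longrightarrow> Ck_open j W h) \<and> (\<forall>q\<in>W \<inter> S'. f q = h q)"
    by (intro exI[of _ W] exI[of _ h]) auto
qed

lemma Ck_on_mono: "Ck_on k S f \<Longrightarrow> j \<le> k \<Longrightarrow> Ck_on j S f"
  unfolding Ck_on_def using order_trans[of _ j k] by fast

lemma Ck_on_cong: "(\<And>p. p \<in> S \<Longrightarrow> f p = g p) \<Longrightarrow> Ck_on k S f \<longleftrightarrow> Ck_on k S g"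
  unfolding Ck_on_def by simp

text \<open>Near a given point, smoothness on \<open>S\<close> and on a relatively open part of \<open>S\<close> are the same.  This
  permits different formulas for a map on different parts of its domain.\<close>

lemma Ck_on_local:
  assumes "\<And>p. p \<in> S \<Longrightarrow> \<exists>W. open W \<and> p \<in> W \<and> Ck_on k (S \<inter> W) f"
  shows "Ck_on k S f"
proof (rule Ck_onI)
  fix p assume "p \<in> S"
  with assms obtain W where W: "open W" "p \<in> W" "Ck_on k (S \<inter> W) f" by blast
  then obtain W' h where "open W'" "p \<in> W'" "\<And>j. enat j \<le> k \<Longrightarrow> Ck_open j W' h"
    "\<And>q. q \<in> W' \<Longrightarrow> q \<in> S \<inter> W \<Longrightarrow> f q = h q" using Ck_onE[OF W(3), of p] \<open>p \<in> S\<close> by blast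
  with W show "\<exists>W h. open W \<and> p \<in> W \<and>
     (\<forall>j. enat j \<le> k \<longrightarrow> Ck_open j W h) \<and> (\<forall>q\<in>W \<inter> S. f q = h q)"
    by (intro exI[of _ "W \<inter> W'"] exI[of _ h]) (auto intro: Ck_open_subset)
qed

lemma continuous_on_local:
  fixes f :: "'a::t2_space \<Rightarrow> 'b::topological_space"
  assumes "\<And>p. p \<in> S \<Longrightarrow> \<exists>W. open W \<and> p \<in> W \<and> continuous_on (S \<inter> W) f"
  shows "continuous_on S f"
  unfolding continuous_on_eq_continuous_within
proof
  fix p assume p: "p \<in> S"
  with assms obtain W where W: "open W" "p \<in> W" "continuous_on (S \<inter> W) f" by blast
  have "at p within S \<inter> W = at p within S"
    by (rule at_within_nhd[OF W(2,1)]) auto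
  moreover have "continuous (at p within S \<inter> W) f"
    using W p by (simp add: continuous_on_eq_continuous_within)
  ultimately show "continuous (at p within S) f" by simp
qed

lemma Ck_on_continuous_on:
  assumes "Ck_on k S f"
  shows "continuous_on S f"
proof (rule continuous_on_local)
  fix p assume "p \<in> S"
  with assms obtain W h where h: "open W" "p \<in> W" "\<And>j. enat j \<le> k \<Longrightarrow> Ck_open j W h"
    "\<And>q. q \<in> W \<Longrightarrow> q \<in> S \<Longrightarrow> f q = h q" by (metis Ck_onE)
  have "continuous_on (S \<inter> W) f"
    using h(4) continuous_on_subset[OF Ck_open_continuous_on[OF h(3)[of 0]]]
    by (subst continuous_on_cong[OF refl, of _ f h]) (auto simp: zero_enat_def[symmetric])
  then show "\<exists>W. open W \<and> p \<in> W \<and> continuous_on (S \<inter> W) f" using h(1,2) by blast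
qed

lemma Ck_on_compose:
  assumes "Ck_on k S g" "Ck_on k S' f" "g ` S \<subseteq> S'"
  shows "Ck_on k S (\<lambda>p. f (g p))"
proof (rule Ck_onI)
  fix p assume p: "p \<in> S"
  obtain W h where h: "open W" "p \<in> W" "\<And>j. enat j \<le> k \<Longrightarrow> Ck_open j W h"
    "\<And>q. q \<in> W \<Longrightarrow> q \<in> S \<Longrightarrow> g q = h q" using Ck_onE[OF assms(1) p] by metis
  obtain W' h' where h': "open W'" "g p \<in> W'" "\<And>j. enat j \<le> k \<Longrightarrow> Ck_open j W' h'"
    "\<And>q. q \<in> W' \<Longrightarrow> q \<in> S' \<Longrightarrow> f q = h' q" using Ck_onE[OF assms(2), of "g p"] p assms(3) by blast
  have op: "open (W \<inter> h -` W')"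
    using continuous_open_preimage[OF Ck_open_continuous_on[OF h(3)[of 0]] h(1) h'(1)]
    by (simp add: zero_enat_def[symmetric])
  have "Ck_open j (W \<inter> h -` W') (\<lambda>q. h' (h q))" if "enat j \<le> k" for j
    by (rule Ck_open_compose[OF op h'(1) Ck_open_subset[OF h(3)] h'(3)]) (use that in auto)
  moreover have "\<forall>q\<in>W \<inter> h -` W' \<inter> S. f (g q) = h' (h q)"
    using h(4) h'(4) assms(3) by auto
  ultimately show "\<exists>W h. open W \<and> p \<in> W \<and>
     (\<forall>j. enat j \<le> k \<longrightarrow> Ck_open j W h) \<and> (\<forall>q\<in>W \<inter> S. f (g q) = h q)"
    using op h(2,4) h'(2) p by (intro exI[of _ "W \<inter> h -` W'"] exI[of _ "\<lambda>q. h' (h q)"]) auto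
qed

lemma Ck_on_compose_linear:
  assumes "Ck_on k S f" "bounded_linear L"
  shows "Ck_on k S (\<lambda>p. L (f p))"
proof -
  have "Ck_on k UNIV L"
    using Ck_open_bounded_linear[OF open_UNIV assms(2) Ck_open_ident[OF open_UNIV]]
    by (intro Ck_onI_open) simp_all
  then show ?thesis using Ck_on_compose[OF assms(1)] by auto
qed

lemma Ck_on_const: "Ck_on k S (\<lambda>p. c)"
  by (rule Ck_on_subset[OF Ck_onI_open[of UNIV]]) (auto intro: Ck_open_const)

lemma Ck_on_pointwise:
  fixes S :: "'a::euclidean_space set" and f :: "'a \<Rightarrow> 'b::euclidean_space"
    and g :: "'a \<Rightarrow> 'c::euclidean_space" and B :: "'b \<Rightarrow> 'c \<Rightarrow> 'd::euclidean_space"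
  assumes "\<And>(W::'a set) j f g. open W \<Longrightarrow> Ck_open j W f \<Longrightarrow> Ck_open j W g \<Longrightarrow> Ck_open j W (\<lambda>p. B (f p) (g p))"
    and "Ck_on k S f" "Ck_on k S g"
  shows "Ck_on k S (\<lambda>p. B (f p) (g p))"
proof (rule Ck_onI)
  fix p assume p: "p \<in> S"
  obtain W h where h: "open W" "p \<in> W" "\<And>j. enat j \<le> k \<Longrightarrow> Ck_open j W h"
    "\<And>q. q \<in> W \<Longrightarrow> q \<in> S \<Longrightarrow> f q = h q" using Ck_onE[OF assms(2) p] by metis
  obtain W' h' where h': "open W'" "p \<in> W'" "\<And>j. enat j \<le> k \<Longrightarrow> Ck_open j W' h'"
    "\<And>q. q \<in> W' \<Longrightarrow> q \<in> S \<Longrightarrow> g q = h' q" using Ck_onE[OF assms(3) p] by metis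
  have "Ck_open j (W \<inter> W') (\<lambda>q. B (h q) (h' q))" if "enat j \<le> k" for j
    by (rule assms(1)[OF _ Ck_open_subset[OF h(3)] Ck_open_subset[OF h'(3)]])
       (use that h(1) h'(1) in auto)
  then show "\<exists>W h. open W \<and> p \<in> W \<and>
     (\<forall>j. enat j \<le> k \<longrightarrow> Ck_open j W h) \<and> (\<forall>q\<in>W \<inter> S. B (f q) (g q) = h q)"
    using h h' by (intro exI[of _ "W \<inter> W'"] exI[of _ "\<lambda>q. B (h q) (h' q)"]) auto
qed

lemma Ck_on_bounded_bilinear:
  "bounded_bilinear B \<Longrightarrow> Ck_on k S f \<Longrightarrow> Ck_on k S g \<Longrightarrow> Ck_on k S (\<lambda>p. B (f p) (g p))"
  by (rule Ck_on_pointwise) (rule Ck_open_bounded_bilinear)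

lemma Ck_on_add: "Ck_on k S f \<Longrightarrow> Ck_on k S g \<Longrightarrow> Ck_on k S (\<lambda>p. f p + g p)"
  by (rule Ck_on_pointwise) (rule Ck_open_add)

lemma Ck_on_sum:
  assumes "\<And>i. i \<in> I \<Longrightarrow> Ck_on k S (f i)"
  shows "Ck_on k S (\<lambda>p. \<Sum>i\<in>I. f i p)"
  using assms
  by (induction I rule: infinite_finite_induct) (auto intro!: Ck_on_const Ck_on_add)

text \<open>For a curve parametrised by a set without isolated points, derivatives within that set are
  derivatives of any local extension, so that the derivative is again of class $C^k$.\<close>

lemma Ck_on_vector_derivative:
  fixes S :: "real set"
  assumes "Ck_on (eSuc k) S f" and lim: "\<And>t. t \<in> S \<Longrightarrow> at t within S \<noteq> bot"
  shows "\<And>t. t \<in> S \<Longrightarrow> (f has_vector_derivative vector_derivative f (at t within S)) (at t within S)"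
    and "Ck_on k S (\<lambda>t. vector_derivative f (at t within S))"
proof -
  have loc: "\<exists>W h. open W \<and> t \<in> W \<and>
     (\<forall>j. enat j \<le> k \<longrightarrow> Ck_open j W h) \<and> (\<forall>s\<in>W \<inter> S. (f has_vector_derivative h s) (at s within S))"
    if t: "t \<in> S" for t
  proof -
    obtain W h where h: "open W" "t \<in> W" "\<And>j. enat j \<le> eSuc k \<Longrightarrow> Ck_open j W h"
      "\<And>q. q \<in> W \<Longrightarrow> q \<in> S \<Longrightarrow> f q = h q" using Ck_onE[OF assms(1) t] by metis
    have hS: "Ck_open (Suc j) W h" if "enat j \<le> k" for j
      using h(3)[of "Suc j"] that by (simp flip: eSuc_enat del: Ck_open.simps)
    have h0: "Ck_open (Suc 0) W h" using hS[of 0] by (simp flip: zero_enat_def del: Ck_open.simps)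
    have "(f has_vector_derivative frechet_derivative h (at s) 1) (at s within S)" if s: "s \<in> W \<inter> S" for s
    proof -
      have "(h has_vector_derivative frechet_derivative h (at s) 1) (at s)"
        unfolding has_vector_derivative_def
      proof (rule has_derivative_eq_rhs[OF Ck_open_Suc_derivative[OF h0]])
        show "s \<in> W" using s by simp
        then have "linear (frechet_derivative h (at s))"
          using Ck_open_Suc_derivative[OF h0] has_derivative_linear by blast
        show "frechet_derivative h (at s) = (\<lambda>x. x *\<^sub>R frechet_derivative h (at s) 1)"
        proof
          fix x :: real
          show "frechet_derivative h (at s) x = x *\<^sub>R frechet_derivative h (at s) 1"
            using linear_scale[OF \<open>linear (frechet_derivative h (at s))\<close>, of x 1] by simp
        qed
      qed
      then have 1: "(h has_vector_derivative frechet_derivative h (at s) 1) (at s within S)"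
        by (rule has_vector_derivative_at_within)
      have "eventually (\<lambda>x. x \<in> S \<longrightarrow> f x = h x) (nhds s)"
        using eventually_nhds_in_open[OF h(1), of s] s h(4) by (auto elim: eventually_mono)
      from has_vector_derivative_cong_ev[OF this] 1 h(4) s show ?thesis by auto
    qed
    moreover have "Ck_open j W (\<lambda>s. frechet_derivative h (at s) 1)" if "enat j \<le> k" for j
      using Ck_open_frechet[OF hS[OF that]] .
    ultimately show ?thesis using h(1,2) by (intro exI[of _ W] exI[of _ "\<lambda>s. frechet_derivative h (at s) 1"]) simp
  qed
  show 1: "(f has_vector_derivative vector_derivative f (at t within S)) (at t within S)" if "t \<in> S" for t
    using loc[OF that] vector_derivative_works that differentiableI_vector by blast
  show "Ck_on k S (\<lambda>t. vector_derivative f (at t within S))"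
  proof (rule Ck_onI)
    fix t assume "t \<in> S"
    from loc[OF this] obtain W h where h: "open W" "t \<in> W" "\<forall>j. enat j \<le> k \<longrightarrow> Ck_open j W h"
       "\<forall>s\<in>W \<inter> S. (f has_vector_derivative h s) (at s within S)" by blast
    have "\<forall>s\<in>W \<inter> S. vector_derivative f (at s within S) = h s"
      using h(4) lim vector_derivative_within by blast
    with h(1-3) show "\<exists>W h. open W \<and> t \<in> W \<and> (\<forall>j. enat j \<le> k \<longrightarrow> Ck_open j W h) \<and>
       (\<forall>s\<in>W \<inter> S. vector_derivative f (at s within S) = h s)" by blast
  qed
qed


section \<open>A smooth bump function\<close>

text \<open>The powers of \<open>t\<close> make the family closed under differentiation up to linear combinations, so that
  one induction proves all its members smooth.\<close>

definition flat_exp :: "nat \<Rightarrow> real \<Rightarrow> real" where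
  "flat_exp k t = (if 0 < t then exp (- 1 / t) / t ^ k else 0)"

lemma flat_exp_tendsto: "(flat_exp k \<longlongrightarrow> 0) (at 0)"
proof -
  have "((\<lambda>t. exp (- 1 / t) / t ^ k) \<longlongrightarrow> 0) (at_right (0::real))"
    by real_asymp
  then have r: "(flat_exp k \<longlongrightarrow> 0) (at_right 0)"
    by (rule Lim_transform_eventually)
       (auto simp: eventually_at_right_field flat_exp_def intro!: exI[of _ 1])
  have "(flat_exp k \<longlongrightarrow> 0) (at_left 0)"
    by (rule tendsto_eventually) (auto simp: eventually_at_left_field flat_exp_def intro!: exI[of _ "-1"])
  with r show ?thesis by (simp add: filterlim_split_at)
qed

lemma flat_exp_derivative:
  "(flat_exp k has_real_derivative flat_exp (k + 2) t - real k * flat_exp (k + 1) t) (at t)"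
proof (cases t "0::real" rule: linorder_cases)
  case less
  have "((\<lambda>t. 0) has_real_derivative flat_exp (k + 2) t - real k * flat_exp (k + 1) t) (at t)"
    using less by (simp add: flat_exp_def)
  then show ?thesis
    by (rule has_field_derivative_transform_within_open[where S="{..<0}"]) (use less in \<open>auto simp: flat_exp_def\<close>)
next
  case equal
  have "((\<lambda>h. flat_exp k h / h) \<longlongrightarrow> 0) (at 0)"
    using flat_exp_tendsto[of "k + 1"]
    by (rule Lim_transform_eventually) (auto simp: flat_exp_def eventually_at_filter)
  then show ?thesis using equal by (simp add: DERIV_def flat_exp_def)
next
  case greater
  have "((\<lambda>t. exp (- 1 / t) / t ^ k) has_real_derivative flat_exp (k + 2) t - real k * flat_exp (k + 1) t) (at t)"
    using greater
    apply (cases k)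
     apply (auto intro!: derivative_eq_intros simp: flat_exp_def field_simps power2_eq_square)
    subgoal for n by (cases n) auto
    done
  then show ?thesis
    by (rule has_field_derivative_transform_within_open[where S="{0<..}"]) (use greater in \<open>auto simp: flat_exp_def\<close>)
qed

lemma flat_exp_Ck: "Ck_open j UNIV (flat_exp k)"
proof (induction j arbitrary: k)
  case 0
  then show ?case
    using flat_exp_derivative DERIV_isCont by (fastforce simp: continuous_on_eq_continuous_at)
next
  case (Suc j)
  have "Ck_open j UNIV (\<lambda>t. flat_exp (k + 2) t + (- real k) *\<^sub>R flat_exp (k + 1) t)"
    by (intro Ck_open_add Ck_open_bounded_linear[OF _ bounded_linear_scaleR_right] Suc.IH) auto
  then show ?case
    by (intro Ck_open_SucI_vector[where f'="\<lambda>t. flat_exp (k + 2) t + (- real k) *\<^sub>R flat_exp (k + 1) t"])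
       (use flat_exp_derivative[of k] in \<open>auto simp: has_real_derivative_iff_has_vector_derivative\<close>)
qed

lemma smooth_bump:
  fixes a b :: real
  obtains \<beta> :: "real \<Rightarrow> real" where "\<And>j. Ck_open j UNIV \<beta>" "\<And>t. 0 \<le> \<beta> t"
    "\<And>t. 0 < \<beta> t \<longleftrightarrow> a < t \<and> t < b"
proof
  let ?b = "\<lambda>t. flat_exp 0 (t - a) * flat_exp 0 (b - t)"
  have l: "Ck_open j UNIV (\<lambda>t. t - a)" "Ck_open j UNIV (\<lambda>t. b - t)" for j
    using Ck_open_add[OF open_UNIV Ck_open_ident[OF open_UNIV] Ck_open_const, of j "- a"]
      Ck_open_add[OF open_UNIV Ck_open_const[of j UNIV b]
        Ck_open_bounded_linear[OF open_UNIV bounded_linear_minus[OF bounded_linear_ident] Ck_open_ident[OF open_UNIV]]]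
    by auto
  show "Ck_open j UNIV ?b" for j
    by (intro Ck_open_bounded_bilinear[OF open_UNIV bounded_bilinear_mult]
         Ck_open_compose[OF open_UNIV open_UNIV l(1) flat_exp_Ck]
         Ck_open_compose[OF open_UNIV open_UNIV l(2) flat_exp_Ck]) auto
  show "0 \<le> ?b t" "0 < ?b t \<longleftrightarrow> a < t \<and> t < b" for t
    by (auto simp: flat_exp_def)
qed


section \<open>Symmetry of second derivatives\<close>

text \<open>Differentiating $f(q + su + tv) - f(q - eu + tv) = \int_{-e}^s D_uf(q + \sigma u + tv)\,d\sigma$
  first in \<open>t\<close>, under the integral, and then in \<open>s\<close> gives $D_uD_vf = D_vD_uf$.\<close>

lemma second_derivative_symmetric:
  fixes f :: "'a::euclidean_space \<Rightarrow> real"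
  assumes W: "open W" and q: "q \<in> W" and f: "Ck_open 2 W f"
  shows "frechet_derivative (\<lambda>p. frechet_derivative f (at p) u) (at q) v
       = frechet_derivative (\<lambda>p. frechet_derivative f (at p) v) (at q) u"
proof -
  obtain r where r: "r > 0" "ball q r \<subseteq> W" using W q open_contains_ball by blast
  define e where "e = r / (norm u + norm v + 1)"
  have pos: "norm u + norm v + 1 > 0" by (simp add: add_nonneg_pos)
  then have e: "e > 0" using r by (simp add: e_def)
  define pt where "pt s t = q + s *\<^sub>R u + t *\<^sub>R v" for s t
  have ptW: "pt s t \<in> W" if "\<bar>s\<bar> \<le> e" "\<bar>t\<bar> \<le> e" for s t
  proof -
    have "norm (s *\<^sub>R u + t *\<^sub>R v) \<le> e * norm u + e * norm v"
      by (rule order_trans[OF norm_triangle_ineq]) (use that in \<open>auto intro!: add_mono mult_right_mono\<close>)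
    also have "\<dots> = r - e"
    proof -
      have "e * (norm u + norm v + 1) = r" using pos by (simp add: e_def)
      then show ?thesis by (simp add: algebra_simps)
    qed
    also have "\<dots> < r" using e by simp
    finally have "norm (s *\<^sub>R u + t *\<^sub>R v) < r" .
    moreover have "dist q (pt s t) = norm (s *\<^sub>R u + t *\<^sub>R v)"
      unfolding dist_norm pt_def add.assoc by (metis add_diff_cancel_left' norm_minus_commute)
    ultimately have "pt s t \<in> ball q r" by simp
    then show ?thesis using r by auto
  qed
  define D where "D w p = frechet_derivative f (at p) w" for w p
  have f2: "Ck_open (Suc (Suc 0)) W f" using f by (simp add: numeral_2_eq_2)
  have D: "(f has_derivative (\<lambda>w. D w p)) (at p)" if "p \<in> W" for p
    using Ck_open_Suc_derivative[OF f2 that] by (simp add: D_def)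
  have D1: "Ck_open (Suc 0) W (D w)" for w
    using Ck_open_frechet[OF f2] by (simp add: D_def[abs_def])
  define E where "E w w' p = frechet_derivative (D w) (at p) w'" for w w' p
  have E: "(D w has_derivative (\<lambda>w'. E w w' p)) (at p)" if "p \<in> W" for w p
    using Ck_open_Suc_derivative[OF D1 that] by (simp add: E_def)
  have E0: "continuous_on W (E w w')" for w w'
    using Ck_open_frechet[OF D1[of w], of w'] by (simp add: E_def[abs_def])
  have der_s: "((\<lambda>s. h (pt s t)) has_real_derivative h' u (pt s t)) (at s within S)"
    and der_t: "((\<lambda>t. h (pt s t)) has_real_derivative h' v (pt s t)) (at t within S)"
    if "(h has_derivative (\<lambda>w. h' w (pt s t))) (at (pt s t))" for h h' s t S
  proof -
    interpret bounded_linear "\<lambda>w. h' w (pt s t)" using that has_derivative_bounded_linear by blast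
    have "((\<lambda>s. pt s t) has_derivative (\<lambda>a. a *\<^sub>R u)) (at s within S)"
      unfolding pt_def by (auto intro!: derivative_eq_intros)
    from has_derivative_compose[OF this that]
    show "((\<lambda>s. h (pt s t)) has_real_derivative h' u (pt s t)) (at s within S)"
      unfolding has_field_derivative_def by (rule has_derivative_eq_rhs) (auto simp: scaleR)
    have "((\<lambda>t. pt s t) has_derivative (\<lambda>a. a *\<^sub>R v)) (at t within S)"
      unfolding pt_def by (auto intro!: derivative_eq_intros)
    from has_derivative_compose[OF this that]
    show "((\<lambda>t. h (pt s t)) has_real_derivative h' v (pt s t)) (at t within S)"
      unfolding has_field_derivative_def by (rule has_derivative_eq_rhs) (auto simp: scaleR)
  qed
  have cpt: "continuous_on X (\<lambda>(t, s). pt s t)" for X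
    unfolding pt_def split_def by (intro continuous_intros)
  have key: "integral {-e..s} (\<lambda>\<sigma>. E u v (pt \<sigma> 0)) = D v (pt s 0) - D v (pt (-e) 0)"
    if s: "s \<in> {-e..e}" for s
  proof (rule DERIV_unique)
    have "((\<lambda>t. integral (cbox (-e) s) (\<lambda>\<sigma>. D u (pt \<sigma> t))) has_real_derivative
        integral (cbox (-e) s) (\<lambda>\<sigma>. E u v (pt \<sigma> 0))) (at 0 within {-e<..<e})"
    proof (rule leibniz_rule_field_derivative[where fx="\<lambda>t \<sigma>. E u v (pt \<sigma> t)"])
      show "((\<lambda>t. D u (pt \<sigma> t)) has_real_derivative E u v (pt \<sigma> t)) (at t within {- e<..<e})"
        if "t \<in> {-e<..<e}" "\<sigma> \<in> cbox (-e) s" for t \<sigma>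
        by (rule der_t, rule E, rule ptW) (use that s in auto)
      show "(\<lambda>\<sigma>. D u (pt \<sigma> t)) integrable_on cbox (-e) s" if "t \<in> {-e<..<e}" for t
        by (rule integrable_continuous, rule DERIV_continuous_on, rule der_s, rule E, rule ptW)
          (use that s in auto)
      show "continuous_on ({- e<..<e} \<times> cbox (- e) s) (\<lambda>(t, \<sigma>). E u v (pt \<sigma> t))"
        unfolding split_def
        by (rule continuous_on_compose2[OF E0 cpt[unfolded split_def]]) (use ptW s in auto)
    qed (use e in auto)
    then have "((\<lambda>t. integral {-e..s} (\<lambda>\<sigma>. D u (pt \<sigma> t))) has_real_derivative
        integral {-e..s} (\<lambda>\<sigma>. E u v (pt \<sigma> 0))) (at 0)"
      using e by (simp add: at_within_open[of 0 "{-e<..<e}"])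
    then show "((\<lambda>t. f (pt s t) - f (pt (-e) t)) has_real_derivative
        integral {-e..s} (\<lambda>\<sigma>. E u v (pt \<sigma> 0))) (at 0)"
    proof (rule has_field_derivative_transform_within_open[where S="{-e<..<e}"])
      fix t assume t: "t \<in> {-e<..<e}"
      show "integral {-e..s} (\<lambda>\<sigma>. D u (pt \<sigma> t)) = f (pt s t) - f (pt (-e) t)"
        by (rule integral_unique, rule fundamental_theorem_of_calculus)
           (use s t in \<open>auto intro!: der_s D ptW simp flip: has_real_derivative_iff_has_vector_derivative\<close>)
    qed (use e in auto)
    show "((\<lambda>t. f (pt s t) - f (pt (-e) t)) has_real_derivative D v (pt s 0) - D v (pt (-e) 0)) (at 0)"
      using e s by (intro DERIV_diff der_t D ptW) auto
  qed
  have "((\<lambda>s. integral {-e..s} (\<lambda>\<sigma>. E u v (pt \<sigma> 0))) has_real_derivative E u v (pt 0 0)) (at 0 within {-e..e})"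
  proof (rule integral_has_real_derivative)
    show "continuous_on {-e..e} (\<lambda>\<sigma>. E u v (pt \<sigma> 0))"
    proof (rule continuous_on_compose2[OF E0])
      show "continuous_on {-e..e} (\<lambda>\<sigma>. pt \<sigma> 0)" unfolding pt_def by (intro continuous_intros)
    qed (use ptW e in auto)
  qed (use e in auto)
  then have "((\<lambda>s. integral {-e..s} (\<lambda>\<sigma>. E u v (pt \<sigma> 0))) has_real_derivative E u v (pt 0 0)) (at 0)"
    using e at_within_Icc_at[of "-e" 0 e] by simp
  then have "((\<lambda>s. D v (pt s 0) - D v (pt (-e) 0)) has_real_derivative E u v (pt 0 0)) (at 0)"
    by (rule has_field_derivative_transform_within_open[where S="{-e<..<e}"]) (use key e in auto)
  moreover have "((\<lambda>s. D v (pt s 0) - D v (pt (-e) 0)) has_real_derivative E v u (pt 0 0) - 0) (at 0)"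
    using e by (intro DERIV_diff der_s E ptW DERIV_const) auto
  ultimately have "E u v (pt 0 0) = E v u (pt 0 0)" using DERIV_unique by fastforce
  then show ?thesis by (simp add: E_def D_def[abs_def] pt_def)
qed


section \<open>Bilinear maps depending smoothly on a point\<close>

text \<open>Metric coefficients and Christoffel symbols, as functions of the coordinates of a chart with image
  \<open>U\<close>, are of this kind.\<close>

definition bil_family ::
    "'e::euclidean_space set \<Rightarrow> ('e \<Rightarrow> 'e \<Rightarrow> 'e \<Rightarrow> 'b::euclidean_space) \<Rightarrow> bool" where
  "bil_family U B \<longleftrightarrow> (\<forall>q\<in>U. bilinear (B q)) \<and> (\<forall>u v j. Ck_open j U (\<lambda>q. B q u v))"

definition fam_deriv ::
    "('e::euclidean_space \<Rightarrow> 'e \<Rightarrow> 'e \<Rightarrow> 'b::euclidean_space) \<Rightarrow> 'e \<Rightarrow> 'e \<Rightarrow> 'e \<Rightarrow> 'e \<Rightarrow> 'b" where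
  "fam_deriv B q w u v = frechet_derivative (\<lambda>q. B q u v) (at q) w"

lemma bil_familyD:
  assumes "bil_family U B" "q \<in> U"
  shows "B q (u + u') v = B q u v + B q u' v" "B q u (v + v') = B q u v + B q u v'"
    "B q (r *\<^sub>R u) v = r *\<^sub>R B q u v" "B q u (r *\<^sub>R v) = r *\<^sub>R B q u v"
    "B q (- u) v = - B q u v" "B q u (- v) = - B q u v"
    "B q (u - u') v = B q u v - B q u' v" "B q u (v - v') = B q u v - B q u v'"
    "B q 0 v = 0" "B q u 0 = 0"
proof -
  have b: "bilinear (B q)" using assms by (auto simp: bil_family_def)
  show "B q (u + u') v = B q u v + B q u' v" "B q u (v + v') = B q u v + B q u v'"
    "B q (r *\<^sub>R u) v = r *\<^sub>R B q u v" "B q u (r *\<^sub>R v) = r *\<^sub>R B q u v"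
    "B q (- u) v = - B q u v" "B q u (- v) = - B q u v"
    "B q (u - u') v = B q u v - B q u' v" "B q u (v - v') = B q u v - B q u v'"
    "B q 0 v = 0" "B q u 0 = 0"
    using b by (auto simp: bilinear_ladd bilinear_radd bilinear_lmul bilinear_rmul
      bilinear_lneg bilinear_rneg bilinear_lsub bilinear_rsub bilinear_lzero bilinear_rzero)
qed

lemma bil_family_smooth: "bil_family U B \<Longrightarrow> Ck_open j U (\<lambda>q. B q u v)"
  by (simp add: bil_family_def)

text \<open>The coefficients with respect to a basis are smooth functions of the point alone, which reduces the
  calculus of such families to that of sums and products.\<close>

lemma bil_family_expand:
  assumes "bil_family U B" "q \<in> U"
  shows "B q u v = (\<Sum>i\<in>Basis. \<Sum>j\<in>Basis. ((u \<bullet> i) * (v \<bullet> j)) *\<^sub>R B q i j)"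
proof -
  have b: "bilinear (B q)" using assms by (auto simp: bil_family_def)
  have "B q u v = B q (\<Sum>i\<in>Basis. (u \<bullet> i) *\<^sub>R i) (\<Sum>j\<in>Basis. (v \<bullet> j) *\<^sub>R j)"
    by (simp add: euclidean_representation)
  also have "\<dots> = (\<Sum>(i,j)\<in>Basis \<times> Basis. B q ((u \<bullet> i) *\<^sub>R i) ((v \<bullet> j) *\<^sub>R j))"
    by (rule bilinear_sum[OF b])
  finally show ?thesis
    by (simp add: sum.cartesian_product bilinear_lmul[OF b] bilinear_rmul[OF b] mult.commute)
qed

lemma fam_deriv_has_derivative:
  assumes "bil_family U B" "q \<in> U"
  shows "((\<lambda>q. B q u v) has_derivative (\<lambda>w. fam_deriv B q w u v)) (at q)"
  using Ck_open_Suc_derivative[OF bil_family_smooth[OF assms(1), of "Suc 0"] assms(2)]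
  by (simp add: fam_deriv_def)

lemma fam_derivI:
  "((\<lambda>q. B q u v) has_derivative D) (at q) \<Longrightarrow> fam_deriv B q w u v = D w"
  using frechet_derivativeI by (fastforce simp: fam_deriv_def)

lemma bil_family_fam_deriv:
  assumes U: "open U" and B: "bil_family U B"
  shows "bil_family U (\<lambda>q. fam_deriv B q w)"
  unfolding bil_family_def
proof (intro conjI ballI allI)
  show "Ck_open j U (\<lambda>q. fam_deriv B q w u v)" for j u v
    using Ck_open_frechet[OF bil_family_smooth[OF B, of "Suc j"]] by (simp add: fam_deriv_def)
  fix q assume q: "q \<in> U"
  note d = fam_deriv_has_derivative[OF B q]
  have sum: "fam_deriv B q w u v = fam_deriv B q w u1 v1 + fam_deriv B q w u2 v2"
    if "\<And>q. q \<in> U \<Longrightarrow> B q u1 v1 + B q u2 v2 = B q u v" for u v u1 v1 u2 v2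
    by (rule fam_derivI, rule has_derivative_transform_within_open[OF has_derivative_add[OF d d] U q that])
  have scale: "fam_deriv B q w u v = r *\<^sub>R fam_deriv B q w u1 v1"
    if "\<And>q. q \<in> U \<Longrightarrow> r *\<^sub>R B q u1 v1 = B q u v" for r u v u1 v1
    by (rule fam_derivI, rule has_derivative_transform_within_open[OF has_derivative_scaleR_right[OF d] U q that])
  have "linear (\<lambda>v. fam_deriv B q w u v)" for u
    by (intro linearI sum scale) (simp_all add: bil_familyD[OF B])
  moreover have "linear (\<lambda>u. fam_deriv B q w u v)" for v
    by (intro linearI sum scale) (simp_all add: bil_familyD[OF B])
  ultimately show "bilinear (fam_deriv B q w)" by (simp add: bilinear_def)
qed

lemma fam_deriv_linear:
  assumes "bil_family U B" "q \<in> U"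
  shows "linear (\<lambda>w. fam_deriv B q w u v)"
  using fam_deriv_has_derivative[OF assms] has_derivative_linear by blast

lemma bil_family_has_derivative:
  assumes U: "open U" and B: "bil_family U B" and tS: "t \<in> S" "y t \<in> U"
    and y: "(y has_derivative y') (at t within S)"
    and u: "(u has_derivative u') (at t within S)"
    and v: "(v has_derivative v') (at t within S)"
  shows "((\<lambda>s. B (y s) (u s) (v s)) has_derivative
     (\<lambda>h. fam_deriv B (y t) (y' h) (u t) (v t) + B (y t) (u' h) (v t) + B (y t) (u t) (v' h))) (at t within S)"
proof -
  let ?R = "\<lambda>s. \<Sum>i\<in>Basis. \<Sum>j\<in>Basis. ((u s \<bullet> i) * (v s \<bullet> j)) *\<^sub>R B (y s) i j"
  have "((\<lambda>s. B (y s) i j) has_derivative (\<lambda>h. fam_deriv B (y t) (y' h) i j)) (at t within S)" for i j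
    by (rule has_derivative_compose[OF y fam_deriv_has_derivative[OF B tS(2)]])
  then have 1: "(?R has_derivative (\<lambda>h. \<Sum>i\<in>Basis. \<Sum>j\<in>Basis.
      ((u t \<bullet> i) * (v t \<bullet> j)) *\<^sub>R fam_deriv B (y t) (y' h) i j
      + ((u t \<bullet> i) * (v' h \<bullet> j) + (u' h \<bullet> i) * (v t \<bullet> j)) *\<^sub>R B (y t) i j)) (at t within S)"
    by (intro has_derivative_sum has_derivative_scaleR has_derivative_mult has_derivative_inner_left u v)
  have 2: "(\<Sum>i\<in>Basis. \<Sum>j\<in>Basis.
      ((u t \<bullet> i) * (v t \<bullet> j)) *\<^sub>R fam_deriv B (y t) (y' h) i j
      + ((u t \<bullet> i) * (v' h \<bullet> j) + (u' h \<bullet> i) * (v t \<bullet> j)) *\<^sub>R B (y t) i j)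
    = fam_deriv B (y t) (y' h) (u t) (v t) + B (y t) (u' h) (v t) + B (y t) (u t) (v' h)" for h
    by (subst bil_family_expand[OF bil_family_fam_deriv[OF U B] tS(2)],
        (subst (1 2) bil_family_expand[OF B tS(2)]))
       (simp add: sum.distrib scaleR_add_left)
  have "\<forall>\<^sub>F s in at t within S. y s \<in> U"
    using has_derivative_continuous[OF y] U tS(2) unfolding continuous_within
    by (metis topological_tendstoD)
  then have 3: "\<forall>\<^sub>F s in at t within S. ?R s = B (y s) (u s) (v s)"
    by eventually_elim (simp add: bil_family_expand[OF B, symmetric])
  show ?thesis
    by (rule has_derivative_transform_eventually[OF 1[unfolded 2] 3])
       (use bil_family_expand[OF B tS(2), symmetric] tS in auto)
qed

lemma bil_family_has_vector_derivative:
  assumes U: "open U" and B: "bil_family U B" and tS: "t \<in> S" "y t \<in> U"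
    and "(y has_vector_derivative y') (at t within S)"
    and "(u has_vector_derivative u') (at t within S)"
    and "(v has_vector_derivative v') (at t within S)"
  shows "((\<lambda>s. B (y s) (u s) (v s)) has_vector_derivative
     (fam_deriv B (y t) y' (u t) (v t) + B (y t) u' (v t) + B (y t) (u t) v')) (at t within S)"
  unfolding has_vector_derivative_def
  by (rule has_derivative_eq_rhs[OF bil_family_has_derivative[OF U B tS
        assms(5-7)[unfolded has_vector_derivative_def]]])
     (simp add: linear_scale[OF fam_deriv_linear[OF B tS(2)]] bil_familyD[OF B tS(2)] scaleR_add_right)

lemma bil_family_continuous_on:
  assumes B: "bil_family U B"
    and "continuous_on S y" "continuous_on S u" "continuous_on S v" "y ` S \<subseteq> U"
  shows "continuous_on S (\<lambda>t. B (y t) (u t) (v t))"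
proof -
  have "continuous_on S (\<lambda>t. B (y t) i j)" for i j
    by (rule continuous_on_compose2[OF Ck_open_continuous_on[OF bil_family_smooth[OF B]] assms(2,5)])
  then have "continuous_on S (\<lambda>t. \<Sum>i\<in>Basis. \<Sum>j\<in>Basis. ((u t \<bullet> i) * (v t \<bullet> j)) *\<^sub>R B (y t) i j)"
    by (intro continuous_intros assms)
  then show ?thesis
    by (rule continuous_on_eq) (use bil_family_expand[OF B, symmetric] assms(5) in auto)
qed

text \<open>Joint continuity of the derivative follows from that for finitely many fixed directions, where it
  is again a bilinear family.\<close>

lemma fam_deriv_expand:
  assumes "bil_family U B" "q \<in> U"
  shows "fam_deriv B q w u v = (\<Sum>k\<in>Basis. (w \<bullet> k) *\<^sub>R fam_deriv B q k u v)"
proof -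
  have "fam_deriv B q w u v = fam_deriv B q (\<Sum>k\<in>Basis. (w \<bullet> k) *\<^sub>R k) u v"
    by (simp add: euclidean_representation)
  also have "\<dots> = (\<Sum>k\<in>Basis. (w \<bullet> k) *\<^sub>R fam_deriv B q k u v)"
    by (subst linear_sum[OF fam_deriv_linear[OF assms]], subst linear_scale[OF fam_deriv_linear[OF assms]]) simp
  finally show ?thesis .
qed

lemma fam_deriv_continuous_on:
  assumes U: "open U" and B: "bil_family U B"
    and "continuous_on S y" "continuous_on S w" "continuous_on S u" "continuous_on S v" "y ` S \<subseteq> U"
  shows "continuous_on S (\<lambda>t. fam_deriv B (y t) (w t) (u t) (v t))"
proof -
  have "continuous_on S (\<lambda>t. \<Sum>k\<in>Basis. (w t \<bullet> k) *\<^sub>R fam_deriv B (y t) k (u t) (v t))"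
    by (intro continuous_intros bil_family_continuous_on[OF bil_family_fam_deriv[OF U B]] assms)
  then show ?thesis
    by (rule continuous_on_eq) (use fam_deriv_expand[OF B, symmetric] assms(7) in auto)
qed

lemma bil_family_Ck_on:
  assumes U: "open U" and B: "bil_family U B"
    and "Ck_on k S y" "Ck_on k S u" "Ck_on k S v" "y ` S \<subseteq> U"
  shows "Ck_on k S (\<lambda>t. B (y t) (u t) (v t))"
proof -
  have "Ck_on k S (\<lambda>t. B (y t) i j)" for i j
    by (rule Ck_on_compose[OF assms(3) Ck_onI_open[OF U bil_family_smooth[OF B]] assms(6)])
  then have "Ck_on k S (\<lambda>t. \<Sum>i\<in>Basis. \<Sum>j\<in>Basis. ((u t \<bullet> i) * (v t \<bullet> j)) *\<^sub>R B (y t) i j)"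
    by (intro Ck_on_sum Ck_on_bounded_bilinear[OF bounded_bilinear_scaleR]
        Ck_on_bounded_bilinear[OF bounded_bilinear_mult]
        Ck_on_compose_linear[OF _ bounded_linear_inner_left] assms)
  then show ?thesis
    by (rule Ck_on_cong[THEN iffD1, rotated]) (use bil_family_expand[OF B, symmetric] assms(6) in auto)
qed


section \<open>Riemannian geometry in one chart\<close>

text \<open>The situation in the image \<open>U\<close> of a chart: \<open>G\<close> are the metric coefficients and \<open>\<Gamma>\<close> the Christoffel
  symbols.  Symmetry of \<open>\<Gamma>\<close> expresses that the connection is torsion-free.\<close>

locale chart_geometry =
  fixes U :: "'e::euclidean_space set"
    and G :: "'e \<Rightarrow> 'e \<Rightarrow> 'e \<Rightarrow> real" and \<Gamma> :: "'e \<Rightarrow> 'e \<Rightarrow> 'e \<Rightarrow> 'e"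
  assumes U: "open U" and G: "bil_family U G" and \<Gamma>: "bil_family U \<Gamma>"
    and G_sym: "q \<in> U \<Longrightarrow> G q u v = G q v u"
    and G_pos: "q \<in> U \<Longrightarrow> u \<noteq> 0 \<Longrightarrow> 0 < G q u u"
    and \<Gamma>_sym: "q \<in> U \<Longrightarrow> \<Gamma> q u v = \<Gamma> q v u"
    and compat: "q \<in> U \<Longrightarrow> fam_deriv G q w u v = G q (\<Gamma> q w u) v + G q u (\<Gamma> q w v)"
begin

lemmas G_simps = bil_familyD[OF G] and \<Gamma>_simps = bil_familyD[OF \<Gamma>]

lemma G_nondegenerate:
  assumes "q \<in> U" "\<And>w. G q u w = 0"
  shows "u = 0"
  using G_pos[OF assms(1)] assms(2)[of u] by fastforce

lemma fam_deriv_\<Gamma>_sym: "q \<in> U \<Longrightarrow> fam_deriv \<Gamma> q w u v = fam_deriv \<Gamma> q w v u"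
  unfolding fam_deriv_def
  by (rule fun_cong[OF frechet_derivative_cong_open[OF U]]) (auto intro: \<Gamma>_sym)

text \<open>The curvature $R(u, v)w = \nabla_u\nabla_vw - \nabla_v\nabla_uw$ of fields with constant components, which
  commute.\<close>

definition Rm :: "'e \<Rightarrow> 'e \<Rightarrow> 'e \<Rightarrow> 'e \<Rightarrow> 'e" where
  "Rm q u v w = fam_deriv \<Gamma> q u v w - fam_deriv \<Gamma> q v u w + \<Gamma> q u (\<Gamma> q v w) - \<Gamma> q v (\<Gamma> q u w)"

lemma Rm_antisym: "Rm q u v w = - Rm q v u w"
  by (simp add: Rm_def)

lemma Rm_Bianchi:
  assumes "q \<in> U"
  shows "Rm q u v w + Rm q v w u + Rm q w u v = 0"
  using fam_deriv_\<Gamma>_sym[OF assms, of u v w] fam_deriv_\<Gamma>_sym[OF assms, of v w u]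
    fam_deriv_\<Gamma>_sym[OF assms, of w u v] \<Gamma>_sym[OF assms, of v w] \<Gamma>_sym[OF assms, of u w]
    \<Gamma>_sym[OF assms, of u v]
  by (simp add: Rm_def)

text \<open>Differentiating metric compatibility once more expresses the second derivatives of the
  metric; their symmetry is the skew-symmetry of the curvature.\<close>

lemma Rm_skew:
  assumes q: "q \<in> U"
  shows "G q (Rm q u v w) z = - G q w (Rm q u v z)"
proof -
  have dd: "fam_deriv (\<lambda>q. fam_deriv G q v) q u w z
     = fam_deriv G q u (\<Gamma> q v w) z + G q (fam_deriv \<Gamma> q u v w) z
     + (fam_deriv G q u w (\<Gamma> q v z) + G q w (fam_deriv \<Gamma> q u v z))" for u v
  proof (rule fam_derivI[OF has_derivative_transform_within_open[OF _ U q]])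
    have d\<Gamma>: "((\<lambda>q. \<Gamma> q v w) has_derivative (\<lambda>h. fam_deriv \<Gamma> q h v w)) (at q)" for v w
      by (rule fam_deriv_has_derivative[OF \<Gamma> q])
    have "((\<lambda>q. G q (\<Gamma> q v w) z + G q w (\<Gamma> q v z)) has_derivative
       (\<lambda>u. (fam_deriv G q u (\<Gamma> q v w) z + G q (fam_deriv \<Gamma> q u v w) z + G q (\<Gamma> q v w) 0)
         + (fam_deriv G q u w (\<Gamma> q v z) + G q 0 (\<Gamma> q v z) + G q w (fam_deriv \<Gamma> q u v z)))) (at q)"
      by (intro has_derivative_add
            bil_family_has_derivative[OF U G UNIV_I q has_derivative_ident d\<Gamma> has_derivative_const]
            bil_family_has_derivative[OF U G UNIV_I q has_derivative_ident has_derivative_const d\<Gamma>])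
    then show "((\<lambda>q. G q (\<Gamma> q v w) z + G q w (\<Gamma> q v z)) has_derivative
       (\<lambda>u. fam_deriv G q u (\<Gamma> q v w) z + G q (fam_deriv \<Gamma> q u v w) z
     + (fam_deriv G q u w (\<Gamma> q v z) + G q w (fam_deriv \<Gamma> q u v z)))) (at q)"
      by (simp add: G_simps[OF q])
  qed (simp add: compat)
  have "fam_deriv (\<lambda>q. fam_deriv G q v) q u w z = fam_deriv (\<lambda>q. fam_deriv G q u) q v w z"
    using second_derivative_symmetric[OF U q bil_family_smooth[OF G], of w z v u]
    by (simp add: fam_deriv_def)
  with dd[of u v] dd[of v u] show ?thesis
    by (simp add: compat[OF q] Rm_def G_simps[OF q])
qed

text \<open>A formal consequence of the two skew symmetries and the Bianchi identity: in a
  signed sum of the four cyclic identities for \<open>a\<close>, \<open>b\<close>, \<open>c\<close>, \<open>d\<close> all other terms cancel.\<close>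

lemma Rm_pair_symmetry:
  assumes q: "q \<in> U"
  shows "G q (Rm q a b c) d = G q (Rm q c d a) b"
proof -
  define r where "r a b c d = G q (Rm q a b c) d" for a b c d
  have 1: "r a b c d = - r b a c d" for a b c d
    using Rm_antisym[of q a b c] by (simp add: r_def G_simps[OF q])
  have 2: "r a b c d = - r a b d c" for a b c d
    unfolding r_def Rm_skew[OF q, of a b c d] G_sym[OF q, of c] ..
  have 3: "r a b c d + r b c a d + r c a b d = 0" for a b c d
    unfolding r_def G_simps(1)[OF q, symmetric] Rm_Bianchi[OF q] by (rule G_simps(9)[OF q])
  have "r b c a d + r c d a b + r b d c a = 0"
    using 3[of b c d a] 2[of b c d a] 2[of c d b a] 1[of d b c a] by linarith
  moreover have "r c d a b + r a d b c + r c a b d = 0"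
    using 3[of c d a b] 1[of d a c b] 2[of a d c b] 1[of a c d b] 2[of c a d b] by linarith
  moreover have "r a d b c + r a b c d + r b d c a = 0"
    using 3[of d a b c] 1[of d a b c] 2[of a b d c] 2[of b d a c] by linarith
  ultimately have "r a b c d = r c d a b"
    using 3[of a b c d] by linarith
  then show ?thesis by (simp add: r_def)
qed

text \<open>The product rule for the covariant derivative $P' + \Gamma(y', P)$ along a curve.\<close>

lemma G_has_derivative_along:
  assumes "t \<in> S" "y t \<in> U"
    and "(y has_vector_derivative y') (at t within S)"
    and "(P has_vector_derivative P') (at t within S)"
    and "(Q has_vector_derivative Q') (at t within S)"
  shows "((\<lambda>s. G (y s) (P s) (Q s)) has_real_derivative
     (G (y t) (P' + \<Gamma> (y t) y' (P t)) (Q t) + G (y t) (P t) (Q' + \<Gamma> (y t) y' (Q t)))) (at t within S)"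
  unfolding has_real_derivative_iff_has_vector_derivative
  using bil_family_has_vector_derivative[OF U G assms]
  by (simp add: compat assms(2) G_simps[OF assms(2)] algebra_simps)

text \<open>For the position \<open>q\<close>, velocity \<open>u\<close> and acceleration \<open>w\<close> of a curve in coordinates, \<open>w + \<Gamma> q u u\<close> is
  its covariant acceleration.\<close>

definition lag :: "real \<Rightarrow> ('e \<Rightarrow> real) \<Rightarrow> 'e \<Rightarrow> 'e \<Rightarrow> 'e \<Rightarrow> real" where
  "lag \<sigma> v q u w = 1/2 * (G q (w + \<Gamma> q u u) (w + \<Gamma> q u u) + \<sigma> * G q u u + v q)"

text \<open>The derivative of \<open>lag\<close> when \<open>q\<close>, \<open>u\<close>, \<open>w\<close> move with velocities \<open>\<phi>\<close>, \<open>\<phi>1\<close>, \<open>\<phi>2\<close>.  The derivatives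
  of the metric coefficients have been absorbed into covariant derivatives, by compatibility.\<close>

definition dlag :: "real \<Rightarrow> ('e \<Rightarrow> 'e \<Rightarrow> real) \<Rightarrow> 'e \<Rightarrow> 'e \<Rightarrow> 'e \<Rightarrow> 'e \<Rightarrow> 'e \<Rightarrow> 'e \<Rightarrow> real" where
  "dlag \<sigma> dv q u w \<phi> \<phi>1 \<phi>2 =
     G q (w + \<Gamma> q u u) (\<phi>2 + fam_deriv \<Gamma> q \<phi> u u + 2 *\<^sub>R \<Gamma> q u \<phi>1 + \<Gamma> q \<phi> (w + \<Gamma> q u u))
     + \<sigma> * G q u (\<phi>1 + \<Gamma> q \<phi> u) + 1/2 * dv q \<phi>"

lemma lag_has_derivative:
  assumes q: "q s \<in> U"
    and q': "(q has_vector_derivative \<phi>) (at s)" and u': "(u has_vector_derivative \<phi>1) (at s)"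
    and w': "(w has_vector_derivative \<phi>2) (at s)"
    and v: "(v has_derivative dv (q s)) (at (q s))"
  shows "((\<lambda>s. lag \<sigma> v (q s) (u s) (w s)) has_real_derivative
     dlag \<sigma> dv (q s) (u s) (w s) \<phi> \<phi>1 \<phi>2) (at s)"
proof -
  have A: "((\<lambda>s. w s + \<Gamma> (q s) (u s) (u s)) has_vector_derivative
     \<phi>2 + (fam_deriv \<Gamma> (q s) \<phi> (u s) (u s) + \<Gamma> (q s) \<phi>1 (u s) + \<Gamma> (q s) (u s) \<phi>1)) (at s)"
    by (intro has_vector_derivative_add w' bil_family_has_vector_derivative[OF U \<Gamma> _ q q' u' u']) simp
  have v': "((\<lambda>s. v (q s)) has_real_derivative dv (q s) \<phi>) (at s)"
  proof -
    have "linear (dv (q s))" using v has_derivative_linear by blast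
    from linear_scale[OF this] show ?thesis
      unfolding has_field_derivative_def
      by (intro has_derivative_eq_rhs[OF has_derivative_compose[OF q'[unfolded has_vector_derivative_def] v]]) auto
  qed
  have "((\<lambda>s. lag \<sigma> v (q s) (u s) (w s)) has_real_derivative
     1/2 * ((G (q s) (\<phi>2 + (fam_deriv \<Gamma> (q s) \<phi> (u s) (u s) + \<Gamma> (q s) \<phi>1 (u s) + \<Gamma> (q s) (u s) \<phi>1)
               + \<Gamma> (q s) \<phi> (w s + \<Gamma> (q s) (u s) (u s))) (w s + \<Gamma> (q s) (u s) (u s))
          + G (q s) (w s + \<Gamma> (q s) (u s) (u s))
             (\<phi>2 + (fam_deriv \<Gamma> (q s) \<phi> (u s) (u s) + \<Gamma> (q s) \<phi>1 (u s) + \<Gamma> (q s) (u s) \<phi>1)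
               + \<Gamma> (q s) \<phi> (w s + \<Gamma> (q s) (u s) (u s))))
       + \<sigma> * (G (q s) (\<phi>1 + \<Gamma> (q s) \<phi> (u s)) (u s) + G (q s) (u s) (\<phi>1 + \<Gamma> (q s) \<phi> (u s)))
       + dv (q s) \<phi>)) (at s)"
    unfolding lag_def
    by (intro DERIV_cmult DERIV_add G_has_derivative_along[OF UNIV_I q q'] A u' v')
  then show ?thesis
    by (rule DERIV_cong)
      (simp add: dlag_def G_sym[OF q, of _ "w s + _"] G_sym[OF q, of _ "u s"] \<Gamma>_sym[OF q, of \<phi>1 "u s"]
        scaleR_2 add.assoc field_simps)
qed

text \<open>The commutator of the covariant derivatives in the variation and in the curve parameter
  produces the curvature term.\<close>

lemma dlag_eq:
  assumes q: "q \<in> U"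
  shows "dlag \<sigma> dv q u w \<phi> \<phi>1 \<phi>2 =
    G q (w + \<Gamma> q u u) (\<phi>2 + (fam_deriv \<Gamma> q u u \<phi> + \<Gamma> q w \<phi> + \<Gamma> q u \<phi>1) + \<Gamma> q u (\<phi>1 + \<Gamma> q u \<phi>))
    + G q (Rm q (w + \<Gamma> q u u) u u) \<phi>
    + \<sigma> * G q u (\<phi>1 + \<Gamma> q u \<phi>) + 1/2 * dv q \<phi>"
proof -
  let ?A = "w + \<Gamma> q u u"
  have 1: "\<phi>2 + fam_deriv \<Gamma> q \<phi> u u + 2 *\<^sub>R \<Gamma> q u \<phi>1 + \<Gamma> q \<phi> ?A
     = (\<phi>2 + (fam_deriv \<Gamma> q u u \<phi> + \<Gamma> q w \<phi> + \<Gamma> q u \<phi>1) + \<Gamma> q u (\<phi>1 + \<Gamma> q u \<phi>)) + Rm q \<phi> u u"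
    by (simp add: Rm_def \<Gamma>_simps[OF q] \<Gamma>_sym[OF q, of w \<phi>] \<Gamma>_sym[OF q, of \<phi> u]
        fam_deriv_\<Gamma>_sym[OF q, of u \<phi> u] scaleR_2)
  have 2: "G q ?A (Rm q \<phi> u u) = G q (Rm q ?A u u) \<phi>"
  proof -
    have "G q ?A (Rm q \<phi> u u) = G q (Rm q \<phi> u u) ?A" by (rule G_sym[OF q])
    also have "\<dots> = G q (Rm q u ?A \<phi>) u" by (rule Rm_pair_symmetry[OF q])
    also have "\<dots> = - G q (Rm q ?A u \<phi>) u"
      using Rm_antisym[of q u ?A \<phi>] by (simp add: G_simps[OF q])
    also have "\<dots> = G q (Rm q ?A u u) \<phi>"
      using Rm_skew[OF q, of ?A u \<phi> u] by (simp add: G_sym[OF q, of \<phi>])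
    finally show ?thesis .
  qed
  show ?thesis
    unfolding dlag_def 1 G_simps(2)[OF q, of ?A _ "Rm q \<phi> u u"] 2 \<Gamma>_sym[OF q, of \<phi> u] ..
qed

lemma dlag_continuous_on:
  assumes dv: "\<And>w. continuous_on U (\<lambda>q. dv q w)" "\<And>q. q \<in> U \<Longrightarrow> linear (dv q)"
    and c: "continuous_on S q" "continuous_on S u" "continuous_on S w"
     "continuous_on S \<phi>" "continuous_on S \<phi>1" "continuous_on S \<phi>2" and qU: "q ` S \<subseteq> U"
  shows "continuous_on S (\<lambda>t. dlag \<sigma> dv (q t) (u t) (w t) (\<phi> t) (\<phi>1 t) (\<phi>2 t))"
    and "continuous_on S (\<lambda>t. dv (q t) (\<phi> t))"
proof -
  have "continuous_on S (\<lambda>t. \<Sum>k\<in>Basis. (\<phi> t \<bullet> k) *\<^sub>R dv (q t) k)"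
    by (intro continuous_intros c continuous_on_compose2[OF dv(1) c(1) qU])
  then show dvc: "continuous_on S (\<lambda>t. dv (q t) (\<phi> t))"
  proof (rule continuous_on_eq)
    fix t assume "t \<in> S"
    then have "linear (dv (q t))" using qU dv(2) by auto
    from linear_sum[OF this, of "\<lambda>k. (\<phi> t \<bullet> k) *\<^sub>R k" Basis]
    show "(\<Sum>k\<in>Basis. (\<phi> t \<bullet> k) *\<^sub>R dv (q t) k) = dv (q t) (\<phi> t)"
      by (simp add: linear_scale[OF \<open>linear (dv (q t))\<close>] euclidean_representation)
  qed
  show "continuous_on S (\<lambda>t. dlag \<sigma> dv (q t) (u t) (w t) (\<phi> t) (\<phi>1 t) (\<phi>2 t))"
    unfolding dlag_def
    by (intro continuous_intros c dvc qU bil_family_continuous_on[OF G] bil_family_continuous_on[OF \<Gamma>]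
        fam_deriv_continuous_on[OF U \<Gamma>])
qed

lemma lag_continuous_on:
  assumes "continuous_on U v" "continuous_on S q" "continuous_on S u" "continuous_on S w" "q ` S \<subseteq> U"
  shows "continuous_on S (\<lambda>t. lag \<sigma> v (q t) (u t) (w t))"
  unfolding lag_def
  by (intro continuous_intros bil_family_continuous_on[OF G] bil_family_continuous_on[OF \<Gamma>]
      continuous_on_compose2[OF assms(1,2)] assms)

text \<open>The Euler--Lagrange expression paired with a vector \<open>w\<close>.  The pairing turns the gradient of the
  potential into its differential, whose continuity in time is immediate.\<close>

definition EL :: "real \<Rightarrow> ('e \<Rightarrow> 'e \<Rightarrow> real) \<Rightarrow> 'e \<Rightarrow> 'e \<Rightarrow> 'e \<Rightarrow> 'e \<Rightarrow> 'e \<Rightarrow> real" where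
  "EL \<sigma> dv q Y A C w = G q (C + Rm q A Y Y - \<sigma> *\<^sub>R A) w + 1/2 * dv q w"

lemma EL_continuous_on:
  assumes dv: "\<And>w. continuous_on U (\<lambda>q. dv q w)" "\<And>q. q \<in> U \<Longrightarrow> linear (dv q)"
    and c: "continuous_on S q" "continuous_on S Y" "continuous_on S A" "continuous_on S C"
      "continuous_on S \<phi>" and qU: "q ` S \<subseteq> U"
  shows "continuous_on S (\<lambda>t. EL \<sigma> dv (q t) (Y t) (A t) (C t) (\<phi> t))"
  unfolding EL_def Rm_def
  by (intro continuous_intros c qU dlag_continuous_on(2)[OF dv c(1) c(1) c(1) c(5) c(1) c(1) qU]
      bil_family_continuous_on[OF G] bil_family_continuous_on[OF \<Gamma>]
        fam_deriv_continuous_on[OF U \<Gamma>])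

text \<open>The terms at the end points in the integrated first variation.\<close>

definition bdry :: "real \<Rightarrow> 'e \<Rightarrow> 'e \<Rightarrow> 'e \<Rightarrow> 'e \<Rightarrow> 'e \<Rightarrow> 'e \<Rightarrow> real" where
  "bdry \<sigma> q Y A B \<phi> \<phi>1 = G q A (\<phi>1 + \<Gamma> q Y \<phi>) - G q B \<phi> + \<sigma> * G q Y \<phi>"

text \<open>Differentiation under the integral leads to \<open>dlag\<close>.  By \<open>dlag_eq\<close> and the product rule along the
  curve, this differs from the Euler--Lagrange expression by the derivative of the boundary terms,
  which is the two integrations by parts in one step.\<close>

lemma first_variation:
  fixes y Y A B C \<phi> \<phi>1 \<phi>2 :: "real \<Rightarrow> 'e"
  assumes ab: "a < b" and e: "e > 0"
    and y: "\<And>t. t \<in> {a..b} \<Longrightarrow> (y has_vector_derivative Y t) (at t within {a..b})"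
    and Y: "\<And>t. t \<in> {a..b} \<Longrightarrow> (Y has_vector_derivative A t - \<Gamma> (y t) (Y t) (Y t)) (at t within {a..b})"
    and A: "\<And>t. t \<in> {a..b} \<Longrightarrow> (A has_vector_derivative B t - \<Gamma> (y t) (Y t) (A t)) (at t within {a..b})"
    and B: "\<And>t. t \<in> {a..b} \<Longrightarrow> (B has_vector_derivative C t - \<Gamma> (y t) (Y t) (B t)) (at t within {a..b})"
    and C: "continuous_on {a..b} C"
    and \<phi>: "\<And>t. t \<in> {a..b} \<Longrightarrow> (\<phi> has_vector_derivative \<phi>1 t) (at t within {a..b})"
    and \<phi>1: "\<And>t. t \<in> {a..b} \<Longrightarrow> (\<phi>1 has_vector_derivative \<phi>2 t) (at t within {a..b})"
    and \<phi>2: "continuous_on {a..b} \<phi>2"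
    and inU: "\<And>r t. \<bar>r\<bar> < e \<Longrightarrow> t \<in> {a..b} \<Longrightarrow> y t + r *\<^sub>R \<phi> t \<in> U"
    and v: "\<And>q. q \<in> U \<Longrightarrow> (v has_derivative dv q) (at q)" "\<And>w. continuous_on U (\<lambda>q. dv q w)"
  shows "((\<lambda>r. integral {a..b} (\<lambda>t. lag \<sigma> v (y t + r *\<^sub>R \<phi> t) (Y t + r *\<^sub>R \<phi>1 t)
            (A t - \<Gamma> (y t) (Y t) (Y t) + r *\<^sub>R \<phi>2 t))) has_real_derivative
     bdry \<sigma> (y b) (Y b) (A b) (B b) (\<phi> b) (\<phi>1 b) - bdry \<sigma> (y a) (Y a) (A a) (B a) (\<phi> a) (\<phi>1 a)
     + integral {a..b} (\<lambda>t. EL \<sigma> dv (y t) (Y t) (A t) (C t) (\<phi> t))) (at 0)"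
proof -
  let ?w = "\<lambda>t. A t - \<Gamma> (y t) (Y t) (Y t)"
  have yU: "y t \<in> U" if "t \<in> {a..b}" for t using inU[of 0 t] that e by simp
  then have yU': "y ` {a..b} \<subseteq> U" by auto
  have dv: "linear (dv q)" if "q \<in> U" for q using v(1)[OF that] has_derivative_linear by blast
  note hv = continuous_on_vector_derivative
  have c: "continuous_on {a..b} y" "continuous_on {a..b} Y" "continuous_on {a..b} A"
    "continuous_on {a..b} \<phi>" "continuous_on {a..b} \<phi>1"
    by (auto intro: hv y Y A \<phi> \<phi>1)
  have cw: "continuous_on {a..b} ?w"
    by (intro continuous_intros c yU' bil_family_continuous_on[OF \<Gamma>])
  have cv: "continuous_on U v"
    using v(1) has_derivative_continuous continuous_at_imp_continuous_on by blast
  have "((\<lambda>r. integral (cbox a b) (\<lambda>t. lag \<sigma> v (y t + r *\<^sub>R \<phi> t) (Y t + r *\<^sub>R \<phi>1 t) (?w t + r *\<^sub>R \<phi>2 t)))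
     has_real_derivative
     integral (cbox a b) (\<lambda>t. dlag \<sigma> dv (y t + 0 *\<^sub>R \<phi> t) (Y t + 0 *\<^sub>R \<phi>1 t) (?w t + 0 *\<^sub>R \<phi>2 t) (\<phi> t) (\<phi>1 t) (\<phi>2 t)))
     (at 0 within {-e<..<e})"
  proof (rule leibniz_rule_field_derivative[where
        fx="\<lambda>r t. dlag \<sigma> dv (y t + r *\<^sub>R \<phi> t) (Y t + r *\<^sub>R \<phi>1 t) (?w t + r *\<^sub>R \<phi>2 t) (\<phi> t) (\<phi>1 t) (\<phi>2 t)"])
    fix r t assume rt: "r \<in> {-e<..<e}" "t \<in> cbox a b"
    have lin: "((\<lambda>r. p + r *\<^sub>R p') has_vector_derivative p') (at r)" for p p' :: 'e
      by (auto intro!: derivative_eq_intros)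
    show "((\<lambda>r. lag \<sigma> v (y t + r *\<^sub>R \<phi> t) (Y t + r *\<^sub>R \<phi>1 t) (?w t + r *\<^sub>R \<phi>2 t)) has_real_derivative
       dlag \<sigma> dv (y t + r *\<^sub>R \<phi> t) (Y t + r *\<^sub>R \<phi>1 t) (?w t + r *\<^sub>R \<phi>2 t) (\<phi> t) (\<phi>1 t) (\<phi>2 t))
       (at r within {-e<..<e})"
    proof (rule has_field_derivative_at_within)
      show "((\<lambda>r. lag \<sigma> v (y t + r *\<^sub>R \<phi> t) (Y t + r *\<^sub>R \<phi>1 t) (?w t + r *\<^sub>R \<phi>2 t)) has_real_derivative
         dlag \<sigma> dv (y t + r *\<^sub>R \<phi> t) (Y t + r *\<^sub>R \<phi>1 t) (?w t + r *\<^sub>R \<phi>2 t) (\<phi> t) (\<phi>1 t) (\<phi>2 t)) (at r)"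
        using lin inU[of r t] rt
        by (intro lag_has_derivative[where q="\<lambda>r. y t + r *\<^sub>R \<phi> t" and u="\<lambda>r. Y t + r *\<^sub>R \<phi>1 t"
              and w="\<lambda>r. ?w t + r *\<^sub>R \<phi>2 t"] v(1)) auto
    qed
  next
    fix r assume r: "r \<in> {-e<..<e}"
    have "continuous_on {a..b} (\<lambda>t. lag \<sigma> v (y t + r *\<^sub>R \<phi> t) (Y t + r *\<^sub>R \<phi>1 t) (?w t + r *\<^sub>R \<phi>2 t))"
      by (intro lag_continuous_on cv continuous_intros c cw \<phi>2) (use inU r in auto)
    then show "(\<lambda>t. lag \<sigma> v (y t + r *\<^sub>R \<phi> t) (Y t + r *\<^sub>R \<phi>1 t) (?w t + r *\<^sub>R \<phi>2 t)) integrable_on cbox a b"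
      using integrable_continuous_real by simp
  next
    have c2: "continuous_on ({-e<..<e} \<times> cbox a b) (\<lambda>p. f (snd p))" if "continuous_on {a..b} f" for f :: "real \<Rightarrow> 'e"
      by (rule continuous_on_compose2[OF that continuous_on_snd[OF continuous_on_id]]) auto
    show "continuous_on ({-e<..<e} \<times> cbox a b) (\<lambda>(r, t).
        dlag \<sigma> dv (y t + r *\<^sub>R \<phi> t) (Y t + r *\<^sub>R \<phi>1 t) (?w t + r *\<^sub>R \<phi>2 t) (\<phi> t) (\<phi>1 t) (\<phi>2 t))"
      unfolding split_def
    proof (rule dlag_continuous_on(1)[OF v(2) dv])
      show "(\<lambda>p. y (snd p) + fst p *\<^sub>R \<phi> (snd p)) ` ({- e<..<e} \<times> cbox a b) \<subseteq> U"
        using inU by auto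
    qed (intro continuous_intros c2[OF c(1)] c2[OF c(2)] c2[OF cw] c2[OF c(4)] c2[OF c(5)] c2[OF \<phi>2] | assumption)+
  qed (use e in auto)
  then have 1: "((\<lambda>r. integral {a..b} (\<lambda>t. lag \<sigma> v (y t + r *\<^sub>R \<phi> t) (Y t + r *\<^sub>R \<phi>1 t) (?w t + r *\<^sub>R \<phi>2 t)))
     has_real_derivative integral {a..b} (\<lambda>t. dlag \<sigma> dv (y t) (Y t) (?w t) (\<phi> t) (\<phi>1 t) (\<phi>2 t))) (at 0)"
    using e by (simp add: at_within_open[of 0 "{-e<..<e}"])
  define bd where "bd t = bdry \<sigma> (y t) (Y t) (A t) (B t) (\<phi> t) (\<phi>1 t)" for t
  let ?el = "\<lambda>t. EL \<sigma> dv (y t) (Y t) (A t) (C t) (\<phi> t)"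
  have bd': "(bd has_real_derivative dlag \<sigma> dv (y t) (Y t) (?w t) (\<phi> t) (\<phi>1 t) (\<phi>2 t) - ?el t) (at t within {a..b})"
    if t: "t \<in> {a..b}" for t
  proof -
    note q = yU[OF t]
    note G' = G_has_derivative_along[OF t q y[OF t]]
    have D\<phi>: "((\<lambda>t. \<phi>1 t + \<Gamma> (y t) (Y t) (\<phi> t)) has_vector_derivative
       \<phi>2 t + (fam_deriv \<Gamma> (y t) (Y t) (Y t) (\<phi> t) + \<Gamma> (y t) (?w t) (\<phi> t) + \<Gamma> (y t) (Y t) (\<phi>1 t)))
       (at t within {a..b})"
      by (intro has_vector_derivative_add \<phi>1[OF t]
          bil_family_has_vector_derivative[OF U \<Gamma> t q y[OF t] Y[OF t] \<phi>[OF t]])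
    show ?thesis
      unfolding bd_def bdry_def
      by (rule DERIV_cong[OF DERIV_add[OF DERIV_diff[OF G'[OF A[OF t] D\<phi>] G'[OF B[OF t] \<phi>[OF t]]]
              DERIV_cmult[OF G'[OF Y[OF t] \<phi>[OF t]]]]])
         (simp add: dlag_eq[OF q] EL_def G_simps[OF q] algebra_simps)
  qed
  have "((\<lambda>t. dlag \<sigma> dv (y t) (Y t) (?w t) (\<phi> t) (\<phi>1 t) (\<phi>2 t) - ?el t) has_integral bd b - bd a) {a..b}"
    using ab bd' by (intro fundamental_theorem_of_calculus)
      (auto simp flip: has_real_derivative_iff_has_vector_derivative)
  from has_integral_add[OF this, of ?el "integral {a..b} ?el"]
  have "((\<lambda>t. dlag \<sigma> dv (y t) (Y t) (?w t) (\<phi> t) (\<phi>1 t) (\<phi>2 t)) has_integral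
      bd b - bd a + integral {a..b} ?el) {a..b}" if "(?el has_integral integral {a..b} ?el) {a..b}"
    using that by simp
  moreover have "(?el has_integral integral {a..b} ?el) {a..b}"
    by (intro integrable_integral integrable_continuous_real EL_continuous_on v(2) dv c C yU')
  ultimately have "((\<lambda>t. dlag \<sigma> dv (y t) (Y t) (?w t) (\<phi> t) (\<phi>1 t) (\<phi>2 t)) has_integral
      bd b - bd a + integral {a..b} ?el) {a..b}"
    by blast
  then show ?thesis using 1 by (simp add: integral_unique bd_def)
qed

end


section \<open>Charts and tangent vectors\<close>

locale smooth_atlas =
  fixes A :: "('m::topological_space, 'e::euclidean_space) chart set"
  assumes smooth: "smooth_structure A"
begin

lemma chart:
  assumes "c \<in> A"
  shows "open (dom_of c)" "open (coords c ` dom_of c)"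
    "homeomorphism (dom_of c) (coords c ` dom_of c) (coords c) (param c)"
  using smooth assms unfolding smooth_structure_def is_chart_def by blast+

lemma chart_at: "\<exists>c\<in>A. p \<in> dom_of c"
  using smooth unfolding smooth_structure_def by blast

lemma chart_maps:
  assumes "c \<in> A"
  shows param_coords: "p \<in> dom_of c \<Longrightarrow> param c (coords c p) = p"
    and coords_param: "q \<in> coords c ` dom_of c \<Longrightarrow> coords c (param c q) = q"
    and param_in: "q \<in> coords c ` dom_of c \<Longrightarrow> param c q \<in> dom_of c"
    and continuous_coords: "continuous_on (dom_of c) (coords c)"
    and continuous_param: "continuous_on (coords c ` dom_of c) (param c)"
  using chart(3)[OF assms] unfolding homeomorphism_def by auto

lemma open_coords_image:
  assumes "c \<in> A" "open W"
  shows "open (coords c ` (dom_of c \<inter> W))"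
proof -
  have "coords c ` (dom_of c \<inter> W) = coords c ` dom_of c \<inter> param c -` W"
    using param_coords[OF assms(1)] by force
  moreover have "open (coords c ` dom_of c \<inter> param c -` W)"
    by (rule continuous_open_preimage[OF continuous_param[OF assms(1)] chart(2)[OF assms(1)] assms(2)])
  ultimately show ?thesis by simp
qed

lemma open_overlap: "c \<in> A \<Longrightarrow> d \<in> A \<Longrightarrow> open (coords c ` (dom_of c \<inter> dom_of d))"
  using open_coords_image chart(1) by blast

lemma transition_smooth:
  assumes "c \<in> A" "d \<in> A"
  shows "Ck_on \<infinity> (coords c ` (dom_of c \<inter> dom_of d)) (transition c d)"
  using smooth assms unfolding smooth_structure_def compatible_def by blast

lemma transition_coords: "c \<in> A \<Longrightarrow> p \<in> dom_of c \<Longrightarrow> transition c d (coords c p) = coords d p"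
  by (simp add: transition_def param_coords)

text \<open>The expressions of a function in two charts differ by a transition map.\<close>

lemma Ck_on_chart_change:
  assumes c: "c \<in> A" "d \<in> A"
    and F: "Ck_on k (coords c ` (dom_of c \<inter> W)) (\<lambda>q. F (param c q))"
  shows "Ck_on k (coords d ` (dom_of d \<inter> dom_of c \<inter> W)) (\<lambda>q. F (param d q))"
proof -
  have "Ck_on k (coords d ` (dom_of d \<inter> dom_of c \<inter> W)) (\<lambda>q. F (param c (transition d c q)))"
  proof (rule Ck_on_compose[OF _ F])
    show "Ck_on k (coords d ` (dom_of d \<inter> dom_of c \<inter> W)) (transition d c)"
      by (rule Ck_on_subset[OF Ck_on_mono[OF transition_smooth[OF c(2,1)]]]) auto
    show "transition d c ` coords d ` (dom_of d \<inter> dom_of c \<inter> W) \<subseteq> coords c ` (dom_of c \<inter> W)"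
      using transition_coords[OF c(2), of _ c] by auto
  qed
  then show ?thesis
    by (rule Ck_on_cong[THEN iffD1, rotated])
       (auto simp: transition_coords[OF c(2)] param_coords c)
qed

text \<open>The Jacobian of the change of coordinates at the point \<open>p\<close> of the manifold.\<close>

definition dtrans :: "('m, 'e) chart \<Rightarrow> ('m, 'e) chart \<Rightarrow> 'm \<Rightarrow> 'e \<Rightarrow> 'e" where
  "dtrans c d p = frechet_derivative (transition c d) (at (coords c p))"

context
  fixes c d and p
  assumes c: "c \<in> A" "p \<in> dom_of c" and d: "d \<in> A" "p \<in> dom_of d"
begin

lemma transition_has_derivative:
  "(transition c d has_derivative dtrans c d p) (at (coords c p))"
  unfolding dtrans_def
  using Ck_open_Suc_derivative[OF
      Ck_on_open_imp_Ck_open[OF open_overlap[OF c(1) d(1)] transition_smooth[OF c(1) d(1)], of "Suc 0"]]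
    c d by auto

lemma dtrans_linear: "linear (dtrans c d p)"
  using transition_has_derivative has_derivative_linear by blast

lemma dtrans_refl: "dtrans c c p u = u"
proof -
  have "(transition c c has_derivative (\<lambda>u. u)) (at (coords c p))"
    by (rule has_derivative_transform_within_open[OF has_derivative_ident chart(2)[OF c(1)]])
       (use c in \<open>auto simp: transition_coords\<close>)
  from frechet_derivativeI[OF this] show ?thesis by (simp add: dtrans_def)
qed

lemma coords_in_overlap: "coords c p \<in> coords c ` (dom_of c \<inter> dom_of d)"
  using c d by blast

end

lemma dtrans_comp:
  assumes c: "c \<in> A" "p \<in> dom_of c" and d: "d \<in> A" "p \<in> dom_of d" and e: "e \<in> A" "p \<in> dom_of e"
  shows "dtrans c e p u = dtrans d e p (dtrans c d p u)"
proof -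
  have 1: "((\<lambda>q. transition d e (transition c d q)) has_derivative (\<lambda>u. dtrans d e p (dtrans c d p u)))
     (at (coords c p))"
    by (rule has_derivative_compose[OF transition_has_derivative[OF c d]])
       (simp add: transition_has_derivative[OF d e] transition_coords[OF c])
  have "(transition c e has_derivative (\<lambda>u. dtrans d e p (dtrans c d p u))) (at (coords c p))"
    by (rule has_derivative_transform_within_open[OF 1 open_overlap[OF c(1) d(1)] coords_in_overlap[OF c d]])
       (auto simp: transition_coords c d)
  from frechet_derivativeI[OF this] show ?thesis by (simp add: dtrans_def)
qed

lemma tangentD:
  assumes "v \<in> tangent_space A p" "c \<in> A" "p \<in> dom_of c" "d \<in> A" "p \<in> dom_of d"
  shows "v d = dtrans c d p (v c)"
  using assms unfolding tangent_space_def charts_at_def dtrans_def by blast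

lemma tangent_off: "v \<in> tangent_space A p \<Longrightarrow> c \<notin> charts_at A p \<Longrightarrow> v c = 0"
  unfolding tangent_space_def by blast

lemma tangentI:
  assumes "\<And>c d. c \<in> A \<Longrightarrow> p \<in> dom_of c \<Longrightarrow> d \<in> A \<Longrightarrow> p \<in> dom_of d \<Longrightarrow> v d = dtrans c d p (v c)"
    "\<And>c. c \<notin> charts_at A p \<Longrightarrow> v c = 0"
  shows "v \<in> tangent_space A p"
  using assms unfolding tangent_space_def charts_at_def dtrans_def by blast

lemma coord_field_apply:
  "c \<in> A \<Longrightarrow> d \<in> A \<Longrightarrow> p \<in> dom_of d \<Longrightarrow> coord_field A c u p d = dtrans c d p u"
  by (simp add: coord_field_def charts_at_def dtrans_def)

lemma coord_field_self: "c \<in> A \<Longrightarrow> p \<in> dom_of c \<Longrightarrow> coord_field A c u p c = u"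
  by (simp add: coord_field_apply dtrans_refl)

lemma coord_field_tangent:
  assumes "c \<in> A" "p \<in> dom_of c"
  shows "coord_field A c u p \<in> tangent_space A p"
proof (rule tangentI)
  fix d e assume "d \<in> A" "p \<in> dom_of d" "e \<in> A" "p \<in> dom_of e"
  then show "coord_field A c u p e = dtrans d e p (coord_field A c u p d)"
    unfolding coord_field_apply[OF assms(1) \<open>d \<in> A\<close> \<open>p \<in> dom_of d\<close>]
      coord_field_apply[OF assms(1) \<open>e \<in> A\<close> \<open>p \<in> dom_of e\<close>]
    by (intro dtrans_comp assms)
qed (simp add: coord_field_def)

lemma tangent_eqI:
  assumes "v \<in> tangent_space A p" "w \<in> tangent_space A p" "c \<in> A" "p \<in> dom_of c" "v c = w c"
  shows "v = w"
proof
  fix d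
  show "v d = w d"
    using tangentD[OF assms(1,3,4), of d] tangentD[OF assms(2,3,4), of d] assms(5)
      tangent_off[OF assms(1), of d] tangent_off[OF assms(2), of d]
    by (cases "d \<in> charts_at A p") (auto simp: charts_at_def)
qed

lemma tangent_eq_coord_field:
  assumes "v \<in> tangent_space A p" "c \<in> A" "p \<in> dom_of c"
  shows "coord_field A c (v c) p = v"
  by (rule tangent_eqI[OF coord_field_tangent assms(1), where c=c]) (simp_all add: assms coord_field_self)

lemma tangent_linear:
  assumes "v \<in> tangent_space A p" "w \<in> tangent_space A p"
  shows "(\<lambda>c. a *\<^sub>R v c + b *\<^sub>R w c) \<in> tangent_space A p"
proof (rule tangentI)
  fix c d assume c: "c \<in> A" "p \<in> dom_of c" "d \<in> A" "p \<in> dom_of d"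
  interpret linear "dtrans c d p" by (rule dtrans_linear[OF c])
  show "a *\<^sub>R v d + b *\<^sub>R w d = dtrans c d p (a *\<^sub>R v c + b *\<^sub>R w c)"
    using tangentD[OF assms(1) c] tangentD[OF assms(2) c] by (simp add: add scaleR)
qed (simp add: tangent_off[OF assms(1)] tangent_off[OF assms(2)])

lemma coord_field_linear:
  assumes "c \<in> A" "p \<in> dom_of c"
  shows "coord_field A c (a *\<^sub>R u + b *\<^sub>R v) p
    = (\<lambda>d. a *\<^sub>R coord_field A c u p d + b *\<^sub>R coord_field A c v p d)"
  by (rule tangent_eqI[OF coord_field_tangent tangent_linear[OF coord_field_tangent coord_field_tangent], where c=c])
     (simp_all add: assms coord_field_self)

text \<open>The chart that enters the definition of the differential is arbitrary, by the chain rule.\<close>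

lemma differential_chart:
  assumes f: "f \<circ> param c differentiable at (coords c p)"
    and v: "v \<in> tangent_space A p" and c: "c \<in> A" "p \<in> dom_of c"
  shows "differential A f p v = frechet_derivative (f \<circ> param c) (at (coords c p)) (v c)"
proof -
  define d where "d = (SOME c. c \<in> charts_at A p)"
  have "d \<in> charts_at A p" unfolding d_def by (rule someI[of _ c]) (use c in \<open>simp add: charts_at_def\<close>)
  then have d: "d \<in> A" "p \<in> dom_of d" by (auto simp: charts_at_def)
  let ?D = "frechet_derivative (f \<circ> param c) (at (coords c p))"
  have "((\<lambda>q. (f \<circ> param c) (transition d c q)) has_derivative (\<lambda>u. ?D (dtrans d c p u))) (at (coords d p))"
    by (rule has_derivative_compose[OF transition_has_derivative[OF d c]])
       (simp only: transition_coords[OF d] has_derivative_frechet[OF f])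
  then have "(f \<circ> param d has_derivative (\<lambda>u. ?D (dtrans d c p u))) (at (coords d p))"
    by (rule has_derivative_transform_within_open[OF _ open_overlap[OF d(1) c(1)] coords_in_overlap[OF d c]])
       (auto simp: transition_coords c d param_coords)
  from frechet_derivativeI[OF this] show ?thesis
    using tangentD[OF v d c] by (simp add: differential_def d_def[symmetric] Let_def)
qed


section \<open>Vector fields\<close>

lemma vector_fieldsD:
  assumes "X \<in> vector_fields A W"
  shows "p \<in> W \<Longrightarrow> X p \<in> tangent_space A p"
    "c \<in> A \<Longrightarrow> Ck_on \<infinity> (coords c ` (dom_of c \<inter> W)) (\<lambda>q. X (param c q) c)"
  using assms unfolding vector_fields_def by blast+

lemma vector_fields_subset:
  assumes "X \<in> vector_fields A W" "W' \<subseteq> W"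
  shows "X \<in> vector_fields A W'"
  using assms vector_fieldsD[OF assms(1)] unfolding vector_fields_def
  by (auto intro: Ck_on_subset[OF vector_fieldsD(2)[OF assms(1)]])

lemma Ck_fun_of_chart:
  assumes "c \<in> A" "W \<subseteq> dom_of c" "Ck_on k (coords c ` (dom_of c \<inter> W)) (\<lambda>q. f (param c q))"
  shows "Ck_fun A k W f"
  unfolding Ck_fun_def
proof
  fix d assume "d \<in> A"
  from Ck_on_chart_change[OF assms(1) this assms(3)]
  show "Ck_on k (coords d ` (dom_of d \<inter> W)) (f \<circ> param d)"
    using assms(2) by (simp add: comp_def Int_absorb1 Int_assoc)
qed

lemma vector_fields_scale:
  assumes X: "X \<in> vector_fields A W" and f: "Ck_fun A \<infinity> W f"
  shows "(\<lambda>p c. f p *\<^sub>R X p c) \<in> vector_fields A W"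
  unfolding vector_fields_def
proof (intro CollectI conjI ballI)
  show "(\<lambda>c. f p *\<^sub>R X p c) \<in> tangent_space A p" if "p \<in> W" for p
    using tangent_linear[OF vector_fieldsD(1)[OF X that] vector_fieldsD(1)[OF X that], of "f p" 0] by simp
  show "Ck_on \<infinity> (coords c ` (dom_of c \<inter> W)) (\<lambda>q. f (param c q) *\<^sub>R X (param c q) c)" if "c \<in> A" for c
    using f that unfolding Ck_fun_def comp_def
    by (intro Ck_on_bounded_bilinear[OF bounded_bilinear_scaleR] vector_fieldsD(2)[OF X that]) auto
qed

lemma vector_fields_add:
  assumes X: "X \<in> vector_fields A W" and Y: "Y \<in> vector_fields A W"
  shows "(\<lambda>p c. X p c + Y p c) \<in> vector_fields A W"
  unfolding vector_fields_def
proof (intro CollectI conjI ballI)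
  show "(\<lambda>c. X p c + Y p c) \<in> tangent_space A p" if "p \<in> W" for p
    using tangent_linear[OF vector_fieldsD(1)[OF X that] vector_fieldsD(1)[OF Y that], of 1 1] by simp
  show "Ck_on \<infinity> (coords c ` (dom_of c \<inter> W)) (\<lambda>q. X (param c q) c + Y (param c q) c)" if "c \<in> A" for c
    by (intro Ck_on_add vector_fieldsD(2)[OF X that] vector_fieldsD(2)[OF Y that])
qed

lemma tangent_zero: "(\<lambda>c. 0) \<in> tangent_space A p"
  using tangentI dtrans_linear linear_0 by metis

lemma vector_fields_zero:
  assumes "\<And>p. p \<in> W \<Longrightarrow> X p = (\<lambda>c. 0)"
  shows "X \<in> vector_fields A W"
  unfolding vector_fields_def
proof (intro CollectI conjI ballI)
  show "X p \<in> tangent_space A p" if "p \<in> W" for p using tangent_zero assms[OF that] by simp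
  show "Ck_on \<infinity> (coords c ` (dom_of c \<inter> W)) (\<lambda>q. X (param c q) c)" if "c \<in> A" for c
    by (rule Ck_on_cong[THEN iffD1, OF _ Ck_on_const[of _ _ 0]]) (auto simp: assms that param_coords)
qed

lemma vector_fields_sum:
  assumes "\<And>j. j \<in> J \<Longrightarrow> X j \<in> vector_fields A W"
  shows "(\<lambda>p c. \<Sum>j\<in>J. X j p c) \<in> vector_fields A W"
  using assms
  by (induction J rule: infinite_finite_induct) (simp_all add: vector_fields_zero vector_fields_add)

lemma coord_field_vector_field:
  assumes c: "c \<in> A"
  shows "coord_field A c u \<in> vector_fields A (dom_of c)"
  unfolding vector_fields_def
proof (intro CollectI conjI ballI)
  show "coord_field A c u p \<in> tangent_space A p" if "p \<in> dom_of c" for p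
    using coord_field_tangent c that .
  fix d assume d: "d \<in> A"
  let ?O = "coords c ` (dom_of c \<inter> dom_of d)"
  have o: "open ?O" by (rule open_overlap[OF c d])
  have "Ck_open j ?O (\<lambda>q. frechet_derivative (transition c d) (at q) u)" for j
    by (rule Ck_open_frechet[OF Ck_on_open_imp_Ck_open[OF o transition_smooth[OF c d]]]) simp
  then have 1: "Ck_on \<infinity> ?O (\<lambda>q. frechet_derivative (transition c d) (at q) u)"
    by (rule Ck_onI_open[OF o])
  have "Ck_on \<infinity> (coords d ` (dom_of d \<inter> dom_of c))
     (\<lambda>q. frechet_derivative (transition c d) (at (transition d c q)) u)"
    by (rule Ck_on_compose[OF transition_smooth[OF d c] 1]) (auto simp: transition_coords d)
  then show "Ck_on \<infinity> (coords d ` (dom_of d \<inter> dom_of c)) (\<lambda>q. coord_field A c u (param d q) d)"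
    by (rule Ck_on_cong[THEN iffD1, rotated])
       (auto simp: transition_coords d c param_coords coord_field_apply dtrans_def)
qed

lemma vector_field_component:
  assumes c: "c \<in> A" "W \<subseteq> dom_of c" and X: "X \<in> vector_fields A W"
  shows "Ck_fun A \<infinity> W (\<lambda>p. X p c \<bullet> i)"
  by (rule Ck_fun_of_chart[OF c])
    (intro Ck_on_compose_linear[OF vector_fieldsD(2)[OF X c(1)] bounded_linear_inner_left])

lemma vector_field_has_derivative:
  assumes c: "c \<in> A" "p \<in> dom_of c" and W: "open W" "p \<in> W" and X: "X \<in> vector_fields A W"
  shows "((\<lambda>q. X (param c q) c) has_derivative
    frechet_derivative (\<lambda>q. X (param c q) c) (at (coords c p))) (at (coords c p))"
  using Ck_open_Suc_derivative[OF Ck_on_open_imp_Ck_open[OF open_coords_image[OF c(1) W(1)]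
        vector_fieldsD(2)[OF X c(1)], of "Suc 0"]] c W by auto

end


section \<open>The Levi-Civita connection in coordinates\<close>

text \<open>The product rule needed for the second derivative of a curve in new coordinates, where \<open>f\<close> is the
  transition map and \<open>u\<close> the velocity.\<close>

lemma frechet_derivative_along_curve:
  fixes f :: "'a::euclidean_space \<Rightarrow> 'b::euclidean_space"
  assumes W: "open W" "z t \<in> W" and f: "Ck_open 2 W f"
    and z: "(z has_vector_derivative z') (at t)" and u: "(u has_vector_derivative u') (at t)"
  shows "((\<lambda>s. frechet_derivative f (at (z s)) (u s)) has_vector_derivative
     frechet_derivative (\<lambda>q. frechet_derivative f (at q) (u t)) (at (z t)) z'
     + frechet_derivative f (at (z t)) u') (at t)"
proof -
  define D where "D w p = frechet_derivative f (at p) w" for w p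
  define E where "E w p = frechet_derivative (D w) (at p)" for w p
  have f2: "Ck_open (Suc (Suc 0)) W f" using f by (simp add: numeral_2_eq_2)
  have D1: "Ck_open (Suc 0) W (D w)" for w
    using Ck_open_frechet[OF f2] by (simp add: D_def[abs_def])
  have E: "(D w has_derivative E w p) (at p)" if "p \<in> W" for w p
    using Ck_open_Suc_derivative[OF D1 that] by (simp add: E_def)
  have Elin: "linear (E w (z t))" for w using E[OF W(2)] has_derivative_linear by blast
  have Dsum: "D w p = (\<Sum>k\<in>Basis. (w \<bullet> k) *\<^sub>R D k p)" if "p \<in> W" for w p
  proof -
    have "linear (\<lambda>w. D w p)"
      unfolding D_def using Ck_open_Suc_derivative[OF f2 that] has_derivative_linear by blast
    from linear_sum[OF this, of "\<lambda>k. (w \<bullet> k) *\<^sub>R k" Basis] linear_scale[OF this]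
    show ?thesis by (simp add: euclidean_representation)
  qed
  have Esum: "E w (z t) h = (\<Sum>k\<in>Basis. (w \<bullet> k) *\<^sub>R E k (z t) h)" for w h
  proof -
    have "((\<lambda>p. \<Sum>k\<in>Basis. (w \<bullet> k) *\<^sub>R D k p) has_derivative
        (\<lambda>h. \<Sum>k\<in>Basis. (w \<bullet> k) *\<^sub>R E k (z t) h)) (at (z t))"
      by (intro has_derivative_sum has_derivative_scaleR_right E W)
    from has_derivative_transform_within_open[OF this W, of "D w"]
    have "(D w has_derivative (\<lambda>h. \<Sum>k\<in>Basis. (w \<bullet> k) *\<^sub>R E k (z t) h)) (at (z t))"
      using Dsum by simp
    from frechet_derivativeI[OF this] show ?thesis by (simp add: E_def)
  qed
  have 1: "((\<lambda>s. D k (z s)) has_vector_derivative E k (z t) z') (at t)" for k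
  proof -
    have "((\<lambda>s. D k (z s)) has_derivative (\<lambda>r. E k (z t) (r *\<^sub>R z'))) (at t)"
      by (rule has_derivative_compose[OF z[unfolded has_vector_derivative_def] E[OF W(2)]])
    then show ?thesis unfolding has_vector_derivative_def by (simp add: linear_scale[OF Elin])
  qed
  have 2: "((\<lambda>s. u s \<bullet> k) has_real_derivative u' \<bullet> k) (at t)" for k
    using bounded_linear.has_vector_derivative[OF bounded_linear_inner_left u]
    by (simp add: has_real_derivative_iff_has_vector_derivative)
  have 3: "((\<lambda>s. \<Sum>k\<in>Basis. (u s \<bullet> k) *\<^sub>R D k (z s)) has_vector_derivative
     (\<Sum>k\<in>Basis. (u t \<bullet> k) *\<^sub>R E k (z t) z' + (u' \<bullet> k) *\<^sub>R D k (z t))) (at t)"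
    by (intro has_vector_derivative_sum has_vector_derivative_scaleR 1 2)
  have "\<forall>\<^sub>F s in nhds t. z s \<in> W"
    using has_vector_derivative_continuous[OF z] W unfolding isCont_def tendsto_at_iff_tendsto_nhds
    by (metis topological_tendstoD)
  then have ev: "\<forall>\<^sub>F s in nhds t. s \<in> UNIV \<longrightarrow> (\<Sum>k\<in>Basis. (u s \<bullet> k) *\<^sub>R D k (z s)) = D (u s) (z s)"
    by eventually_elim (simp add: Dsum[symmetric])
  have "((\<lambda>s. D (u s) (z s)) has_vector_derivative E (u t) (z t) z' + D u' (z t)) (at t)"
    using has_vector_derivative_cong_ev[OF ev] 3 Dsum[OF W(2), symmetric]
    by (simp add: sum.distrib Esum[symmetric])
  then show ?thesis by (simp add: D_def[abs_def] E_def)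
qed

text \<open>A positive definite form is nondegenerate, so that the linear map \<open>w \<mapsto> G(w, \<cdot>)\<close> is injective, hence
  surjective for reasons of dimension.\<close>

lemma (in chart_geometry) riesz:
  assumes q: "q \<in> U" and l: "linear l"
  shows "\<exists>w. \<forall>v. G q w v = l v"
proof -
  let ?L = "\<lambda>w. \<Sum>j\<in>Basis. G q w j *\<^sub>R j"
  have Lj: "?L w \<bullet> j = G q w j" if "j \<in> Basis" for w j
    using that by (simp add: inner_sum_left inner_Basis if_distrib cong: if_cong)
  have expand: "f v = (\<Sum>j\<in>Basis. (v \<bullet> j) * f j)" if "linear f" for f :: "'e \<Rightarrow> real" and v
    using linear_sum[OF that, of "\<lambda>j. (v \<bullet> j) *\<^sub>R j" Basis] linear_scale[OF that]
    by (simp add: euclidean_representation)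
  have Gl: "linear (G q w)" for w by (rule linearI) (simp_all add: G_simps[OF q])
  have L: "linear ?L"
    by (rule linearI) (simp_all add: G_simps[OF q] scaleR_add_left sum.distrib scaleR_right.sum)
  have "inj ?L"
  proof (subst linear_injective_0[OF L], intro allI impI)
    fix w assume "?L w = 0"
    then have "G q w j = 0" if "j \<in> Basis" for j using Lj[OF that, of w] by simp
    then have "G q w v = 0" for v using expand[OF Gl, of w v] by simp
    then show "w = 0" by (rule G_nondegenerate[OF q])
  qed
  then have "surj ?L" using linear_injective_imp_surjective[OF L] by blast
  then obtain w where w: "?L w = (\<Sum>j\<in>Basis. l j *\<^sub>R j)"
    using surjD[of ?L "\<Sum>j\<in>Basis. l j *\<^sub>R j"] by fastforce
  have wj: "G q w j = l j" if "j \<in> Basis" for j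
    using arg_cong[OF w, of "\<lambda>x. x \<bullet> j"] Lj[OF that, of w] that
    by (simp add: inner_sum_left inner_Basis if_distrib cong: if_cong)
  have "G q w v = l v" for v
    unfolding expand[OF Gl, of w v] expand[OF l, of v] by (rule sum.cong) (simp_all add: wj)
  then show ?thesis by blast
qed

locale riemannian = smooth_atlas A
  for A :: "('m::topological_space, 'e::euclidean_space) chart set" +
  fixes g :: "'m \<Rightarrow> ('m, 'e) tvec \<Rightarrow> ('m, 'e) tvec \<Rightarrow> real"
    and nab :: "('m \<Rightarrow> ('m, 'e) tvec) \<Rightarrow> ('m \<Rightarrow> ('m, 'e) tvec) \<Rightarrow> 'm \<Rightarrow> ('m, 'e) tvec"
  assumes metric: "riemannian_metric A g" and lc: "levi_civita A g nab"
begin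

lemma connection: "affine_connection A nab"
  using lc by (simp add: levi_civita_def)

context
  fixes W X Y assumes W: "open W" and X: "X \<in> vector_fields A W" and Y: "Y \<in> vector_fields A W"
begin

lemmas connection_W = connection[unfolded affine_connection_def, THEN spec, THEN mp, OF W]

lemma nab_vector_field: "nab X Y \<in> vector_fields A W"
  by (rule connection_W[THEN conjunct1, THEN bspec, OF X, THEN bspec, OF Y])

lemma nab_add_left:
  assumes Z: "Z \<in> vector_fields A W" and p: "p \<in> W"
  shows "nab (\<lambda>p c. X p c + Y p c) Z p c = nab X Z p c + nab Y Z p c"
  by (rule connection_W[THEN conjunct2, THEN conjunct1, THEN bspec, OF X, THEN bspec, OF Y,
        THEN bspec, OF Z, THEN bspec, OF p, THEN spec, THEN conjunct1])

lemma nab_add_right: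
  assumes Z: "Z \<in> vector_fields A W" and p: "p \<in> W"
  shows "nab Z (\<lambda>p c. X p c + Y p c) p c = nab Z X p c + nab Z Y p c"
  by (rule connection_W[THEN conjunct2, THEN conjunct1, THEN bspec, OF Z, THEN bspec, OF X,
        THEN bspec, OF Y, THEN bspec, OF p, THEN spec, THEN conjunct2])

lemmas connection_scale = connection_W[THEN conjunct2, THEN conjunct2, THEN bspec, OF X,
  THEN bspec, OF Y, THEN spec, THEN mp, THEN bspec, THEN spec]

lemma nab_scale_left:
  "Ck_fun A \<infinity> W f \<Longrightarrow> p \<in> W \<Longrightarrow> nab (\<lambda>p c. f p *\<^sub>R X p c) Y p c = f p *\<^sub>R nab X Y p c"
  by (rule connection_scale[THEN conjunct1])

lemma nab_scale_right:
  "Ck_fun A \<infinity> W f \<Longrightarrow> p \<in> W \<Longrightarrow> nab X (\<lambda>p c. f p *\<^sub>R Y p c) p c =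
    differential A f p (X p) *\<^sub>R Y p c + f p *\<^sub>R nab X Y p c"
  by (rule connection_scale[THEN conjunct2])

lemmas levi_civita_W = lc[unfolded levi_civita_def, THEN conjunct2, THEN spec, THEN mp, OF W]

lemma nab_torsion_free:
  assumes p: "p \<in> W"
  shows "nab X Y p c - nab Y X p c = lie_bracket A X Y p c"
  by (rule levi_civita_W[THEN conjunct1, THEN bspec, OF X, THEN bspec, OF Y, THEN bspec, OF p, THEN spec])

lemma nab_metric:
  assumes Z: "Z \<in> vector_fields A W" and p: "p \<in> W"
  shows "differential A (\<lambda>p. g p (Y p) (Z p)) p (X p) = g p (nab X Y p) (Z p) + g p (Y p) (nab X Z p)"
  by (rule levi_civita_W[THEN conjunct2, THEN bspec, OF X, THEN bspec, OF Y, THEN bspec, OF Z, THEN bspec, OF p])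

end

text \<open>A field that vanishes on \<open>W\<close> is not changed by multiplication with the function that is 0 on \<open>W\<close>
  and 1 elsewhere; the product rules for this function show that the connection is local.\<close>

lemma nab_vanish:
  assumes W: "open W" and X: "X \<in> vector_fields A W" and Z: "\<And>p. p \<in> W \<Longrightarrow> Z p = (\<lambda>c. 0)"
    and p: "p \<in> W"
  shows "nab Z X p c = 0" "nab X Z p c = 0"
proof -
  let ?f = "\<lambda>p. if p \<in> W then 0 else (1::real)"
  have f: "Ck_fun A \<infinity> W ?f"
    unfolding Ck_fun_def
  proof
    fix c assume "c \<in> A"
    then show "Ck_on \<infinity> (coords c ` (dom_of c \<inter> W)) (?f \<circ> param c)"
      by (intro Ck_on_cong[THEN iffD1, OF _ Ck_on_const[of _ _ 0]]) (auto simp: param_coords)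
  qed
  have fZ: "(\<lambda>p c. ?f p *\<^sub>R Z p c) = Z" using Z by (auto simp: fun_eq_iff)
  have vf: "Z \<in> vector_fields A W" by (rule vector_fields_zero[OF Z])
  show "nab Z X p c = 0" using nab_scale_left[OF W vf X f p, of c] p by (simp only: fZ) simp
  show "nab X Z p c = 0" using nab_scale_right[OF W X vf f p, of c] p by (simp only: fZ) (simp add: Z)
qed

lemma vector_fields_diff:
  assumes "X \<in> vector_fields A W" "Y \<in> vector_fields A W"
  shows "(\<lambda>p c. X p c - Y p c) \<in> vector_fields A W"
proof -
  have "Ck_fun A \<infinity> W (\<lambda>p. - 1)" unfolding Ck_fun_def comp_def by (simp add: Ck_on_const)
  from vector_fields_add[OF assms(1) vector_fields_scale[OF assms(2) this]] show ?thesis by simp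
qed

text \<open>Identities between coordinate fields, such as linearity in the components, hold on the domain of the
  chart only; locality makes them available under the connection.\<close>

lemma nab_cong:
  assumes W: "open W" and X: "X \<in> vector_fields A W" "X' \<in> vector_fields A W"
    and Y: "Y \<in> vector_fields A W" "Y' \<in> vector_fields A W"
    and eq: "\<And>p. p \<in> W \<Longrightarrow> X p = X' p" "\<And>p. p \<in> W \<Longrightarrow> Y p = Y' p" and p: "p \<in> W"
  shows "nab X Y p c = nab X' Y' p c"
proof -
  let ?Z = "\<lambda>p c. X' p c - X p c" and ?Z' = "\<lambda>p c. Y' p c - Y p c"
  have "nab X' Y p c = nab (\<lambda>p c. X p c + ?Z p c) Y p c" by simp
  also have "\<dots> = nab X Y p c"
    unfolding nab_add_left[OF W X(1) vector_fields_diff[OF X(2,1)] Y(1) p]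
    using nab_vanish(1)[OF W Y(1) _ p, of ?Z c] eq(1) by simp
  finally have "nab X Y p c = nab X' Y p c" ..
  also have "nab X' Y' p c = nab X' (\<lambda>p c. Y p c + ?Z' p c) p c" by simp
  then have "nab X' Y p c = nab X' Y' p c"
    unfolding nab_add_right[OF W Y(1) vector_fields_diff[OF Y(2,1)] X(2) p]
    using nab_vanish(2)[OF W X(2) _ p, of ?Z' c] eq(2) by simp
  finally show ?thesis .
qed

lemma nab_sum:
  assumes W: "open W" and X: "\<And>j. j \<in> J \<Longrightarrow> X j \<in> vector_fields A W"
    and Y: "Y \<in> vector_fields A W" and p: "p \<in> W"
  shows "nab (\<lambda>p c. \<Sum>j\<in>J. X j p c) Y p c = (\<Sum>j\<in>J. nab (X j) Y p c)"
    and "nab Y (\<lambda>p c. \<Sum>j\<in>J. X j p c) p c = (\<Sum>j\<in>J. nab Y (X j) p c)"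
  using X
proof (induction J rule: infinite_finite_induct)
  case (insert i J)
  {
    case 1 then show ?case
      using insert nab_add_left[OF W _ vector_fields_sum Y p, of "X i" J X c] by simp
  next
    case 2 then show ?case
      using insert nab_add_right[OF W _ vector_fields_sum Y p, of "X i" J X c] by simp
  }
qed (simp_all add: nab_vanish[OF W Y _ p])

text \<open>The Christoffel symbols and the metric coefficients in a chart, as functions of the coordinates.\<close>

definition Chr :: "('m, 'e) chart \<Rightarrow> 'e \<Rightarrow> 'e \<Rightarrow> 'e \<Rightarrow> 'e" where
  "Chr c q u v = nab (coord_field A c u) (coord_field A c v) (param c q) c"

definition Gc :: "('m, 'e) chart \<Rightarrow> 'e \<Rightarrow> 'e \<Rightarrow> 'e \<Rightarrow> real" where
  "Gc c q u v = g (param c q) (coord_field A c u (param c q)) (coord_field A c v (param c q))"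

lemma Ck_fun_const: "Ck_fun A k W (\<lambda>p. r)"
  unfolding Ck_fun_def comp_def by (simp add: Ck_on_const)

lemma differential_const:
  assumes "v \<in> tangent_space A p"
  shows "differential A (\<lambda>p. r) p v = 0"
proof -
  obtain c where "c \<in> A" "p \<in> dom_of c" using chart_at by blast
  from differential_chart[OF _ assms this, of "\<lambda>p. r"] show ?thesis by (simp add: comp_def)
qed

lemma Chr_linear:
  assumes c: "c \<in> A" and q: "q \<in> coords c ` dom_of c"
  shows "Chr c q (a *\<^sub>R u + b *\<^sub>R v) w = a *\<^sub>R Chr c q u w + b *\<^sub>R Chr c q v w"
    and "Chr c q w (a *\<^sub>R u + b *\<^sub>R v) = a *\<^sub>R Chr c q w u + b *\<^sub>R Chr c q w v"
proof -
  note W = chart(1)[OF c]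
  note p = param_in[OF c q]
  note vf = coord_field_vector_field[OF c]
  note sc = vector_fields_scale[OF vf Ck_fun_const]
  let ?Z = "\<lambda>p d. a *\<^sub>R coord_field A c u p d + b *\<^sub>R coord_field A c v p d"
  have Z: "?Z \<in> vector_fields A (dom_of c)" by (intro vector_fields_add sc)
  have eq: "coord_field A c (a *\<^sub>R u + b *\<^sub>R v) p = ?Z p" if "p \<in> dom_of c" for p
    by (rule coord_field_linear[OF c that])
  have "Chr c q (a *\<^sub>R u + b *\<^sub>R v) w = nab ?Z (coord_field A c w) (param c q) c"
    unfolding Chr_def by (rule nab_cong[OF W vf Z vf vf eq refl p])
  then show "Chr c q (a *\<^sub>R u + b *\<^sub>R v) w = a *\<^sub>R Chr c q u w + b *\<^sub>R Chr c q v w"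
    unfolding nab_add_left[OF W sc sc vf p] nab_scale_left[OF W vf vf Ck_fun_const p]
    by (simp add: Chr_def)
  have "Chr c q w (a *\<^sub>R u + b *\<^sub>R v) = nab (coord_field A c w) ?Z (param c q) c"
    unfolding Chr_def by (rule nab_cong[OF W vf vf vf Z refl eq p])
  then show "Chr c q w (a *\<^sub>R u + b *\<^sub>R v) = a *\<^sub>R Chr c q w u + b *\<^sub>R Chr c q w v"
    unfolding nab_add_right[OF W sc sc vf p] nab_scale_right[OF W vf vf Ck_fun_const p]
    by (simp add: Chr_def differential_const[OF coord_field_tangent[OF c p]])
qed

lemma Chr_bil_family:
  assumes c: "c \<in> A"
  shows "bil_family (coords c ` dom_of c) (Chr c)"
  unfolding bil_family_def
proof (intro conjI ballI allI)
  fix q assume q: "q \<in> coords c ` dom_of c"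
  have "linear (\<lambda>u. Chr c q u v)" "linear (Chr c q v)" for v
    using Chr_linear(1)[OF c q, of 1 _ 1] Chr_linear(1)[OF c q, of _ _ 0]
      Chr_linear(2)[OF c q, of _ 1 _ 1] Chr_linear(2)[OF c q, of _ _ _ 0]
    by (auto intro!: linearI)
  then show "bilinear (Chr c q)" by (simp add: bilinear_def)
next
  fix u v j
  have "Ck_on \<infinity> (coords c ` dom_of c) (\<lambda>q. Chr c q u v)"
    unfolding Chr_def
    using vector_fieldsD(2)[OF nab_vector_field[OF chart(1) coord_field_vector_field coord_field_vector_field]] c
    by fastforce
  then show "Ck_open j (coords c ` dom_of c) (\<lambda>q. Chr c q u v)"
    by (rule Ck_on_open_imp_Ck_open[OF chart(2)[OF c]]) simp
qed

lemma vector_field_expand: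
  assumes c: "c \<in> A" "p \<in> dom_of c" and X: "X p \<in> tangent_space A p"
  shows "X p = (\<lambda>d. \<Sum>i\<in>Basis. (X p c \<bullet> i) *\<^sub>R coord_field A c i p d)"
proof -
  have "(\<lambda>d. \<Sum>i\<in>B. (X p c \<bullet> i) *\<^sub>R coord_field A c i p d) \<in> tangent_space A p" if "finite B" for B
    using that
  proof induction
    case (insert i B)
    then show ?case
      using tangent_linear[OF coord_field_tangent[OF c] insert.IH, of "X p c \<bullet> i" i 1] by simp
  qed (simp add: tangent_zero)
  from tangent_eqI[OF X this[OF finite_Basis] c] show ?thesis
    by (simp add: coord_field_self[OF c] euclidean_representation)
qed

text \<open>Both arguments are expanded in the coordinate frame of the chart.\<close>

lemma nab_chart:
  assumes c: "c \<in> A" "W \<subseteq> dom_of c" and W: "open W" and p: "p \<in> W"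
    and X: "X \<in> vector_fields A W" and Y: "Y \<in> vector_fields A W"
  shows "nab X Y p c = frechet_derivative (\<lambda>q. Y (param c q) c) (at (coords c p)) (X p c)
    + Chr c (coords c p) (X p c) (Y p c)"
proof -
  have pc: "p \<in> dom_of c" using c p by auto
  note E = vector_fields_subset[OF coord_field_vector_field[OF c(1)] c(2)]
  note fX = vector_field_component[OF c X] and fY = vector_field_component[OF c Y]
  define D where "D = frechet_derivative (\<lambda>q. Y (param c q) c) (at (coords c p))"
  have D: "((\<lambda>q. Y (param c q) c) has_derivative D) (at (coords c p))"
    unfolding D_def by (rule vector_field_has_derivative[OF c(1) pc W p Y])
  have lin: "linear D" using D has_derivative_linear by blast
  have q: "coords c p \<in> coords c ` dom_of c" using pc by blast
  have dif: "differential A (\<lambda>p. Y p c \<bullet> j) p (coord_field A c i p) = D i \<bullet> j" for i j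
  proof -
    have "((\<lambda>p. Y p c \<bullet> j) \<circ> param c has_derivative (\<lambda>h. D h \<bullet> j)) (at (coords c p))"
      unfolding comp_def by (intro has_derivative_inner_left D)
    from differential_chart[OF differentiableI[OF this] coord_field_tangent[OF c(1) pc] c(1) pc]
      frechet_derivativeI[OF this]
    show ?thesis by (simp add: coord_field_self c pc)
  qed
  have 1: "nab (coord_field A c i) Y p c = D i + (\<Sum>j\<in>Basis. (Y p c \<bullet> j) *\<^sub>R Chr c (coords c p) i j)" for i
  proof -
    let ?S = "\<lambda>p d. \<Sum>j\<in>Basis. (Y p c \<bullet> j) *\<^sub>R coord_field A c j p d"
    have S: "?S \<in> vector_fields A W" by (intro vector_fields_sum vector_fields_scale E fY)
    have "nab (coord_field A c i) Y p c = nab (coord_field A c i) ?S p c"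
      by (rule nab_cong[OF W E E Y S refl _ p], rule vector_field_expand)
         (use c vector_fieldsD(1)[OF Y] in auto)
    also have "\<dots> = (\<Sum>j\<in>Basis. nab (coord_field A c i) (\<lambda>p d. (Y p c \<bullet> j) *\<^sub>R coord_field A c j p d) p c)"
      by (intro nab_sum(2)[OF W _ E p] vector_fields_scale E fY)
    also have "\<dots> = (\<Sum>j\<in>Basis. (D i \<bullet> j) *\<^sub>R j + (Y p c \<bullet> j) *\<^sub>R Chr c (coords c p) i j)"
      by (rule sum.cong)
         (simp_all add: nab_scale_right[OF W E E fY p] dif coord_field_self[OF c(1) pc] Chr_def param_coords[OF c(1) pc])
    finally show ?thesis by (simp add: sum.distrib euclidean_representation)
  qed
  let ?S = "\<lambda>p d. \<Sum>i\<in>Basis. (X p c \<bullet> i) *\<^sub>R coord_field A c i p d"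
  have S: "?S \<in> vector_fields A W" by (intro vector_fields_sum vector_fields_scale E fX)
  have "nab X Y p c = nab ?S Y p c"
    by (rule nab_cong[OF W X S Y Y _ refl p], rule vector_field_expand)
       (use c vector_fieldsD(1)[OF X] in auto)
  also have "\<dots> = (\<Sum>i\<in>Basis. nab (\<lambda>p d. (X p c \<bullet> i) *\<^sub>R coord_field A c i p d) Y p c)"
    by (intro nab_sum(1)[OF W _ Y p] vector_fields_scale E fX)
  also have "\<dots> = (\<Sum>i\<in>Basis. (X p c \<bullet> i) *\<^sub>R (D i + (\<Sum>j\<in>Basis. (Y p c \<bullet> j) *\<^sub>R Chr c (coords c p) i j)))"
    by (simp add: nab_scale_left[OF W E Y fX p] 1)
  also have "\<dots> = (\<Sum>i\<in>Basis. D ((X p c \<bullet> i) *\<^sub>R i)) + Chr c (coords c p) (X p c) (Y p c)"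
    by (subst (2) bil_family_expand[OF Chr_bil_family[OF c(1)] q])
       (simp add: linear_scale[OF lin] scaleR_add_right sum.distrib scaleR_sum_right)
  also have "(\<Sum>i\<in>Basis. D ((X p c \<bullet> i) *\<^sub>R i)) = D (X p c)"
    by (simp add: linear_sum[OF lin, symmetric] euclidean_representation)
  finally show ?thesis by (simp add: D_def)
qed

text \<open>The bracket is a tangent vector, being a difference of covariant derivatives; thus it vanishes
  as soon as its components do in the chart where the fields are constant.\<close>

lemma coord_field_bracket:
  assumes c: "c \<in> A" "p \<in> dom_of c"
  shows "lie_bracket A (coord_field A c u) (coord_field A c v) p = (\<lambda>d. 0)"
proof (rule tangent_eqI[OF _ tangent_zero c])
  note vf = coord_field_vector_field[OF c(1)]
  have "(\<lambda>p d. nab (coord_field A c u) (coord_field A c v) p d - nab (coord_field A c v) (coord_field A c u) p d)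
     \<in> vector_fields A (dom_of c)"
    by (intro vector_fields_diff nab_vector_field chart(1) c vf)
  from vector_fieldsD(1)[OF this c(2)]
  show "lie_bracket A (coord_field A c u) (coord_field A c v) p \<in> tangent_space A p"
    by (simp add: nab_torsion_free[OF chart(1)[OF c(1)] vf vf c(2)])
  have "frechet_derivative (\<lambda>q. coord_field A c w (param c q) c) (at (coords c p)) = (\<lambda>h. 0)" for w
    using frechet_derivative_cong_open[OF chart(2)[OF c(1)], of "coords c p"
        "\<lambda>q. coord_field A c w (param c q) c" "\<lambda>q. w"] c
    by (simp add: coord_field_self param_in)
  then show "lie_bracket A (coord_field A c u) (coord_field A c v) p c = 0"
    by (simp add: lie_bracket_def)
qed

lemma g_linear_left:
  assumes "u \<in> tangent_space A p" "v \<in> tangent_space A p" "w \<in> tangent_space A p"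
  shows "g p (\<lambda>c. a *\<^sub>R u c + b *\<^sub>R v c) w = a * g p u w + b * g p v w"
  using metric assms unfolding riemannian_metric_def by blast

lemma g_sym: "u \<in> tangent_space A p \<Longrightarrow> v \<in> tangent_space A p \<Longrightarrow> g p u v = g p v u"
  using metric unfolding riemannian_metric_def by blast

lemma Gc_bil_family:
  assumes c: "c \<in> A"
  shows "bil_family (coords c ` dom_of c) (Gc c)"
  unfolding bil_family_def
proof (intro conjI ballI allI)
  fix q assume q: "q \<in> coords c ` dom_of c"
  note t = coord_field_tangent[OF c param_in[OF c q]]
  have 1: "Gc c q (a *\<^sub>R u + b *\<^sub>R v) w = a *\<^sub>R Gc c q u w + b *\<^sub>R Gc c q v w" for a b u v w
    unfolding Gc_def coord_field_linear[OF c param_in[OF c q]] by (simp add: g_linear_left[OF t t t])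
  have 2: "Gc c q u v = Gc c q v u" for u v
    unfolding Gc_def by (rule g_sym[OF t t])
  have "linear (\<lambda>u. Gc c q u v)" for v
    using 1[of 1 _ 1] 1[of _ _ 0] by (auto intro!: linearI)
  then show "bilinear (Gc c q)" using 2 by (simp add: bilinear_def)
next
  fix u v j
  have "Ck_fun A \<infinity> (dom_of c) (\<lambda>p. g p (coord_field A c u p) (coord_field A c v p))"
    using metric c unfolding riemannian_metric_def by blast
  then have "Ck_on \<infinity> (coords c ` dom_of c) (\<lambda>q. Gc c q u v)"
    using c unfolding Ck_fun_def by (fastforce simp: comp_def Gc_def)
  then show "Ck_open j (coords c ` dom_of c) (\<lambda>q. Gc c q u v)"
    by (rule Ck_on_open_imp_Ck_open[OF chart(2)[OF c]]) simp
qed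

lemma g_chart:
  assumes "c \<in> A" "p \<in> dom_of c" "u \<in> tangent_space A p" "v \<in> tangent_space A p"
  shows "g p u v = Gc c (coords c p) (u c) (v c)"
  unfolding Gc_def param_coords[OF assms(1,2)]
  by (simp add: tangent_eq_coord_field assms)

lemma chart_geometry:
  assumes c: "c \<in> A"
  shows "chart_geometry (coords c ` dom_of c) (Gc c) (Chr c)"
proof
  show "open (coords c ` dom_of c)" "bil_family (coords c ` dom_of c) (Gc c)"
    "bil_family (coords c ` dom_of c) (Chr c)"
    using chart(2) Gc_bil_family Chr_bil_family c by auto
  fix q assume q: "q \<in> coords c ` dom_of c"
  note p = param_in[OF c q]
  note t = coord_field_tangent[OF c p]
  note vf = coord_field_vector_field[OF c]
  show "Gc c q u v = Gc c q v u" for u v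
    unfolding Gc_def by (rule g_sym[OF t t])
  show "0 < Gc c q u u" if "u \<noteq> 0" for u
  proof -
    have "coord_field A c u (param c q) \<noteq> (\<lambda>c. 0)"
    proof
      assume "coord_field A c u (param c q) = (\<lambda>c. 0)"
      with coord_field_self[OF c p, of u] that show False by simp
    qed
    then show ?thesis using metric t unfolding riemannian_metric_def Gc_def by blast
  qed
  show "Chr c q u v = Chr c q v u" for u v
    unfolding Chr_def using nab_torsion_free[OF chart(1)[OF c] vf vf p, of u v c]
      coord_field_bracket[OF c p, of u v] by simp
  show "fam_deriv (Gc c) q w u v = Gc c q (Chr c q w u) v + Gc c q u (Chr c q w v)" for u v w
  proof -
    have "(\<lambda>q. Gc c q u v) differentiable (at q)"
      using Ck_open_Suc_derivative[OF bil_family_smooth[OF Gc_bil_family[OF c], of "Suc 0"] q]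
      by (rule differentiableI)
    then have "fam_deriv (Gc c) q w u v = differential A
        (\<lambda>p. g p (coord_field A c u p) (coord_field A c v p)) (param c q) (coord_field A c w (param c q))"
      using differential_chart[OF _ t c p, of "\<lambda>p. g p (coord_field A c u p) (coord_field A c v p)" w]
      by (simp add: comp_def fam_deriv_def coords_param[OF c q] coord_field_self[OF c p] flip: Gc_def)
    moreover have "nab (coord_field A c w) (coord_field A c u) (param c q)
        = coord_field A c (Chr c q w u) (param c q)" for u
      unfolding Chr_def
      by (rule tangent_eq_coord_field[OF vector_fieldsD(1)[OF nab_vector_field[OF chart(1)[OF c] vf vf] p] c p, symmetric])
    ultimately show ?thesis
      using nab_metric[OF chart(1)[OF c] vf vf vf p, of u v w] by (simp add: Gc_def)
  qed
qed

lemma curvature_chart: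
  assumes c: "c \<in> A" "p \<in> dom_of c"
  shows "curvature A nab p u v w c = chart_geometry.Rm (Chr c) (coords c p) (u c) (v c) (w c)"
proof -
  interpret chart_geometry "coords c ` dom_of c" "Gc c" "Chr c" by (rule chart_geometry[OF c(1)])
  note W = chart(1)[OF c(1)]
  note vf = coord_field_vector_field[OF c(1)]
  have 1: "nab (coord_field A c u) (nab (coord_field A c v) (coord_field A c w)) p c
     = fam_deriv (Chr c) (coords c p) u v w + Chr c (coords c p) u (Chr c (coords c p) v w)" for u v w
    using nab_chart[OF c(1) order_refl W c(2) vf nab_vector_field[OF W vf vf], of u v w]
    by (simp add: coord_field_self[OF c] fam_deriv_def Chr_def param_coords[OF c])
  have 2: "nab (lie_bracket A (coord_field A c u) (coord_field A c v)) (coord_field A c w) p c = 0" for u v w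
    by (rule nab_vanish(1)[OF W vf coord_field_bracket[OF c(1)] c(2)])
  show ?thesis
    using c by (simp add: curvature_def charts_at_def curvature_field_def 1 2 Rm_def)
qed

text \<open>The gradient is defined by a definite description, so existence and uniqueness have to be shown:
  the first by \<open>riesz\<close>, the second by nondegeneracy.\<close>

lemma grad_chart:
  assumes c: "c \<in> A" "p \<in> dom_of c" and f: "(f \<circ> param c has_derivative D) (at (coords c p))"
  shows "grad A g f p \<in> tangent_space A p"
    and "Gc c (coords c p) (grad A g f p c) w = D w"
proof -
  interpret chart_geometry "coords c ` dom_of c" "Gc c" "Chr c" by (rule chart_geometry[OF c(1)])
  have q: "coords c p \<in> coords c ` dom_of c" using c by blast
  have dif: "differential A f p v = D (v c)" if "v \<in> tangent_space A p" for v
    using differential_chart[OF differentiableI[OF f] that c] frechet_derivativeI[OF f] by simp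
  obtain w0 where w0: "\<And>v. Gc c (coords c p) w0 v = D v"
    using riesz[OF q, of D] f has_derivative_linear by blast
  let ?P = "\<lambda>w. w \<in> tangent_space A p \<and> (\<forall>v\<in>tangent_space A p. g p w v = differential A f p v)"
  have P: "Gc c (coords c p) (w c) v = D v" if "?P w" for w v
    using that g_chart[OF c _ coord_field_tangent[OF c], of w v] dif[OF coord_field_tangent[OF c], of v]
      coord_field_tangent[OF c, of v] by (simp add: coord_field_self[OF c])
  have "\<exists>!w. ?P w"
  proof (rule ex1I)
    show "?P (coord_field A c w0 p)"
      using coord_field_tangent[OF c] by (simp add: g_chart[OF c] coord_field_self[OF c] w0 dif)
    fix w assume w: "?P w"
    have "w c - w0 = 0"
      by (rule G_nondegenerate[OF q]) (simp add: G_simps[OF q] P[OF w] w0)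
    then show "w = coord_field A c w0 p"
      using w by (intro tangent_eqI[OF _ coord_field_tangent[OF c] c]) (auto simp: coord_field_self[OF c])
  qed
  from theI'[OF this] have "?P (grad A g f p)" unfolding grad_def .
  then show "grad A g f p \<in> tangent_space A p" "Gc c (coords c p) (grad A g f p c) w = D w"
    using P by blast+
qed

text \<open>The inhomogeneous transformation law of the Christoffel symbols: the tangent vector $\nabla_EE$, for
  the field \<open>E\<close> with constant components \<open>u\<close> in \<open>c\<close>, is computed in both charts.\<close>

lemma Chr_transform:
  assumes c: "c \<in> A" "p \<in> dom_of c" and d: "d \<in> A" "p \<in> dom_of d"
  shows "dtrans c d p (Chr c (coords c p) u u)
    = frechet_derivative (\<lambda>q. frechet_derivative (transition c d) (at q) u) (at (coords c p)) u
      + Chr d (coords d p) (dtrans c d p u) (dtrans c d p u)"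
proof -
  let ?W = "dom_of c \<inter> dom_of d" and ?E = "coord_field A c u"
  have W: "open ?W" using chart(1) c d by blast
  have p: "p \<in> ?W" using c d by blast
  have E: "?E \<in> vector_fields A ?W"
    by (rule vector_fields_subset[OF coord_field_vector_field[OF c(1)]]) auto
  note o = open_overlap[OF c(1) d(1)] and cp = coords_in_overlap[OF c d]
  let ?H = "\<lambda>q. coord_field A c u (param d q) d"
  have "(?H has_derivative frechet_derivative ?H (at (coords d p))) (at (coords d p))"
    by (rule vector_field_has_derivative[OF d W p E])
  then have "((\<lambda>q. ?H (transition c d q)) has_derivative
     (\<lambda>h. frechet_derivative ?H (at (coords d p)) (dtrans c d p h))) (at (coords c p))"
    by (intro has_derivative_compose[OF transition_has_derivative[OF c d]]) (simp only: transition_coords[OF c])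
  then have "((\<lambda>q. frechet_derivative (transition c d) (at q) u) has_derivative
     (\<lambda>h. frechet_derivative ?H (at (coords d p)) (dtrans c d p h))) (at (coords c p))"
    by (rule has_derivative_transform_within_open[OF _ o cp])
       (auto simp: transition_coords c param_coords d coord_field_apply dtrans_def)
  from frechet_derivativeI[OF this]
  have 1: "frechet_derivative (\<lambda>q. frechet_derivative (transition c d) (at q) u) (at (coords c p)) u
     = frechet_derivative ?H (at (coords d p)) (dtrans c d p u)" by simp
  have "nab ?E ?E p d = frechet_derivative ?H (at (coords d p)) (?E p d) + Chr d (coords d p) (?E p d) (?E p d)"
    by (rule nab_chart[OF d(1) _ W p E E]) auto
  moreover have "nab ?E ?E p d = dtrans c d p (nab ?E ?E p c)"
    by (rule tangentD[OF vector_fieldsD(1)[OF nab_vector_field[OF W E E] p] c d])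
  ultimately show ?thesis
    using 1 by (simp add: Chr_def coord_field_apply[OF c(1) d] param_coords[OF c])
qed

end


section \<open>Curves in coordinates\<close>

lemma vector_derivative_cong_open:
  assumes "open W" "t \<in> W" "t \<in> I" "I \<inter> W = I' \<inter> W" "\<And>s. s \<in> I \<inter> W \<Longrightarrow> f s = f' s"
  shows "vector_derivative f (at t within I) = vector_derivative f' (at t within I')"
proof -
  have "\<forall>\<^sub>F s in nhds t. s \<in> W" using assms(1,2) by (rule eventually_nhds_in_open)
  then have ev: "\<forall>\<^sub>F s in nhds t. s \<in> I \<longrightarrow> f s = f' s"
    by eventually_elim (use assms(5) in auto)
  have "at t within I = at t within I'"
    by (rule at_within_nhd[OF assms(2,1)]) (use assms(4) in auto)
  then show ?thesis
    unfolding vector_derivative_def using has_vector_derivative_cong_ev[OF ev] assms(2,3,5) by auto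
qed

context riemannian
begin

text \<open>The derivatives of a curve depend only on its germ in the parameter set.  This serves to compare
  derivatives taken in a cell with those taken in the whole interval, and a varied curve with the
  original one outside the support of the variation.\<close>

context
  fixes W I I' :: "real set" and x x' :: "real \<Rightarrow> 'm"
  assumes W: "open W" "I \<inter> W = I' \<inter> W" and eq: "\<And>t. t \<in> I \<inter> W \<Longrightarrow> x t = x' t"
begin

lemma velocity_local:
  assumes "t \<in> I" "t \<in> W"
  shows "velocity A I x t = velocity A I' x' t"
proof
  fix c :: "('m, 'e) chart"
  have "vector_derivative (coords c \<circ> x) (at t within I) = vector_derivative (coords c \<circ> x') (at t within I')"
    using assms W eq by (intro vector_derivative_cong_open[of W]) auto
  then show "velocity A I x t c = velocity A I' x' t c"
    using eq[of t] assms by (simp add: velocity_def)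
qed

lemma cov_deriv_local:
  assumes "\<And>t. t \<in> I \<inter> W \<Longrightarrow> Y t = Y' t" "t \<in> I" "t \<in> W"
  shows "cov_deriv A nab I x Y t = cov_deriv A nab I' x' Y' t"
proof
  fix c :: "('m, 'e) chart"
  have "vector_derivative (\<lambda>s. Y s c) (at t within I) = vector_derivative (\<lambda>s. Y' s c) (at t within I')"
    using assms W eq by (intro vector_derivative_cong_open[of W]) auto
  then show "cov_deriv A nab I x Y t c = cov_deriv A nab I' x' Y' t c"
    using eq[of t] assms by (simp add: cov_deriv_def velocity_local)
qed

lemma cov_power_local:
  assumes "t \<in> I" "t \<in> W"
  shows "cov_power A nab I x k t = cov_power A nab I' x' k t"
proof -
  have "((cov_deriv A nab I x) ^^ j) (velocity A I x) t = ((cov_deriv A nab I' x') ^^ j) (velocity A I' x') t"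
    if "t \<in> I \<inter> W" for j t
    using that by (induction j arbitrary: t) (auto intro: velocity_local cov_deriv_local)
  then show ?thesis using assms by (simp add: cov_power_def)
qed

end

lemma cov_power_1: "cov_power A nab I x 1 = velocity A I x"
  by (simp add: cov_power_def)

lemma cov_power_Suc:
  "k \<ge> 1 \<Longrightarrow> cov_power A nab I x (Suc k) = cov_deriv A nab I x (cov_power A nab I x k)"
  by (cases k) (simp_all add: cov_power_def)

lemma cov_power_off: "k \<ge> 1 \<Longrightarrow> c \<notin> charts_at A (x t) \<Longrightarrow> cov_power A nab I x k t c = 0"
proof (cases "k = 1")
  case False
  assume "k \<ge> 1" "c \<notin> charts_at A (x t)"
  with False show ?thesis
    using cov_power_Suc[of "k - 1" I x] by (simp add: cov_deriv_def)
qed (simp add: velocity_def cov_power_1[simplified])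

lemma Ck_map_continuous: "Ck_map A k I x \<Longrightarrow> continuous_on I x"
  by (simp add: Ck_map_def)

lemma Ck_map_coords: "Ck_map A k I x \<Longrightarrow> c \<in> A \<Longrightarrow> Ck_on k (I \<inter> x -` dom_of c) (\<lambda>t. coords c (x t))"
  by (simp add: Ck_map_def comp_def)

lemma at_within_preimage:
  assumes "continuous_on I x" "c \<in> A" "t \<in> I \<inter> x -` dom_of c"
  shows "at t within (I \<inter> x -` dom_of c) = at t within I"
proof -
  obtain B where "open B" "B \<inter> I = x -` dom_of c \<inter> I"
    using assms(1) chart(1)[OF assms(2)] unfolding continuous_on_open_invariant by blast
  then show ?thesis
    using assms(3) by (intro at_within_nhd[of t B]) blast+
qed

text \<open>The components of the iterated covariant derivatives in a chart, with the formula
  $D_tY = Y' + \Gamma(x', Y)$.\<close>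

context
  fixes I :: "real set" and x :: "real \<Rightarrow> 'm" and c :: "('m, 'e) chart"
  assumes x: "Ck_map A \<infinity> I x" and c: "c \<in> A" and I: "\<And>t. t \<in> I \<Longrightarrow> at t within I \<noteq> bot"
begin

lemma velocity_chart:
  shows "t \<in> I \<inter> x -` dom_of c \<Longrightarrow>
      ((\<lambda>t. coords c (x t)) has_vector_derivative velocity A I x t c) (at t within (I \<inter> x -` dom_of c))"
    and "Ck_on \<infinity> (I \<inter> x -` dom_of c) (\<lambda>t. velocity A I x t c)"
proof -
  let ?S = "I \<inter> x -` dom_of c" and ?y = "\<lambda>t. coords c (x t)"
  have y: "Ck_on (eSuc \<infinity>) ?S ?y" using Ck_map_coords[OF x c] by simp
  have at: "at t within ?S = at t within I" if "t \<in> ?S" for t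
    by (rule at_within_preimage[OF Ck_map_continuous[OF x] c that])
  then have lim: "at t within ?S \<noteq> bot" if "t \<in> ?S" for t using I that by auto
  have v: "velocity A I x t c = vector_derivative ?y (at t within ?S)" if "t \<in> ?S" for t
    unfolding at[OF that] using that c by (simp add: velocity_def charts_at_def comp_def)
  show "(?y has_vector_derivative velocity A I x t c) (at t within ?S)" if "t \<in> ?S"
    using Ck_on_vector_derivative(1)[OF y lim that] v[OF that] by simp
  show "Ck_on \<infinity> ?S (\<lambda>t. velocity A I x t c)"
    using Ck_on_vector_derivative(2)[OF y lim] v by (subst Ck_on_cong) auto
qed

lemma cov_deriv_chart:
  assumes Y: "Ck_on \<infinity> (I \<inter> x -` dom_of c) (\<lambda>t. Y t c)"
  shows "t \<in> I \<inter> x -` dom_of c \<Longrightarrow> ((\<lambda>t. Y t c) has_vector_derivative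
      cov_deriv A nab I x Y t c - Chr c (coords c (x t)) (velocity A I x t c) (Y t c))
      (at t within (I \<inter> x -` dom_of c))"
    and "Ck_on \<infinity> (I \<inter> x -` dom_of c) (\<lambda>t. cov_deriv A nab I x Y t c)"
proof -
  let ?S = "I \<inter> x -` dom_of c"
  have at: "at t within ?S = at t within I" if "t \<in> ?S" for t
    by (rule at_within_preimage[OF Ck_map_continuous[OF x] c that])
  then have lim: "at t within ?S \<noteq> bot" if "t \<in> ?S" for t using I that by auto
  have Y': "Ck_on (eSuc \<infinity>) ?S (\<lambda>t. Y t c)" using Y by simp
  have D: "cov_deriv A nab I x Y t c = vector_derivative (\<lambda>t. Y t c) (at t within ?S)
     + Chr c (coords c (x t)) (velocity A I x t c) (Y t c)" if "t \<in> ?S" for t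
    unfolding at[OF that] using that c by (simp add: cov_deriv_def charts_at_def Chr_def param_coords)
  show "((\<lambda>t. Y t c) has_vector_derivative
      cov_deriv A nab I x Y t c - Chr c (coords c (x t)) (velocity A I x t c) (Y t c)) (at t within ?S)"
    if "t \<in> ?S"
    using Ck_on_vector_derivative(1)[OF Y' lim that] by (simp add: D[OF that])
  have "Ck_on \<infinity> ?S (\<lambda>t. vector_derivative (\<lambda>t. Y t c) (at t within ?S)
     + Chr c (coords c (x t)) (velocity A I x t c) (Y t c))"
    by (intro Ck_on_add Ck_on_vector_derivative(2)[OF Y' lim] velocity_chart(2) Y
        bil_family_Ck_on[OF chart(2)[OF c] Chr_bil_family[OF c]] Ck_map_coords[OF x c]) auto
  then show "Ck_on \<infinity> ?S (\<lambda>t. cov_deriv A nab I x Y t c)"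
    using D by (subst Ck_on_cong) auto
qed

lemma cov_power_Ck_on:
  assumes "k \<ge> 1"
  shows "Ck_on \<infinity> (I \<inter> x -` dom_of c) (\<lambda>t. cov_power A nab I x k t c)"
  using assms
proof (induction k rule: dec_induct)
  case base
  then show ?case using velocity_chart(2) by (simp add: cov_power_1[simplified])
next
  case (step k)
  then show ?case using cov_deriv_chart(2)[where Y="cov_power A nab I x k", OF step.IH] by (simp add: cov_power_Suc)
qed

lemma cov_power_has_derivative:
  assumes "k \<ge> 1" "t \<in> I \<inter> x -` dom_of c"
  shows "((\<lambda>t. cov_power A nab I x k t c) has_vector_derivative
      cov_power A nab I x (Suc k) t c
      - Chr c (coords c (x t)) (cov_power A nab I x 1 t c) (cov_power A nab I x k t c))
      (at t within (I \<inter> x -` dom_of c))"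
  using cov_deriv_chart(1)[where Y="cov_power A nab I x k", OF cov_power_Ck_on[OF assms(1)] assms(2)] assms(1)
  by (simp add: cov_power_Suc cov_power_1[simplified])

end


section \<open>The integrand of the action\<close>

definition integrand :: "real \<Rightarrow> ('m \<Rightarrow> real) \<Rightarrow> real set \<Rightarrow> (real \<Rightarrow> 'm) \<Rightarrow> real \<Rightarrow> real" where
  "integrand \<sigma> V I x t = 1/2 *
     ((tnorm g (x t) (cov_power A nab I x 2 t))\<^sup>2
      + \<sigma> * (tnorm g (x t) (cov_power A nab I x 1 t))\<^sup>2
      + V (x t))"

lemma tnorm_coord_field:
  assumes c: "c \<in> A" "p \<in> dom_of c"
  shows "(tnorm g p (coord_field A c u p))\<^sup>2 = Gc c (coords c p) u u"
proof -
  interpret chart_geometry "coords c ` dom_of c" "Gc c" "Chr c" by (rule chart_geometry[OF c(1)])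
  have q: "coords c p \<in> coords c ` dom_of c" using c by blast
  have "0 \<le> Gc c (coords c p) u u" using G_pos[OF q, of u] G_simps(9)[OF q, of 0] by (cases "u = 0") auto
  then show ?thesis
    by (simp add: tnorm_def g_chart[OF c coord_field_tangent[OF c] coord_field_tangent[OF c]] coord_field_self[OF c])
qed

text \<open>The Christoffel terms make the second derivative of a curve a tangent vector, so that the
  integrand can be evaluated in any one chart.\<close>

lemma integrand_chart:
  assumes c: "c \<in> A" and W: "open W" "t \<in> W" "W \<subseteq> I" and xW: "\<And>s. s \<in> W \<Longrightarrow> x s \<in> dom_of c"
    and z1: "\<And>s. s \<in> W \<Longrightarrow> ((\<lambda>s. coords c (x s)) has_vector_derivative z1 s) (at s)"
    and z2: "(z1 has_vector_derivative z2) (at t)"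
  shows "integrand \<sigma> V I x t = chart_geometry.lag (Gc c) (Chr c) \<sigma> (\<lambda>q. V (param c q)) (coords c (x t)) (z1 t) z2"
proof -
  interpret chart_geometry "coords c ` dom_of c" "Gc c" "Chr c" by (rule chart_geometry[OF c])
  let ?z = "\<lambda>s. coords c (x s)"
  have at: "at s within I = at s" if "s \<in> W" for s
    using that W by (meson at_within_interior interior_maximal subsetD)
  have 12: "velocity A I x t d = dtrans c d (x t) (z1 t)"
     "cov_power A nab I x 2 t d = dtrans c d (x t) (z2 + Chr c (?z t) (z1 t) (z1 t))"
    if d: "d \<in> A" "x t \<in> dom_of d" for d
  proof -
    let ?O = "coords c ` (dom_of c \<inter> dom_of d)"
    let ?W = "W \<inter> ?z -` ?O"
    note o = open_overlap[OF c d(1)]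
    have xt: "x t \<in> dom_of c" using xW W by blast
    have "continuous_on W ?z"
      by (rule continuous_on_vector_derivative[OF has_vector_derivative_at_within[OF z1]])
    then have W': "open ?W" using continuous_open_preimage[OF _ W(1) o] by blast
    have tW': "t \<in> ?W" using W xt d by auto
    have xd: "x s \<in> dom_of c" "x s \<in> dom_of d" if "s \<in> ?W" for s
    proof -
      show "x s \<in> dom_of c" using that xW by blast
      from that obtain p where p: "p \<in> dom_of c" "p \<in> dom_of d" "?z s = coords c p" by auto
      have "p = x s"
        using param_coords[OF c p(1)] param_coords[OF c \<open>x s \<in> dom_of c\<close>] p(3) by simp
      with p show "x s \<in> dom_of d" by simp
    qed
    have teq: "transition c d (?z s) = (coords d \<circ> x) s" if "s \<in> ?W" for s
      unfolding comp_apply by (rule transition_coords[OF c xd(1)[OF that]])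
    have \<tau>: "Ck_open j ?O (transition c d)" for j
      by (rule Ck_on_open_imp_Ck_open[OF o transition_smooth[OF c d(1)]]) simp
    have v: "velocity A I x s d = frechet_derivative (transition c d) (at (?z s)) (z1 s)" if s: "s \<in> ?W" for s
    proof -
      have sO: "?z s \<in> ?O" using s by blast
      note f' = Ck_open_Suc_derivative[OF \<tau>[of "Suc 0"] sO]
      have "linear (frechet_derivative (transition c d) (at (?z s)))" using f' has_derivative_linear by blast
      then have "((\<lambda>s. transition c d (?z s)) has_vector_derivative
         frechet_derivative (transition c d) (at (?z s)) (z1 s)) (at s)"
        using has_derivative_compose[OF z1[unfolded has_vector_derivative_def] f'] s
        by (simp add: has_vector_derivative_def linear_scale)
      then have "(coords d \<circ> x has_vector_derivative
         frechet_derivative (transition c d) (at (?z s)) (z1 s)) (at s)"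
        by (rule has_vector_derivative_transform_within_open[OF _ W' s teq])
      then show ?thesis
        using xd[OF s] d(1) s at[of s] by (simp add: velocity_def charts_at_def vector_derivative_at)
    qed
    show 1: "velocity A I x t d = dtrans c d (x t) (z1 t)"
      using v[OF tW'] by (simp add: dtrans_def)
    have "((\<lambda>s. frechet_derivative (transition c d) (at (?z s)) (z1 s)) has_vector_derivative
       frechet_derivative (\<lambda>q. frechet_derivative (transition c d) (at q) (z1 t)) (at (?z t)) (z1 t)
       + dtrans c d (x t) z2) (at t)"
      unfolding dtrans_def
      by (rule frechet_derivative_along_curve[OF o _ \<tau> z1 z2]) (use tW' W in auto)
    then have "((\<lambda>s. velocity A I x s d) has_vector_derivative
       frechet_derivative (\<lambda>q. frechet_derivative (transition c d) (at q) (z1 t)) (at (?z t)) (z1 t)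
       + dtrans c d (x t) z2) (at t)"
      by (rule has_vector_derivative_transform_within_open[OF _ W' tW']) (use v in auto)
    from vector_derivative_at[OF this]
    have "cov_deriv A nab I x (velocity A I x) t d = dtrans c d (x t) z2 + dtrans c d (x t) (Chr c (?z t) (z1 t) (z1 t))"
      using Chr_transform[OF c xt d, of "z1 t"] d W(2)
      by (simp add: cov_deriv_def charts_at_def at Chr_def[of d] param_coords 1)
    then show "cov_power A nab I x 2 t d = dtrans c d (x t) (z2 + Chr c (?z t) (z1 t) (z1 t))"
      using cov_power_Suc[of 1 I x] linear_add[OF dtrans_linear[OF c xt d]]
      by (simp add: cov_power_1[simplified] numeral_2_eq_2)
  qed
  have xt: "x t \<in> dom_of c" using xW W by blast
  have "velocity A I x t = coord_field A c (z1 t) (x t)"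
  proof
    fix d show "velocity A I x t d = coord_field A c (z1 t) (x t) d"
      using 12(1)[of d] c by (cases "d \<in> charts_at A (x t)")
        (auto simp: coord_field_apply charts_at_def velocity_def coord_field_def[of A c] dtrans_def)
  qed
  moreover have "cov_power A nab I x 2 t = coord_field A c (z2 + Chr c (?z t) (z1 t) (z1 t)) (x t)"
  proof
    fix d show "cov_power A nab I x 2 t d = coord_field A c (z2 + Chr c (?z t) (z1 t) (z1 t)) (x t) d"
      using 12(2)[of d] c cov_power_off[of 2 d x t I] by (cases "d \<in> charts_at A (x t)")
        (auto simp: coord_field_apply charts_at_def coord_field_def[of A c] dtrans_def)
  qed
  ultimately show ?thesis
    by (simp add: integrand_def lag_def cov_power_1[simplified] tnorm_coord_field[OF c xt] param_coords[OF c xt])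
qed

end


section \<open>Variations supported in a chart\<close>

lemma (in smooth_atlas) Ck_map_compose:
  assumes f: "Ck_map A k S f" and h: "Ck_on k S' h" "h ` S' \<subseteq> S"
  shows "Ck_map A k S' (\<lambda>p. f (h p))"
  unfolding Ck_map_def
proof (intro conjI ballI)
  show "continuous_on S' (\<lambda>p. f (h p))"
    using f h by (intro continuous_on_compose2[OF _ Ck_on_continuous_on[OF h(1)]]) (auto simp: Ck_map_def)
  fix c assume "c \<in> A"
  then have *: "Ck_on k (S \<inter> f -` dom_of c) (coords c \<circ> f)" using f by (simp add: Ck_map_def)
  have "Ck_on k (S' \<inter> (\<lambda>p. f (h p)) -` dom_of c) (\<lambda>p. (coords c \<circ> f) (h p))"
    by (rule Ck_on_compose[OF Ck_on_subset[OF h(1)] *]) (use h(2) in auto)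
  then show "Ck_on k (S' \<inter> (\<lambda>p. f (h p)) -` dom_of c) (coords c \<circ> (\<lambda>p. f (h p)))"
    by (simp add: comp_def)
qed

text \<open>The curve moved by \<open>r\<phi>\<close> in the coordinates of \<open>c\<close>; \<open>\<phi>\<close> will be supported inside \<open>{a..b}\<close>.\<close>

definition vary :: "('m, 'e::euclidean_space) chart \<Rightarrow> real \<Rightarrow> real \<Rightarrow> (real \<Rightarrow> 'e) \<Rightarrow> (real \<Rightarrow> 'm) \<Rightarrow>
    real \<Rightarrow> real \<Rightarrow> 'm" where
  "vary c a b \<phi> x r t = (if t \<in> {a..b} then param c (coords c (x t) + r *\<^sub>R \<phi> t) else x t)"

context smooth_atlas
begin

context
  fixes c :: "('m, 'e) chart" and x :: "real \<Rightarrow> 'm" and \<phi> :: "real \<Rightarrow> 'e" and a a' b b' e :: real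
  assumes c: "c \<in> A" and ab: "a < a'" "b' < b" and e: "e > 0"
    and \<phi>: "\<And>j. Ck_open j UNIV \<phi>" "\<And>t. t \<notin> {a'..b'} \<Longrightarrow> \<phi> t = 0"
    and x: "\<And>t. t \<in> {a..b} \<Longrightarrow> x t \<in> dom_of c"
    and inU: "\<And>r t. \<bar>r\<bar> < e \<Longrightarrow> t \<in> {a..b} \<Longrightarrow> coords c (x t) + r *\<^sub>R \<phi> t \<in> coords c ` dom_of c"
begin

lemma vary_off: "t \<notin> {a'..b'} \<Longrightarrow> vary c a b \<phi> x r t = x t"
  using x by (simp add: vary_def \<phi>(2) param_coords[OF c])

lemma vary_0: "vary c a b \<phi> x 0 t = x t"
  using x by (simp add: vary_def param_coords[OF c])

lemma vary_on:
  assumes "\<bar>r\<bar> < e" "t \<in> {a..b}"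
  shows "vary c a b \<phi> x r t \<in> dom_of c"
    and "coords c (vary c a b \<phi> x r t) = coords c (x t) + r *\<^sub>R \<phi> t"
  using assms param_in[OF c inU] coords_param[OF c inU] by (auto simp: vary_def)

text \<open>The parameter domain is covered by two open strips: on one of them the coordinate formula holds, on
  the other the variation does not depend on \<open>r\<close>.\<close>

lemma vary_Ck_map:
  assumes J: "Ck_map A k J x"
  shows "Ck_map A k ({-e<..<e} \<times> J) (\<lambda>(r, t). vary c a b \<phi> x r t)"
proof -
  let ?S = "{-e<..<e} \<times> J" and ?F = "\<lambda>(r, t). vary c a b \<phi> x r t"
  let ?h = "\<lambda>p. coords c (x (snd p)) + fst p *\<^sub>R \<phi> (snd p)"
  let ?O1 = "UNIV \<times> {a<..<b} :: (real \<times> real) set" and ?O2 = "UNIV \<times> (- {a'..b'}) :: (real \<times> real) set"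
  have O: "open ?O1" "open ?O2" by (auto intro: open_Times open_Compl)
  have cover: "p \<in> ?O1 \<or> p \<in> ?O2" for p using ab by (cases p) auto
  have lin: "Ck_on k X (\<lambda>p. fst p)" "Ck_on k X (\<lambda>p. snd p)" for X :: "(real \<times> real) set"
  proof -
    have id: "Ck_on k UNIV (\<lambda>p. p :: real \<times> real)" by (auto intro: Ck_onI_open Ck_open_ident)
    show "Ck_on k X (\<lambda>p. fst p)" "Ck_on k X (\<lambda>p. snd p)"
      by (auto intro: Ck_on_subset Ck_on_compose_linear[OF id] bounded_linear_fst bounded_linear_snd)
  qed
  have J1: "J \<inter> {a<..<b} \<subseteq> J \<inter> x -` dom_of c" using x by auto
  have y: "Ck_on k (J \<inter> {a<..<b}) (\<lambda>t. coords c (x t))"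
    using J c by (intro Ck_on_subset[OF _ J1]) (simp add: Ck_map_def comp_def)
  have "Ck_on k UNIV \<phi>" by (intro Ck_onI_open \<phi>(1)) auto
  then have h: "Ck_on k (?S \<inter> ?O1) ?h"
    by (intro Ck_on_add Ck_on_bounded_bilinear[OF bounded_bilinear_scaleR] lin
        Ck_on_compose[OF lin(2) y] Ck_on_compose[where f=\<phi> and S'=UNIV, OF lin(2)]) auto
  have hU: "?h p \<in> coords c ` dom_of c" "?F p = param c (?h p)" if "p \<in> ?S \<inter> ?O1" for p
    using that inU by (auto simp: vary_def)
  have Fx: "?F p = x (snd p)" if "p \<in> ?S \<inter> ?O2" for p
    using that vary_off by auto
  have cx: "continuous_on J x" using J by (simp add: Ck_map_def)
  show ?thesis
    unfolding Ck_map_def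
  proof (intro conjI ballI)
    show "continuous_on ?S ?F"
    proof (rule continuous_on_local)
      fix p assume "p \<in> ?S"
      have "continuous_on (?S \<inter> ?O1) ?F"
      proof (rule continuous_on_eq)
        show "continuous_on (?S \<inter> ?O1) (\<lambda>p. param c (?h p))"
          by (rule continuous_on_compose2[OF continuous_param[OF c] Ck_on_continuous_on[OF h]])
             (use hU(1) in blast)
      qed (use hU(2) in simp)
      moreover have "continuous_on (?S \<inter> ?O2) ?F"
      proof (rule continuous_on_eq)
        show "continuous_on (?S \<inter> ?O2) (\<lambda>p. x (snd p))"
          by (rule continuous_on_compose2[OF cx continuous_on_snd[OF continuous_on_id]]) auto
      qed (use Fx in simp)
      ultimately show "\<exists>W. open W \<and> p \<in> W \<and> continuous_on (?S \<inter> W) ?F"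
        using cover[of p] O by blast
    qed
    fix d assume d: "d \<in> A"
    let ?Sd = "?S \<inter> ?F -` dom_of d"
    show "Ck_on k ?Sd (coords d \<circ> ?F)"
    proof (rule Ck_on_local)
      fix p assume "p \<in> ?Sd"
      have "Ck_on k (?Sd \<inter> ?O1) (\<lambda>p. transition c d (?h p))"
      proof (rule Ck_on_compose[OF Ck_on_subset[OF h] Ck_on_mono[OF transition_smooth[OF c d]]])
        show "?h ` (?Sd \<inter> ?O1) \<subseteq> coords c ` (dom_of c \<inter> dom_of d)"
        proof
          fix q assume "q \<in> ?h ` (?Sd \<inter> ?O1)"
          then obtain p where p: "p \<in> ?S \<inter> ?O1" "?F p \<in> dom_of d" "q = ?h p" by blast
          then have "q = coords c (param c q)" "param c q \<in> dom_of c" "param c q \<in> dom_of d"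
            using hU[OF p(1)] coords_param[OF c] param_in[OF c] by auto
          then show "q \<in> coords c ` (dom_of c \<inter> dom_of d)" by blast
        qed
      qed auto
      then have "Ck_on k (?Sd \<inter> ?O1) (coords d \<circ> ?F)"
        by (rule Ck_on_cong[THEN iffD1, rotated]) (use hU(2) in \<open>auto simp: transition_def\<close>)
      moreover have "Ck_on k (?Sd \<inter> ?O2) (coords d \<circ> ?F)"
      proof (rule Ck_on_cong[THEN iffD1])
        have "Ck_on k (J \<inter> x -` dom_of d) (\<lambda>t. coords d (x t))" using J d by (simp add: Ck_map_def comp_def)
        then show "Ck_on k (?Sd \<inter> ?O2) (\<lambda>p. coords d (x (snd p)))"
          by (rule Ck_on_compose[OF lin(2)]) (use Fx in fastforce)
        show "coords d (x (snd p)) = (coords d \<circ> ?F) p" if "p \<in> ?Sd \<inter> ?O2" for p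
          using that Fx[of p] by auto
      qed
      ultimately show "\<exists>W. open W \<and> p \<in> W \<and> Ck_on k (?Sd \<inter> W) (coords d \<circ> ?F)"
        using cover[of p] O by blast
    qed
  qed
qed

lemma vary_Ck_map_slice:
  assumes J: "Ck_map A k J x" and r: "\<bar>r\<bar> < e"
  shows "Ck_map A k J (vary c a b \<phi> x r)"
proof -
  have "Ck_on k J (\<lambda>t. (r, 0) + (0, t))"
    by (intro Ck_on_add Ck_on_const Ck_on_subset[OF Ck_on_compose_linear[OF Ck_onI_open[OF open_UNIV Ck_open_ident]]])
       (auto intro: bounded_linear_Pair bounded_linear_zero bounded_linear_ident)
  then have "Ck_on k J (\<lambda>t. (r, t))" by simp
  moreover have "(\<lambda>t. (r, t)) ` J \<subseteq> {-e<..<e} \<times> J" using r by auto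
  ultimately show ?thesis using Ck_map_compose[OF vary_Ck_map[OF J]] by fastforce
qed

end

end


section \<open>The interpolation problem\<close>

locale spline_problem = riemannian A g nab
  for A :: "('m::topological_space, 'e::euclidean_space) chart set" and g and nab +
  fixes \<sigma> :: real and V :: "'m \<Rightarrow> real" and N :: nat and T :: "nat \<Rightarrow> real"
    and pt :: "nat \<Rightarrow> 'm" and v0 vN :: "('m, 'e) tvec"
  assumes V: "Ck_fun A 2 UNIV V" and N: "N \<ge> 1" and T0: "T 0 = 0"
    and T_step: "\<And>i. i \<in> {1..N} \<Longrightarrow> T (i - 1) < T i"
begin

abbreviation cell :: "nat \<Rightarrow> real set" where "cell i \<equiv> {T (i - 1)..T i}"

abbreviation F :: "(real \<Rightarrow> 'm) \<Rightarrow> real \<Rightarrow> real" where "F \<equiv> integrand \<sigma> V {0..T N}"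

definition dV :: "('m, 'e) chart \<Rightarrow> 'e \<Rightarrow> 'e \<Rightarrow> real" where
  "dV c q = frechet_derivative (\<lambda>q. V (param c q)) (at q)"

lemma T_less: "i < j \<Longrightarrow> j \<le> N \<Longrightarrow> T i < T j"
proof (induction j)
  case (Suc j)
  then show ?case using T_step[of "Suc j"] by (cases "i = j") auto
qed simp

lemma T_le: "i \<le> j \<Longrightarrow> j \<le> N \<Longrightarrow> T i \<le> T j"
  using T_less[of i j] by (cases "i = j") auto

lemma cell_subset: "i \<in> {1..N} \<Longrightarrow> cell i \<subseteq> {0..T N}"
  using T_le[of 0 "i - 1"] T_le[of i N] T0 by auto

lemma knot_left:
  assumes "0 < t" "t \<le> T N"
  obtains i where "i \<in> {1..N}" "T (i - 1) < t" "t \<le> T i"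
proof -
  define i where "i = (LEAST i. t \<le> T i)"
  have 1: "t \<le> T i" unfolding i_def by (rule LeastI) (rule assms(2))
  have 2: "i \<le> N" unfolding i_def by (rule Least_le) (rule assms(2))
  have "i \<noteq> 0" using 1 assms T0 by (metis not_less)
  moreover have "T (i - 1) < t"
    using not_less_Least[of "i - 1" "\<lambda>i. t \<le> T i"] \<open>i \<noteq> 0\<close> unfolding i_def[symmetric] by simp
  ultimately show thesis using 1 2 by (intro that[of i]) auto
qed

lemma knot_right:
  assumes "0 \<le> t" "t < T N"
  obtains i where "i \<in> {1..N}" "T (i - 1) \<le> t" "t < T i"
proof -
  define i where "i = (LEAST i. t < T i)"
  have 1: "t < T i" unfolding i_def by (rule LeastI) (rule assms(2))
  have 2: "i \<le> N" unfolding i_def by (rule Least_le) (rule assms(2))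
  have "i \<noteq> 0" using 1 assms T0 by (metis not_less)
  moreover have "T (i - 1) \<le> t"
    using not_less_Least[of "i - 1" "\<lambda>i. t < T i"] \<open>i \<noteq> 0\<close> unfolding i_def[symmetric] by simp
  ultimately show thesis using 1 2 by (intro that[of i]) auto
qed

lemma at_within_cell: "i \<in> {1..N} \<Longrightarrow> t \<in> cell i \<Longrightarrow> at t within cell i \<noteq> bot"
  using T_step[of i] by (simp add: trivial_limit_within islimpt_Icc)

lemma V_chart:
  assumes "c \<in> A" "q \<in> coords c ` dom_of c"
  shows "((\<lambda>q. V (param c q)) has_derivative dV c q) (at q)"
    and "continuous_on (coords c ` dom_of c) (\<lambda>q. dV c q w)"
    and "continuous_on (coords c ` dom_of c) (\<lambda>q. V (param c q))"
proof -
  have "Ck_on 2 (coords c ` dom_of c) (\<lambda>q. V (param c q))"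
    using V assms(1) by (auto simp: Ck_fun_def comp_def)
  then have 2: "Ck_open (Suc 1) (coords c ` dom_of c) (\<lambda>q. V (param c q))"
    by (rule Ck_on_open_imp_Ck_open[OF chart(2)[OF assms(1)]]) (simp add: numeral_eq_enat)
  show "((\<lambda>q. V (param c q)) has_derivative dV c q) (at q)"
    unfolding dV_def by (rule Ck_open_Suc_derivative[OF 2 assms(2)])
  show "continuous_on (coords c ` dom_of c) (\<lambda>q. dV c q w)"
    unfolding dV_def by (rule Ck_open_continuous_on[OF Ck_open_frechet[OF 2]])
  show "continuous_on (coords c ` dom_of c) (\<lambda>q. V (param c q))"
    by (rule Ck_open_continuous_on[OF 2])
qed

context
  fixes x :: "real \<Rightarrow> 'm" and i :: nat and c :: "('m, 'e) chart" and a b :: real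
  assumes i: "i \<in> {1..N}" and x: "Ck_map A \<infinity> (cell i) x" and c: "c \<in> A"
    and ab: "a < b" "{a..b} \<subseteq> cell i" and xc: "\<And>t. t \<in> {a..b} \<Longrightarrow> x t \<in> dom_of c"
begin

text \<open>The derivatives are taken within the cell, hence are one-sided at its ends, as is required for
  arcs that end at a knot.  The ordinary second derivative of the coordinates is \<open>acc\<close>.\<close>

abbreviation crd where "crd t \<equiv> coords c (x t)"
abbreviation cpow where "cpow k t \<equiv> cov_power A nab (cell i) x k t c"
abbreviation acc where "acc t \<equiv> cpow 2 t - Chr c (crd t) (cpow 1 t) (cpow 1 t)"

lemma arc_in_chart: "{a..b} \<subseteq> cell i \<inter> x -` dom_of c"
  using ab(2) xc by auto

lemma crd_derivative:
  "t \<in> {a..b} \<Longrightarrow> (crd has_vector_derivative cpow 1 t) (at t within {a..b})"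
  using has_vector_derivative_within_subset[OF velocity_chart(1)[OF x c at_within_cell[OF i]] arc_in_chart] arc_in_chart
  by (auto simp: cov_power_1[simplified])

lemma cpow_derivative:
  assumes "k \<ge> 1" "t \<in> {a..b}"
  shows "(cpow k has_vector_derivative cpow (Suc k) t - Chr c (crd t) (cpow 1 t) (cpow k t)) (at t within {a..b})"
  using has_vector_derivative_within_subset[OF cov_power_has_derivative[OF x c at_within_cell[OF i] assms(1)] arc_in_chart]
    arc_in_chart assms(2) by blast

lemma cpow1_derivative:
  "t \<in> {a..b} \<Longrightarrow> (cpow 1 has_vector_derivative acc t) (at t within {a..b})"
  using cpow_derivative[of 1 t] by (simp add: numeral_2_eq_2)

lemma cpow_continuous_on: "k \<ge> 1 \<Longrightarrow> continuous_on {a..b} (cpow k)"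
  by (rule continuous_on_vector_derivative[OF cpow_derivative])

lemma crd_continuous_on: "continuous_on {a..b} crd"
  by (rule continuous_on_vector_derivative[OF crd_derivative])

lemma crd_in: "crd ` {a..b} \<subseteq> coords c ` dom_of c"
  using xc by auto

lemma acc_continuous_on: "continuous_on {a..b} acc"
  by (intro continuous_intros cpow_continuous_on bil_family_continuous_on[OF Chr_bil_family[OF c]]
      crd_continuous_on crd_in) auto

text \<open>The integrand is defined by derivatives within the whole interval.  In the interior of an arc
  these are the derivatives within the cell; the two end points are negligible for the integral.\<close>

lemma F_chart:
  assumes u: "\<And>t. t \<in> {a..b} \<Longrightarrow> u t \<in> dom_of c \<and> coords c (u t) = crd t + r *\<^sub>R \<phi> t"
    and \<phi>: "\<And>t. (\<phi> has_vector_derivative \<phi>1 t) (at t)" "\<And>t. (\<phi>1 has_vector_derivative \<phi>2 t) (at t)"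
    and t: "t \<in> {a<..<b}"
  shows "F u t = chart_geometry.lag (Gc c) (Chr c) \<sigma> (\<lambda>q. V (param c q))
     (crd t + r *\<^sub>R \<phi> t) (cpow 1 t + r *\<^sub>R \<phi>1 t) (acc t + r *\<^sub>R \<phi>2 t)"
proof -
  have at: "at s within {a..b} = at s" if "s \<in> {a<..<b}" for s
    using that at_within_Icc_at[of a s b] by simp
  have "F u t = chart_geometry.lag (Gc c) (Chr c) \<sigma> (\<lambda>q. V (param c q)) (coords c (u t))
     (cpow 1 t + r *\<^sub>R \<phi>1 t) (acc t + r *\<^sub>R \<phi>2 t)"
  proof (rule integrand_chart[OF c, where W="{a<..<b}" and ?z1.0="\<lambda>s. cpow 1 s + r *\<^sub>R \<phi>1 s"])
    show "{a<..<b} \<subseteq> {0..T N}" using ab(2) cell_subset[OF i] by fastforce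
    show "u s \<in> dom_of c" if "s \<in> {a<..<b}" for s using u that by simp
    show "((\<lambda>s. coords c (u s)) has_vector_derivative cpow 1 s + r *\<^sub>R \<phi>1 s) (at s)" if s: "s \<in> {a<..<b}" for s
    proof (rule has_vector_derivative_transform_within_open[OF _ open_greaterThanLessThan s])
      show "((\<lambda>s. crd s + r *\<^sub>R \<phi> s) has_vector_derivative cpow 1 s + r *\<^sub>R \<phi>1 s) (at s)"
        using crd_derivative[of s] s unfolding at[OF s]
        by (auto intro!: derivative_eq_intros \<phi>(1))
    qed (use u in simp)
    show "((\<lambda>s. cpow 1 s + r *\<^sub>R \<phi>1 s) has_vector_derivative acc t + r *\<^sub>R \<phi>2 t) (at t)"
      using cpow1_derivative[of t] t unfolding at[OF t]
      by (auto intro!: derivative_eq_intros \<phi>(2))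
  qed (use t in auto)
  then show ?thesis using u t by simp
qed

lemma F_integrable: "F x integrable_on {a..b}"
proof -
  interpret chart_geometry "coords c ` dom_of c" "Gc c" "Chr c" by (rule chart_geometry[OF c])
  have "continuous_on {a..b} (\<lambda>t. lag \<sigma> (\<lambda>q. V (param c q)) (crd t) (cpow 1 t) (acc t))"
    using xc[of a] ab(1) by (intro lag_continuous_on V_chart(3)[OF c] crd_continuous_on cpow_continuous_on acc_continuous_on crd_in) auto
  from integrable_continuous_real[OF this]
  have "(\<lambda>t. lag \<sigma> (\<lambda>q. V (param c q)) (crd t) (cpow 1 t) (acc t)) integrable_on {a..b}" .
  then show ?thesis
  proof (rule integrable_spike_finite[of "{a, b}", rotated 2])
    show "F x t = lag \<sigma> (\<lambda>q. V (param c q)) (crd t) (cpow 1 t) (acc t)" if "t \<in> {a..b} - {a, b}" for t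
      using F_chart[of x 0 "\<lambda>t. 0" "\<lambda>t. 0" "\<lambda>t. 0" t] xc that by auto
  qed simp
qed

lemma F_variation:
  assumes u: "\<And>r t. \<bar>r\<bar> < e \<Longrightarrow> t \<in> {a..b} \<Longrightarrow> u r t \<in> dom_of c \<and> coords c (u r t) = crd t + r *\<^sub>R \<phi> t"
    and e: "e > 0"
    and \<phi>: "\<And>t. (\<phi> has_vector_derivative \<phi>1 t) (at t)" "\<And>t. (\<phi>1 has_vector_derivative \<phi>2 t) (at t)"
      "continuous_on {a..b} \<phi>2"
  shows "((\<lambda>r. integral {a..b} (F (u r))) has_real_derivative
    chart_geometry.bdry (Gc c) (Chr c) \<sigma> (crd b) (cpow 1 b) (cpow 2 b) (cpow 3 b) (\<phi> b) (\<phi>1 b)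
    - chart_geometry.bdry (Gc c) (Chr c) \<sigma> (crd a) (cpow 1 a) (cpow 2 a) (cpow 3 a) (\<phi> a) (\<phi>1 a)
    + integral {a..b} (\<lambda>t. chart_geometry.EL (Gc c) (Chr c) \<sigma> (dV c) (crd t) (cpow 1 t) (cpow 2 t) (cpow 4 t) (\<phi> t))) (at 0)"
proof -
  interpret chart_geometry "coords c ` dom_of c" "Gc c" "Chr c" by (rule chart_geometry[OF c])
  have q: "crd a \<in> coords c ` dom_of c" using xc[of a] ab by auto
  have "((\<lambda>r. integral {a..b} (\<lambda>t. lag \<sigma> (\<lambda>q. V (param c q)) (crd t + r *\<^sub>R \<phi> t) (cpow 1 t + r *\<^sub>R \<phi>1 t) (acc t + r *\<^sub>R \<phi>2 t)))
     has_real_derivative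
    bdry \<sigma> (crd b) (cpow 1 b) (cpow 2 b) (cpow 3 b) (\<phi> b) (\<phi>1 b) - bdry \<sigma> (crd a) (cpow 1 a) (cpow 2 a) (cpow 3 a) (\<phi> a) (\<phi>1 a)
    + integral {a..b} (\<lambda>t. EL \<sigma> (dV c) (crd t) (cpow 1 t) (cpow 2 t) (cpow 4 t) (\<phi> t))) (at 0)"
  proof (rule first_variation[OF ab(1) e crd_derivative cpow1_derivative])
    show "(cpow 2 has_vector_derivative cpow 3 t - Chr c (crd t) (cpow 1 t) (cpow 2 t)) (at t within {a..b})"
      "(cpow 3 has_vector_derivative cpow 4 t - Chr c (crd t) (cpow 1 t) (cpow 3 t)) (at t within {a..b})"
      if "t \<in> {a..b}" for t
      using cpow_derivative[of 2 t] cpow_derivative[of 3 t] that by (simp_all add: eval_nat_numeral)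
    show "crd t + r *\<^sub>R \<phi> t \<in> coords c ` dom_of c" if "\<bar>r\<bar> < e" "t \<in> {a..b}" for r t
      using u[OF that] by (metis image_eqI)
    show "continuous_on {a..b} (cpow 4)" by (rule cpow_continuous_on) simp
  qed (auto intro: has_vector_derivative_at_within \<phi> V_chart[OF c] V_chart(2)[OF c q])
  then show ?thesis
  proof (rule has_field_derivative_transform_within_open[where S="{-e<..<e}"])
    fix r assume r: "r \<in> {-e<..<e}"
    show "integral {a..b} (\<lambda>t. lag \<sigma> (\<lambda>q. V (param c q)) (crd t + r *\<^sub>R \<phi> t) (cpow 1 t + r *\<^sub>R \<phi>1 t) (acc t + r *\<^sub>R \<phi>2 t))
       = integral {a..b} (F (u r))"
    proof (rule integral_spike[of "{a, b}"])
      show "F (u r) t = lag \<sigma> (\<lambda>q. V (param c q)) (crd t + r *\<^sub>R \<phi> t) (cpow 1 t + r *\<^sub>R \<phi>1 t) (acc t + r *\<^sub>R \<phi>2 t)"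
        if "t \<in> {a..b} - {a, b}" for t
        by (rule F_chart[OF _ \<phi>(1,2)]) (use u r that in auto)
    qed (simp add: negligible_finite)
  qed (use e in auto)
qed

end

end


section \<open>Stationarity\<close>

lemma smooth_derivatives:
  fixes \<phi> :: "real \<Rightarrow> 'a::euclidean_space"
  assumes "\<And>j. Ck_open j UNIV \<phi>"
  obtains \<phi>1 \<phi>2 where "\<And>t. (\<phi> has_vector_derivative \<phi>1 t) (at t)"
    "\<And>t. (\<phi>1 has_vector_derivative \<phi>2 t) (at t)" "\<And>X. continuous_on X \<phi>2"
    "\<And>X t. open X \<Longrightarrow> t \<in> X \<Longrightarrow> (\<And>s. s \<in> X \<Longrightarrow> \<phi> s = 0) \<Longrightarrow> \<phi>1 t = 0"
proof -
  define d where "d \<psi> t = vector_derivative \<psi> (at t)" for \<psi> :: "real \<Rightarrow> 'a" and t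
  have *: "(\<psi> has_vector_derivative d \<psi> t) (at t)" "Ck_on \<infinity> UNIV (d \<psi>)" if "Ck_on \<infinity> UNIV \<psi>" for \<psi> t
    using Ck_on_vector_derivative[of \<infinity> UNIV \<psi>] that by (simp_all add: d_def[abs_def])
  have 0: "Ck_on \<infinity> UNIV \<phi>" using assms by (intro Ck_onI_open) auto
  note 1 = *[OF 0] and 2 = *[OF *(2)[OF 0]]
  show thesis
  proof (rule that[OF 1(1) 2(1)])
    show "continuous_on X (d (d \<phi>))" for X
      using Ck_on_continuous_on[OF 2(2)] continuous_on_subset by blast
    show "d \<phi> t = 0" if "open X" "t \<in> X" "\<And>s. s \<in> X \<Longrightarrow> \<phi> s = 0" for X t
    proof -
      have "((\<lambda>s. 0) has_vector_derivative d \<phi> t) (at t)"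
        by (rule has_vector_derivative_transform_within_open[OF 1(1) that(1,2)]) (use that in simp)
      then show ?thesis using vector_derivative_at by fastforce
    qed
  qed
qed

context spline_problem
begin

abbreviation adm where "adm \<equiv> admissible A N T pt v0 vN"

lemma admissibleD:
  assumes "x \<in> adm"
  shows "continuous_on {0..T N} x" "i \<in> {1..N} \<Longrightarrow> Ck_map A \<infinity> (cell i) x" "Ck_map A 1 {0..T N} x"
  using assms by (auto simp: admissible_def Ck_map_def)

lemma chart_nbhd:
  fixes x :: "real \<Rightarrow> 'm"
  assumes "continuous_on I x" "t0 \<in> I" "c \<in> A" "x t0 \<in> dom_of c"
  obtains d where "d > 0" "\<And>t. t \<in> I \<Longrightarrow> \<bar>t - t0\<bar> < d \<Longrightarrow> x t \<in> dom_of c"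
proof -
  obtain B where B: "open B" "B \<inter> I = x -` dom_of c \<inter> I"
    using assms(1) chart(1)[OF assms(3)] unfolding continuous_on_open_invariant by blast
  have "t0 \<in> B" using B assms by blast
  then obtain d where d: "d > 0" "ball t0 d \<subseteq> B" using B(1) open_contains_ball by blast
  have "x t \<in> dom_of c" if "t \<in> I" "\<bar>t - t0\<bar> < d" for t
  proof -
    have "t \<in> ball t0 d" using that(2) by (simp add: dist_real_def abs_minus_commute)
    then show ?thesis using d(2) B(2) that(1) by blast
  qed
  then show thesis using that d(1) by blast
qed

text \<open>On each side of any time, and close to it, the curve stays in one cell and one chart, where the
  integrand is continuous up to the ends of the arc; compactness does the rest.\<close>

lemma F_integrable_on:
  assumes x: "x \<in> adm"
  shows "F x integrable_on {0..T N}"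
proof -
  have "\<exists>d>0. \<forall>u v. t0 \<in> {u..v} \<and> {u..v} \<subseteq> ball t0 d \<and> {u..v} \<subseteq> {0..T N} \<longrightarrow> F x integrable_on {u..v}"
    if t0: "t0 \<in> {0..T N}" for t0
  proof -
    obtain c where c: "c \<in> A" "x t0 \<in> dom_of c" using chart_at by blast
    obtain d where d: "d > 0" "\<And>t. t \<in> {0..T N} \<Longrightarrow> \<bar>t - t0\<bar> < d \<Longrightarrow> x t \<in> dom_of c"
      using chart_nbhd[OF admissibleD(1)[OF x] t0 c] by blast
    have piece: "F x integrable_on {u..v}"
      if "u \<le> v" "i \<in> {1..N}" "T (i - 1) \<le> u" "v \<le> T i" "\<And>t. t \<in> {u..v} \<Longrightarrow> \<bar>t - t0\<bar> < d" for u v i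
    proof (cases "u = v")
      case False
      have "{u..v} \<subseteq> cell i" using that by auto
      moreover have "x t \<in> dom_of c" if "t \<in> {u..v}" for t
        using \<open>{u..v} \<subseteq> cell i\<close> cell_subset[OF \<open>i \<in> {1..N}\<close>] that \<open>\<And>t. t \<in> {u..v} \<Longrightarrow> \<bar>t - t0\<bar> < d\<close>
        by (intro d(2)) auto
      ultimately show ?thesis
        using F_integrable[OF that(2) admissibleD(2)[OF x that(2)] c(1)] False that(1) by simp
    qed (use integrable_on_refl[of "F x" v] in simp)
    have left: "\<exists>l>0. \<forall>u. 0 \<le> u \<and> u \<le> t0 \<and> t0 - u < l \<longrightarrow> F x integrable_on {u..t0}"
    proof (cases "t0 = 0")
      case True
      have "F x integrable_on {u..t0}" if "0 \<le> u" "u \<le> t0" for u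
        using that True integrable_on_refl[of "F x" t0] by (cases "u = t0") auto
      then show ?thesis by (intro exI[of _ 1]) auto
    next
      case False
      then obtain i where i: "i \<in> {1..N}" "T (i - 1) < t0" "t0 \<le> T i" using knot_left[of t0] t0 by auto
      have "F x integrable_on {u..t0}" if "u \<le> t0" "t0 - u < min d (t0 - T (i - 1))" for u
        by (rule piece[OF _ i(1)]) (use that i in auto)
      then show ?thesis using i d(1) by (intro exI[of _ "min d (t0 - T (i - 1))"]) auto
    qed
    have right: "\<exists>l>0. \<forall>v. v \<le> T N \<and> t0 \<le> v \<and> v - t0 < l \<longrightarrow> F x integrable_on {t0..v}"
    proof (cases "t0 = T N")
      case True
      have "F x integrable_on {t0..v}" if "v \<le> T N" "t0 \<le> v" for v
        using that True integrable_on_refl[of "F x" t0] by (cases "v = t0") auto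
      then show ?thesis by (intro exI[of _ 1]) auto
    next
      case False
      then obtain i where i: "i \<in> {1..N}" "T (i - 1) \<le> t0" "t0 < T i" using knot_right[of t0] t0 by auto
      have "F x integrable_on {t0..v}" if "t0 \<le> v" "v - t0 < min d (T i - t0)" for v
        by (rule piece[OF _ i(1)]) (use that i in auto)
      then show ?thesis using i d(1) by (intro exI[of _ "min d (T i - t0)"]) auto
    qed
    from left obtain l where l: "l > 0" "\<And>u. 0 \<le> u \<Longrightarrow> u \<le> t0 \<Longrightarrow> t0 - u < l \<Longrightarrow> F x integrable_on {u..t0}" by blast
    from right obtain m where m: "m > 0" "\<And>v. v \<le> T N \<Longrightarrow> t0 \<le> v \<Longrightarrow> v - t0 < m \<Longrightarrow> F x integrable_on {t0..v}" by blast
    have "F x integrable_on {u..v}" if "t0 \<in> {u..v}" "{u..v} \<subseteq> ball t0 (min l m)" "{u..v} \<subseteq> {0..T N}" for u v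
    proof (rule Henstock_Kurzweil_Integration.integrable_combine)
      have uv: "u \<in> {u..v}" "v \<in> {u..v}" using that(1) by auto
      have "t0 - u < l" "v - t0 < m" "0 \<le> u" "v \<le> T N"
        using subsetD[OF that(2) uv(1)] subsetD[OF that(2) uv(2)] subsetD[OF that(3) uv(1)]
          subsetD[OF that(3) uv(2)] by (auto simp: dist_real_def)
      then show "F x integrable_on {u..t0}" "F x integrable_on {t0..v}" "u \<le> t0" "t0 \<le> v"
        using that(1) by (auto intro: l(2) m(2))
    qed
    then show ?thesis using l(1) m(1) by (intro exI[of _ "min l m"]) auto
  qed
  then show ?thesis using integrable_on_little_subintervals[of 0 "T N" "F x"] by simp
qed

context
  fixes c :: "('m, 'e) chart" and x :: "real \<Rightarrow> 'm" and \<phi> :: "real \<Rightarrow> 'e" and a a' b b' e :: real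
  assumes c: "c \<in> A" and ab: "a < a'" "a' < b'" "b' < b" "0 < a" "b < T N" and e: "e > 0"
    and \<phi>: "\<And>j. Ck_open j UNIV \<phi>" "\<And>t. t \<notin> {a'..b'} \<Longrightarrow> \<phi> t = 0"
    and x: "\<And>t. t \<in> {a..b} \<Longrightarrow> x t \<in> dom_of c"
    and inU: "\<And>r t. \<bar>r\<bar> < e \<Longrightarrow> t \<in> {a..b} \<Longrightarrow> coords c (x t) + r *\<^sub>R \<phi> t \<in> coords c ` dom_of c"
    and x_adm: "x \<in> adm" and knots: "\<And>j. j \<in> {1..<N} \<Longrightarrow> \<phi> (T j) = 0"
begin

lemma vary_admissible_at:
  assumes r: "\<bar>r\<bar> < e"
  shows "vary c a b \<phi> x r \<in> adm"
proof -
  have sl: "Ck_map A k J (vary c a b \<phi> x r)" if "Ck_map A k J x" for k J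
    by (rule vary_Ck_map_slice[OF c ab(1,3) e \<phi> x inU that r])
  have off: "vary c a b \<phi> x r t = x t" if "t \<notin> {a'..b'}" for t
    by (rule vary_off[OF c ab(1,3) e \<phi> x inU that])
  have "vary c a b \<phi> x r (T j) = pt j" if "j \<in> {1..<N}" for j
  proof -
    have "vary c a b \<phi> x r (T j) = x (T j)"
      by (simp add: vary_def knots[OF that] param_coords[OF c x])
    then show ?thesis using x_adm that by (simp add: admissible_def)
  qed
  moreover have "velocity A {0..T N} (vary c a b \<phi> x r) 0 = velocity A {0..T N} x 0"
    by (rule velocity_local[of "{..<a'}"]) (use ab off in auto)
  moreover have "velocity A {0..T N} (vary c a b \<phi> x r) (T N) = velocity A {0..T N} x (T N)"
    by (rule velocity_local[of "{b'<..}"]) (use ab off in auto)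
  moreover have "vary c a b \<phi> x r 0 = x 0" "vary c a b \<phi> x r (T N) = x (T N)"
    using ab off by auto
  ultimately show ?thesis
    using sl x_adm by (simp add: admissible_def)
qed

lemma vary_admissible: "admissible_variation A N T pt v0 vN x (vary c a b \<phi> x)"
  unfolding admissible_variation_def
proof (intro exI[of _ e] conjI ballI)
  show "Ck_map A 1 ({- e<..<e} \<times> {0..T N}) (\<lambda>(r, t). vary c a b \<phi> x r t)"
    by (rule vary_Ck_map[OF c ab(1,3) e \<phi> x inU admissibleD(3)[OF x_adm]])
  show "Ck_map A \<infinity> ({- e<..<e} \<times> cell i) (\<lambda>(r, t). vary c a b \<phi> x r t)" if "i \<in> {1..N}" for i
    by (rule vary_Ck_map[OF c ab(1,3) e \<phi> x inU admissibleD(2)[OF x_adm that]])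
  show "vary c a b \<phi> x 0 t = x t" for t
    by (rule vary_0[OF c ab(1,3) e \<phi> x inU])
  show "vary c a b \<phi> x r \<in> adm" if "r \<in> {-e<..<e}" for r
    using that by (intro vary_admissible_at) auto
qed (rule e)

text \<open>Off the support of the variation the integrand does not change, so that the derivative of the
  action is that of the integral over the support.\<close>

lemma stationary:
  assumes ext: "extremizer A N T pt v0 vN (action A g nab \<sigma> V (T N)) x"
  shows "((\<lambda>r. integral {a..b} (F (vary c a b \<phi> x r))) has_real_derivative 0) (at 0)"
proof -
  let ?u = "vary c a b \<phi> x"
  have off: "?u r t = x t" if "t \<notin> {a'..b'}" for r t
    by (rule vary_off[OF c ab(1,3) e \<phi> x inU that])
  have J: "action A g nab \<sigma> V (T N) z = integral {0..T N} (F z)" for z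
    by (simp add: action_def integrand_def[abs_def])
  have d: "((\<lambda>r. action A g nab \<sigma> V (T N) (?u r)) has_real_derivative 0) (at 0)"
    using ext vary_admissible unfolding extremizer_def by blast
  have Foff: "F (?u r) t = F x t" if "t \<in> {0..a} \<union> {b..T N}" for r t
  proof -
    have tI: "t \<in> {0..T N}" using that ab by auto
    have "cov_power A nab {0..T N} (?u r) k t = cov_power A nab {0..T N} x k t" for k
      by (rule cov_power_local[of "- {a'..b'}"]) (use that ab off tI in auto)
    moreover have "?u r t = x t" using off[of t r] that ab by auto
    ultimately show ?thesis by (simp add: integrand_def)
  qed
  let ?K = "integral {0..a} (F x) + integral {b..T N} (F x)"
  have split: "action A g nab \<sigma> V (T N) (?u r) - ?K = integral {a..b} (F (?u r))" if "r \<in> {-e<..<e}" for r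
  proof -
    have i: "F (?u r) integrable_on {0..T N}"
      using that by (intro F_integrable_on vary_admissible_at) auto
    have i': "F (?u r) integrable_on {a..T N}"
      by (rule integrable_subinterval_real[OF i]) (use ab in auto)
    have "integral {0..T N} (F (?u r)) = integral {0..a} (F (?u r)) + (integral {a..b} (F (?u r)) + integral {b..T N} (F (?u r)))"
      using Henstock_Kurzweil_Integration.integral_combine[OF _ _ i, of a] Henstock_Kurzweil_Integration.integral_combine[OF _ _ i', of b] ab by simp
    moreover have "integral {0..a} (F (?u r)) = integral {0..a} (F x)"
      "integral {b..T N} (F (?u r)) = integral {b..T N} (F x)"
      by (rule integral_cong, rule Foff, simp)+
    ultimately show ?thesis by (simp add: J)
  qed
  have "((\<lambda>r. action A g nab \<sigma> V (T N) (?u r) - ?K) has_real_derivative 0 - 0) (at 0)"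
    by (intro DERIV_diff d DERIV_const)
  then have "((\<lambda>r. action A g nab \<sigma> V (T N) (?u r) - ?K) has_real_derivative 0) (at 0)" by simp
  then show ?thesis
    by (rule has_field_derivative_transform_within_open[where S="{-e<..<e}"]) (use e split in auto)
qed

end

text \<open>The compact arc has positive distance from the complement of the open chart image.\<close>

lemma variation_room:
  fixes x :: "real \<Rightarrow> 'm" and \<phi> :: "real \<Rightarrow> 'e"
  assumes c: "c \<in> A" and x: "continuous_on {a..b} x" "\<And>t. t \<in> {a..b} \<Longrightarrow> x t \<in> dom_of c"
    and \<phi>: "continuous_on {a..b} \<phi>"
  obtains e where "e > 0"
    "\<And>r t. \<bar>r\<bar> < e \<Longrightarrow> t \<in> {a..b} \<Longrightarrow> coords c (x t) + r *\<^sub>R \<phi> t \<in> coords c ` dom_of c"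
proof -
  let ?K = "(\<lambda>t. coords c (x t)) ` {a..b}"
  have "continuous_on {a..b} (\<lambda>t. coords c (x t))"
    by (rule continuous_on_compose2[OF continuous_coords[OF c] x(1)]) (use x in auto)
  then have "compact ?K" by (rule compact_continuous_image) auto
  moreover have "?K \<subseteq> coords c ` dom_of c" using x by auto
  ultimately obtain d where d: "d > 0" "(\<Union>q\<in>?K. ball q d) \<subseteq> coords c ` dom_of c"
    using compact_subset_open_imp_ball_epsilon_subset chart(2)[OF c] by metis
  obtain M where M: "M > 0" "\<And>t. t \<in> {a..b} \<Longrightarrow> norm (\<phi> t) \<le> M"
    using compact_imp_bounded[OF compact_continuous_image[OF \<phi> compact_Icc]] unfolding bounded_pos by auto
  show thesis
  proof
    show "d / M > 0" using d M by simp
    fix r t assume rt: "\<bar>r\<bar> < d / M" "t \<in> {a..b}"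
    have "norm (r *\<^sub>R \<phi> t) \<le> \<bar>r\<bar> * M" using M(2)[OF rt(2)] by (simp add: mult_left_mono)
    also have "\<dots> < d" using rt(1) M(1) by (simp add: field_simps)
    finally have "coords c (x t) + r *\<^sub>R \<phi> t \<in> ball (coords c (x t)) d" by (simp add: dist_norm)
    then show "coords c (x t) + r *\<^sub>R \<phi> t \<in> coords c ` dom_of c" using d(2) rt(2) by blast
  qed
qed


section \<open>The Euler--Lagrange equation\<close>

text \<open>The index \<open>i\<close> matters at a knot only, where it selects the side from which derivatives are
  taken.\<close>

definition el :: "(real \<Rightarrow> 'm) \<Rightarrow> nat \<Rightarrow> ('m, 'e) chart \<Rightarrow> real \<Rightarrow> 'e \<Rightarrow> real" where
  "el x i c t w = chart_geometry.EL (Gc c) (Chr c) \<sigma> (dV c) (coords c (x t))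
     (cpow x i c 1 t) (cpow x i c 2 t) (cpow x i c 4 t) w"

lemma el_scale:
  assumes "c \<in> A" "x t \<in> dom_of c"
  shows "el x i c t (r *\<^sub>R w) = r * el x i c t w"
proof -
  interpret chart_geometry "coords c ` dom_of c" "Gc c" "Chr c" by (rule chart_geometry[OF assms(1)])
  have q: "coords c (x t) \<in> coords c ` dom_of c" using assms by blast
  have "linear (dV c (coords c (x t)))" using V_chart(1)[OF assms(1) q] has_derivative_linear by blast
  from linear_scale[OF this] show ?thesis
    by (simp add: el_def EL_def G_simps[OF q] algebra_simps)
qed

lemma el_continuous_on:
  assumes i: "i \<in> {1..N}" and x: "Ck_map A \<infinity> (cell i) x" and c: "c \<in> A"
  shows "continuous_on (cell i \<inter> x -` dom_of c) (\<lambda>t. el x i c t w)"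
proof (cases "cell i \<inter> x -` dom_of c = {}")
  case False
  interpret chart_geometry "coords c ` dom_of c" "Gc c" "Chr c" by (rule chart_geometry[OF c])
  have D: "continuous_on (cell i \<inter> x -` dom_of c) (\<lambda>t. cpow x i c k t)" if "k \<ge> 1" for k
    by (rule Ck_on_continuous_on[OF cov_power_Ck_on[OF x c at_within_cell[OF i] that]])
  obtain p where p: "p \<in> dom_of c" using False by blast
  show ?thesis
    unfolding el_def
  proof (rule EL_continuous_on)
    show "linear (dV c q)" if "q \<in> coords c ` dom_of c" for q
      using V_chart(1)[OF c that] has_derivative_linear by blast
    show "continuous_on (coords c ` dom_of c) (\<lambda>q. dV c q w)" for w
      using p by (intro V_chart(2)[OF c, of "coords c p"]) blast
    show "continuous_on (cell i \<inter> x -` dom_of c) (\<lambda>t. coords c (x t))"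
      by (rule Ck_on_continuous_on[OF Ck_map_coords[OF x c]])
    show "continuous_on (cell i \<inter> x -` dom_of c) (\<lambda>t. cpow x i c 1 t)"
      "continuous_on (cell i \<inter> x -` dom_of c) (\<lambda>t. cpow x i c 2 t)"
      "continuous_on (cell i \<inter> x -` dom_of c) (\<lambda>t. cpow x i c 4 t)"
      by (rule D, simp)+
  qed auto
qed simp

context
  fixes x assumes ext: "extremizer A N T pt v0 vN (action A g nab \<sigma> V (T N)) x"
begin

lemma x_adm: "x \<in> adm" using ext by (simp add: extremizer_def)

text \<open>The first variation for a test field supported in \<open>{a..b}\<close>, where \<open>\<tau>\<close> may be a knot, so that
  the covariant derivatives before and after \<open>\<tau>\<close> are taken in different cells.\<close>

lemma split_variation:
  assumes i: "i \<in> {1..N}" "j \<in> {1..N}" and c: "c \<in> A"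
    and ab: "a < a'" "a' < \<tau>" "\<tau> < b'" "b' < b" "0 < a" "b < T N"
    and cells: "{a..\<tau>} \<subseteq> cell i" "{\<tau>..b} \<subseteq> cell j"
    and xc: "\<And>t. t \<in> {a..b} \<Longrightarrow> x t \<in> dom_of c"
    and \<phi>: "\<And>k. Ck_open k UNIV \<phi>" "\<And>t. t \<notin> {a'..b'} \<Longrightarrow> \<phi> t = 0"
    and knots: "\<And>k. k \<in> {1..<N} \<Longrightarrow> \<phi> (T k) = 0"
    and \<psi>: "(\<phi> has_vector_derivative \<psi>) (at \<tau>)"
  shows "chart_geometry.bdry (Gc c) (Chr c) \<sigma> (crd x c \<tau>) (cpow x i c 1 \<tau>) (cpow x i c 2 \<tau>) (cpow x i c 3 \<tau>) (\<phi> \<tau>) \<psi>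
      + integral {a..\<tau>} (\<lambda>t. el x i c t (\<phi> t))
    = chart_geometry.bdry (Gc c) (Chr c) \<sigma> (crd x c \<tau>) (cpow x j c 1 \<tau>) (cpow x j c 2 \<tau>) (cpow x j c 3 \<tau>) (\<phi> \<tau>) \<psi>
      - integral {\<tau>..b} (\<lambda>t. el x j c t (\<phi> t))"
proof -
  interpret chart_geometry "coords c ` dom_of c" "Gc c" "Chr c" by (rule chart_geometry[OF c])
  have ab': "a' < b'" "a < \<tau>" "\<tau> < b" using ab by auto
  obtain \<phi>1 \<phi>2 where \<phi>': "\<And>t. (\<phi> has_vector_derivative \<phi>1 t) (at t)"
    "\<And>t. (\<phi>1 has_vector_derivative \<phi>2 t) (at t)" "\<And>X. continuous_on X \<phi>2"
    "\<And>X t. open X \<Longrightarrow> t \<in> X \<Longrightarrow> (\<And>s. s \<in> X \<Longrightarrow> \<phi> s = 0) \<Longrightarrow> \<phi>1 t = 0"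
    using smooth_derivatives[OF \<phi>(1)] by metis
  have z: "\<phi> a = 0" "\<phi> b = 0" "\<phi>1 a = 0" "\<phi>1 b = 0"
    using \<phi>(2)[of a] \<phi>(2)[of b] \<phi>'(4)[of "- {a'..b'}" a] \<phi>'(4)[of "- {a'..b'}" b] \<phi>(2) ab by auto
  have \<psi>': "\<phi>1 \<tau> = \<psi>" by (rule vector_derivative_unique_at[OF \<phi>'(1) \<psi>])
  have xab: "continuous_on {a..b} x"
    by (rule continuous_on_subset[OF admissibleD(1)[OF x_adm]]) (use ab in auto)
  obtain e where e: "e > 0"
    "\<And>r t. \<bar>r\<bar> < e \<Longrightarrow> t \<in> {a..b} \<Longrightarrow> crd x c t + r *\<^sub>R \<phi> t \<in> coords c ` dom_of c"
    using variation_room[OF c xab xc continuous_on_subset[OF Ck_open_continuous_on[OF \<phi>(1)[of 0]]]] by blast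
  let ?u = "vary c a b \<phi> x"
  have st: "((\<lambda>r. integral {a..b} (F (?u r))) has_real_derivative 0) (at 0)"
    by (rule stationary[OF c ab(1) ab'(1) ab(4-6) e(1) \<phi> xc e(2) x_adm knots ext])
  have on: "?u r t \<in> dom_of c \<and> coords c (?u r t) = crd x c t + r *\<^sub>R \<phi> t"
    if "\<bar>r\<bar> < e" "t \<in> {a..b}" for r t
    using vary_on[OF c ab(1,4) e(1) \<phi> xc e(2) that] by blast
  have q: "crd x c a \<in> coords c ` dom_of c" "crd x c b \<in> coords c ` dom_of c"
    using xc[of a] xc[of b] ab by auto
  let ?L = "bdry \<sigma> (crd x c \<tau>) (cpow x i c 1 \<tau>) (cpow x i c 2 \<tau>) (cpow x i c 3 \<tau>) (\<phi> \<tau>) \<psi>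
      + integral {a..\<tau>} (\<lambda>t. el x i c t (\<phi> t))"
    and ?R = "bdry \<sigma> (crd x c \<tau>) (cpow x j c 1 \<tau>) (cpow x j c 2 \<tau>) (cpow x j c 3 \<tau>) (\<phi> \<tau>) \<psi>
      - integral {\<tau>..b} (\<lambda>t. el x j c t (\<phi> t))"
  have zero: "bdry \<sigma> (crd x c a) Y A' B 0 0 = 0" "bdry \<sigma> (crd x c b) Y A' B 0 0 = 0" for Y A' B
    by (simp_all add: bdry_def G_simps[OF q(1)] G_simps[OF q(2)] \<Gamma>_simps[OF q(1)] \<Gamma>_simps[OF q(2)])
  have L: "((\<lambda>r. integral {a..\<tau>} (F (?u r))) has_real_derivative ?L) (at 0)"
    by (rule DERIV_cong[OF F_variation[OF i(1) admissibleD(2)[OF x_adm i(1)] c ab'(2) cells(1) xc on e(1) \<phi>'(1-3)]])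
       (use ab in \<open>auto simp: z zero \<psi>' el_def\<close>)
  have R: "((\<lambda>r. integral {\<tau>..b} (F (?u r))) has_real_derivative - ?R) (at 0)"
    by (rule DERIV_cong[OF F_variation[OF i(2) admissibleD(2)[OF x_adm i(2)] c ab'(3) cells(2) xc on e(1) \<phi>'(1-3)]])
       (use ab in \<open>auto simp: z zero \<psi>' el_def\<close>)
  have "((\<lambda>r. integral {a..b} (F (?u r))) has_real_derivative ?L + - ?R) (at 0)"
  proof (rule has_field_derivative_transform_within_open[OF DERIV_add[OF L R], where S="{-e<..<e}"])
    fix r assume r: "r \<in> {-e<..<e}"
    have "F (?u r) integrable_on {0..T N}"
      using r by (intro F_integrable_on vary_admissible_at[OF c ab(1) ab'(1) ab(4-6) e(1) \<phi> xc e(2) x_adm knots]) auto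
    then have "F (?u r) integrable_on {a..b}"
      by (rule integrable_subinterval_real) (use ab in auto)
    then show "integral {a..\<tau>} (F (?u r)) + integral {\<tau>..b} (F (?u r)) = integral {a..b} (F (?u r))"
      using ab by (intro Henstock_Kurzweil_Integration.integral_combine) auto
  qed (use e in auto)
  from DERIV_unique[OF st this] show ?thesis by simp
qed

lemma chart_interval:
  assumes "c \<in> A" "x t0 \<in> dom_of c" "l < t0" "t0 < u" "{l..u} \<subseteq> {0..T N}" "0 < d1"
  obtains d where "0 < d" "d < d1" "l < t0 - d" "t0 + d < u" "\<And>t. t \<in> {t0 - d..t0 + d} \<Longrightarrow> x t \<in> dom_of c"
proof -
  have "t0 \<in> {0..T N}" using assms by auto
  then obtain d0 where d0: "d0 > 0" "\<And>t. t \<in> {0..T N} \<Longrightarrow> \<bar>t - t0\<bar> < d0 \<Longrightarrow> x t \<in> dom_of c"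
    using chart_nbhd[OF admissibleD(1)[OF x_adm] _ assms(1,2)] by blast
  define d where "d = min (min d0 d1) (min (t0 - l) (u - t0)) / 2"
  have d: "d > 0" "d < d0" "d < d1" "d < t0 - l" "d < u - t0"
    using d0(1) assms by (auto simp: d_def)
  have "{t0 - d..t0 + d} \<subseteq> {l..u}" using d by auto
  moreover have "\<bar>t - t0\<bar> < d0" if "t \<in> {t0 - d..t0 + d}" for t using that d by auto
  ultimately show thesis using d assms(5) by (intro that[of d] d0(2)) (auto dest: subsetD)
qed

text \<open>The fundamental lemma of the calculus of variations, with a bump function times a constant
  vector as test field.\<close>

lemma el_interior:
  assumes i: "i \<in> {1..N}" and t0: "T (i - 1) < t0" "t0 < T i" and c: "c \<in> A" "x t0 \<in> dom_of c"
  shows "el x i c t0 w = 0"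
proof -
  note xi = admissibleD(2)[OF x_adm i]
  \<comment> \<open>Only positive values have to be excluded, because the expression is odd in \<open>w\<close>.\<close>
  have no: "\<not> el x i c t0 w > 0" for w
  proof
    assume pos: "el x i c t0 w > 0"
    let ?S = "cell i \<inter> x -` dom_of c"
    have "t0 \<in> ?S" using t0 c by auto
    then have "\<exists>d1>0. \<forall>t\<in>?S. dist t t0 < d1 \<longrightarrow> dist (el x i c t w) (el x i c t0 w) < el x i c t0 w"
      using el_continuous_on[OF i xi c(1), of w] pos unfolding continuous_on_iff by blast
    then obtain d1 where d1: "d1 > 0" "\<And>t. t \<in> ?S \<Longrightarrow> dist t t0 < d1 \<Longrightarrow>
        dist (el x i c t w) (el x i c t0 w) < el x i c t0 w" by blast
    obtain d where d: "0 < d" "d < d1" "T (i - 1) < t0 - d" "t0 + d < T i"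
      "\<And>t. t \<in> {t0 - d..t0 + d} \<Longrightarrow> x t \<in> dom_of c"
      using chart_interval[OF c t0 cell_subset[OF i] d1(1)] by blast
    define a b a' b' where "a = t0 - d" and "b = t0 + d" and "a' = t0 - d / 2" and "b' = t0 + d / 2"
    have ab: "a < a'" "a' < t0" "t0 < b'" "b' < b" "a < b" "T (i - 1) < a" "b < T i"
      using d by (auto simp: a_def b_def a'_def b'_def)
    have abT: "0 < a" "b < T N" using ab cell_subset[OF i] T_step[OF i] by auto
    have xc: "x t \<in> dom_of c" if "t \<in> {a..b}" for t using d(5) that by (simp add: a_def b_def)
    have cell: "{a..b} \<subseteq> cell i" "{a..t0} \<subseteq> cell i" "{t0..b} \<subseteq> cell i" using ab by auto
    have elpos: "el x i c t w > 0" if t: "t \<in> {a..b}" for t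
    proof -
      have "t \<in> ?S" "dist t t0 < d1" using t cell(1) xc[OF t] d(2) by (auto simp: dist_real_def a_def b_def)
      from d1(2)[OF this] show ?thesis by (auto simp: dist_real_def)
    qed
    obtain \<beta> :: "real \<Rightarrow> real" where \<beta>: "\<And>j. Ck_open j UNIV \<beta>" "\<And>t. 0 \<le> \<beta> t" "\<And>t. 0 < \<beta> t \<longleftrightarrow> a' < t \<and> t < b'"
      using smooth_bump[of a' b'] by blast
    define \<phi> where "\<phi> t = \<beta> t *\<^sub>R w" for t
    have \<phi>: "Ck_open j UNIV \<phi>" for j
      unfolding \<phi>_def by (intro Ck_open_bounded_bilinear[OF open_UNIV bounded_bilinear_scaleR] \<beta>(1) Ck_open_const)
    have \<phi>0: "\<phi> t = 0" if "t \<notin> {a'..b'}" for t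
      using \<beta>(2,3)[of t] that by (auto simp: \<phi>_def)
    have knots: "\<phi> (T j) = 0" if "j \<in> {1..<N}" for j
    proof (rule \<phi>0)
      have "T j \<le> T (i - 1) \<or> T i \<le> T j"
        using T_le[of j "i - 1"] T_le[of i j] that i by (cases "j \<le> i - 1") auto
      then show "T j \<notin> {a'..b'}" using ab by auto
    qed
    obtain \<psi> where \<psi>: "(\<phi> has_vector_derivative \<psi>) (at t0)"
      using smooth_derivatives[OF \<phi>] by metis
    have eq: "el x i c t (\<phi> t) = \<beta> t * el x i c t w" if "t \<in> {a..b}" for t
      unfolding \<phi>_def by (rule el_scale[where x=x, OF c(1) xc[OF that]])
    have cont: "continuous_on {a..b} (\<lambda>t. \<beta> t * el x i c t w)"
      using xc cell by (intro continuous_intros continuous_on_subset[OF Ck_open_continuous_on[OF \<beta>(1)[of 0]]]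
          continuous_on_subset[OF el_continuous_on[OF i xi c(1)]]) auto
    have "integral {a..t0} (\<lambda>t. el x i c t (\<phi> t)) = - integral {t0..b} (\<lambda>t. el x i c t (\<phi> t))"
      using split_variation[OF i i c(1) ab(1-4) abT cell(2,3) xc \<phi> \<phi>0 knots \<psi>] by simp
    moreover have "integral {a..t0} (\<lambda>t. el x i c t (\<phi> t)) = integral {a..t0} (\<lambda>t. \<beta> t * el x i c t w)"
      "integral {t0..b} (\<lambda>t. el x i c t (\<phi> t)) = integral {t0..b} (\<lambda>t. \<beta> t * el x i c t w)"
      using ab by (auto intro!: integral_cong eq)
    ultimately have "integral {a..b} (\<lambda>t. \<beta> t * el x i c t w) = 0"
      using Henstock_Kurzweil_Integration.integral_combine[OF _ _ integrable_continuous_real[OF cont], of t0] ab by simp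
    moreover have "\<beta> t * el x i c t w \<ge> 0" if "t \<in> {a..b}" for t
      using \<beta>(2)[of t] elpos[OF that] by simp
    moreover have "t0 \<in> {a..b}" using ab by auto
    ultimately have "\<beta> t0 * el x i c t0 w = 0"
      using integral_eq_0_iff[of a b "\<lambda>t. \<beta> t * el x i c t w"] cont ab(5) by blast
    then show False using pos \<beta>(3)[of t0] ab by auto
  qed
  from no[of w] no[of "(-1) *\<^sub>R w"] show ?thesis
    using el_scale[OF c(1), of x t0 i "-1" w] c(2) by simp
qed

text \<open>Continuity from the interior of the cell, since all derivatives are continuous up to its ends.\<close>

lemma el_zero:
  assumes i: "i \<in> {1..N}" and t0: "t0 \<in> cell i" and c: "c \<in> A" "x t0 \<in> dom_of c"
  shows "el x i c t0 w = 0"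
proof -
  note xi = admissibleD(2)[OF x_adm i]
  let ?I = "{T (i - 1)<..<T i}"
  have ne: "at t0 within ?I \<noteq> bot"
  proof -
    have "closure ?I = cell i" using T_step[OF i] by simp
    then show ?thesis
      using t0 interior_limit_point[of t0 ?I] unfolding closure_def trivial_limit_within
      by (cases "t0 \<in> ?I") (auto simp: interior_open)
  qed
  have S: "t0 \<in> cell i \<inter> x -` dom_of c" using t0 c by auto
  obtain d0 where d0: "d0 > 0" "\<And>t. t \<in> cell i \<Longrightarrow> \<bar>t - t0\<bar> < d0 \<Longrightarrow> x t \<in> dom_of c"
    using chart_nbhd[OF Ck_map_continuous[OF xi] t0 c] by blast
  have "((\<lambda>t. el x i c t w) \<longlongrightarrow> el x i c t0 w) (at t0 within cell i)"
    using el_continuous_on[OF i xi c(1)] S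
    unfolding continuous_on_def at_within_preimage[OF Ck_map_continuous[OF xi] c(1) S, symmetric] by blast
  then have "((\<lambda>t. el x i c t w) \<longlongrightarrow> el x i c t0 w) (at t0 within ?I)"
    by (rule tendsto_within_subset) auto
  moreover have "((\<lambda>t. el x i c t w) \<longlongrightarrow> 0) (at t0 within ?I)"
  proof (rule tendsto_eventually)
    have "x t \<in> dom_of c" if "t \<in> ?I" "dist t t0 < d0" for t
      using d0(2)[of t] that by (auto simp: dist_real_def)
    then show "\<forall>\<^sub>F t in at t0 within ?I. el x i c t w = 0"
      using d0(1) el_interior[OF i _ _ c(1)] unfolding eventually_at by (intro exI[of _ d0]) auto
  qed
  ultimately show ?thesis using tendsto_unique[OF ne] by blast
qed

text \<open>As \<open>x\<close> is $C^1$ on the whole interval, the one-sided velocities at a knot agree.\<close>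

lemma velocity_cell:
  assumes i: "i \<in> {1..N}" and t: "t \<in> cell i" and c: "c \<in> A" "x t \<in> dom_of c"
  shows "velocity A (cell i) x t c = velocity A {0..T N} x t c"
proof -
  let ?S = "{0..T N} \<inter> x -` dom_of c" and ?y = "\<lambda>t. coords c (x t)"
  have t0N: "0 < T N" using T_less[of 0 N] N T0 by simp
  have tI: "t \<in> {0..T N}" using cell_subset[OF i] t by blast
  note at = at_within_preimage[OF admissibleD(1)[OF x_adm] c(1)]
  have lim: "at t within ?S \<noteq> bot" if "t \<in> ?S" for t
    using that t0N unfolding at[OF that] by (simp add: trivial_limit_within islimpt_Icc)
  have "Ck_on (eSuc 0) ?S ?y"
    using Ck_map_coords[OF admissibleD(3)[OF x_adm] c(1)] by (simp add: one_eSuc)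
  from Ck_on_vector_derivative(1)[OF this lim, of t]
  have y: "(?y has_vector_derivative vector_derivative ?y (at t within {0..T N})) (at t within {0..T N})"
    using at[of t] tI c by simp
  have "vector_derivative ?y (at t within cell i) = vector_derivative ?y (at t within {0..T N})"
    by (rule vector_derivative_within[OF at_within_cell[OF i t]
        has_vector_derivative_within_subset[OF y cell_subset[OF i]]])
  then show ?thesis using c by (simp add: velocity_def charts_at_def comp_def)
qed

text \<open>At an interior knot the value of a test field is prescribed to be zero, but not that of its
  derivative; the field $(t - T_i)\beta(t)w$ isolates the jump of $D^2x/dt^2$ in the boundary
  terms.\<close>

lemma no_corner:
  assumes i: "1 \<le> i" "i < N" and c: "c \<in> A" "x (T i) \<in> dom_of c"
  shows "cpow x i c 2 (T i) = cpow x (Suc i) c 2 (T i)"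
proof -
  interpret chart_geometry "coords c ` dom_of c" "Gc c" "Chr c" by (rule chart_geometry[OF c(1)])
  define \<tau> where "\<tau> = T i"
  have i1: "i \<in> {1..N}" "Suc i \<in> {1..N}" using i by auto
  have \<tau>T: "T (i - 1) < \<tau>" "\<tau> < T (Suc i)" using T_step[OF i1(1)] T_step[OF i1(2)] by (auto simp: \<tau>_def)
  have c\<tau>: "x \<tau> \<in> dom_of c" using c by (simp add: \<tau>_def)
  have q: "crd x c \<tau> \<in> coords c ` dom_of c" using c\<tau> by blast
  have "{T (i - 1)..T (Suc i)} \<subseteq> {0..T N}"
    using T_le[of 0 "i - 1"] T_le[of "Suc i" N] T0 i by auto
  then obtain d where d: "0 < d" "T (i - 1) < \<tau> - d" "\<tau> + d < T (Suc i)"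
    "\<And>t. t \<in> {\<tau> - d..\<tau> + d} \<Longrightarrow> x t \<in> dom_of c"
    using chart_interval[OF c(1) c\<tau> \<tau>T, of 1] by auto
  define a b a' b' where "a = \<tau> - d" and "b = \<tau> + d" and "a' = \<tau> - d / 2" and "b' = \<tau> + d / 2"
  have ab: "a < a'" "a' < \<tau>" "\<tau> < b'" "b' < b" "T (i - 1) < a" "b < T (Suc i)"
    using d by (auto simp: a_def b_def a'_def b'_def)
  have abT: "0 < a" "b < T N"
    using ab cell_subset[OF i1(1)] T_step[OF i1(1)] T_le[of "Suc i" N] i by auto
  have cells: "{a..\<tau>} \<subseteq> cell i" "{\<tau>..b} \<subseteq> cell (Suc i)" using ab by (auto simp: \<tau>_def)
  have xc: "x t \<in> dom_of c" if "t \<in> {a..b}" for t using d(4) that by (simp add: a_def b_def)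
  obtain \<beta> :: "real \<Rightarrow> real" where \<beta>: "\<And>j. Ck_open j UNIV \<beta>" "\<And>t. 0 \<le> \<beta> t" "\<And>t. 0 < \<beta> t \<longleftrightarrow> a' < t \<and> t < b'"
    using smooth_bump[of a' b'] by blast
  have "Gc c (crd x c \<tau>) (cpow x i c 2 \<tau> - cpow x (Suc i) c 2 \<tau>) w = 0" for w
  proof -
    define \<phi> where "\<phi> t = ((t - \<tau>) * \<beta> t) *\<^sub>R w" for t
    have "Ck_open j UNIV (\<lambda>t. t - \<tau>)" for j
      using Ck_open_add[OF open_UNIV Ck_open_ident[OF open_UNIV] Ck_open_const, of j "- \<tau>"] by simp
    then have \<phi>: "Ck_open j UNIV \<phi>" for j
      unfolding \<phi>_def by (intro Ck_open_bounded_bilinear[OF open_UNIV bounded_bilinear_scaleR]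
          Ck_open_bounded_bilinear[OF open_UNIV bounded_bilinear_mult] \<beta>(1) Ck_open_const)
    have \<phi>0: "\<phi> t = 0" if "t \<notin> {a'..b'}" for t using \<beta>(2,3)[of t] that by (auto simp: \<phi>_def)
    have \<phi>\<tau>: "\<phi> \<tau> = 0" by (simp add: \<phi>_def)
    have "\<beta> differentiable at \<tau>" using \<beta>(1)[of "Suc 0"] by simp
    then obtain \<beta>' where "(\<beta> has_real_derivative \<beta>') (at \<tau>)"
      using real_differentiableE by blast
    then have "((\<lambda>t. (t - \<tau>) * \<beta> t) has_real_derivative \<beta> \<tau>) (at \<tau>)"
      by (auto intro!: derivative_eq_intros)
    from has_vector_derivative_scaleR[OF this has_vector_derivative_const[of w]]
    have \<psi>: "(\<phi> has_vector_derivative \<beta> \<tau> *\<^sub>R w) (at \<tau>)"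
      by (simp add: \<phi>_def[abs_def])
    have knots: "\<phi> (T j) = 0" if "j \<in> {1..<N}" for j
    proof (cases "j = i")
      case False
      then have "T j \<le> T (i - 1) \<or> T (Suc i) \<le> T j"
        using T_le[of j "i - 1"] T_le[of "Suc i" j] that i by (cases "j \<le> i - 1") auto
      then show ?thesis using ab by (intro \<phi>0) auto
    qed (simp add: \<phi>_def \<tau>_def)
    have 0: "integral {a..\<tau>} (\<lambda>t. el x i c t (\<phi> t)) = integral {a..\<tau>} (\<lambda>t. 0)"
      using cells(1) xc ab by (intro integral_cong el_zero[OF i1(1) _ c(1)]) auto
    have "integral {\<tau>..b} (\<lambda>t. el x (Suc i) c t (\<phi> t)) = integral {\<tau>..b} (\<lambda>t. 0)"
      using cells(2) xc ab by (intro integral_cong el_zero[OF i1(2) _ c(1)]) auto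
    with 0 split_variation[OF i1 c(1) ab(1-4) abT cells xc \<phi> \<phi>0 knots \<psi>]
    have "\<beta> \<tau> * Gc c (crd x c \<tau>) (cpow x i c 2 \<tau>) w = \<beta> \<tau> * Gc c (crd x c \<tau>) (cpow x (Suc i) c 2 \<tau>) w"
      by (simp add: \<phi>\<tau> bdry_def G_simps[OF q] \<Gamma>_simps[OF q])
    then show ?thesis using \<beta>(3)[of \<tau>] ab by (simp add: G_simps[OF q])
  qed
  from G_nondegenerate[OF q this] show ?thesis by (simp add: \<tau>_def)
qed

end

end


section \<open>Regularity at the knots\<close>

lemma has_vector_derivative_glue:
  fixes h k :: "real \<Rightarrow> 'a::real_normed_vector"
  assumes "(h has_vector_derivative h' t) (at t)" "(k has_vector_derivative k' t) (at t)"
    and "h \<tau> = k \<tau>" "h' \<tau> = k' \<tau>"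
  shows "((\<lambda>s. if s \<in> {..\<tau>} then h s else k s) has_vector_derivative
    (if t \<in> {..\<tau>} then h' t else k' t)) (at t)"
  by (rule has_vector_derivative_If_within_closures[where T="{\<tau><..}"])
     (use assms in \<open>auto intro: has_vector_derivative_at_within\<close>)

text \<open>A smooth extension across an end point has there the one-sided derivatives of the curve.\<close>

lemma Ck_on_extension_2:
  fixes y :: "real \<Rightarrow> 'a::euclidean_space"
  assumes y: "Ck_on \<infinity> S y" and lim: "\<And>s. s \<in> S \<Longrightarrow> at s within S \<noteq> bot" and t: "t \<in> S"
    and y1: "\<And>s. s \<in> S \<Longrightarrow> (y has_vector_derivative y1 s) (at s within S)"
    and y2: "(y1 has_vector_derivative y2) (at t within S)"
  obtains W h h1 h2 where "open W" "t \<in> W" "\<And>s. s \<in> W \<Longrightarrow> s \<in> S \<Longrightarrow> y s = h s"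
    "\<And>s. s \<in> W \<Longrightarrow> (h has_vector_derivative h1 s) (at s)"
    "\<And>s. s \<in> W \<Longrightarrow> (h1 has_vector_derivative h2 s) (at s)"
    "continuous_on W h2" "h1 t = y1 t" "h2 t = y2"
proof -
  obtain W h where h: "open W" "t \<in> W" "\<And>j. Ck_open j W h" "\<And>s. s \<in> W \<Longrightarrow> s \<in> S \<Longrightarrow> y s = h s"
    using Ck_onE[OF y t] by (metis enat_ord_code(3))
  define h1 where "h1 s = vector_derivative h (at s within W)" for s
  define h2 where "h2 s = vector_derivative h1 (at s within W)" for s
  have limW: "at s within W \<noteq> bot" if "s \<in> W" for s
    using that h(1) by (simp add: at_within_open[OF that h(1)])
  have k0: "Ck_on (eSuc \<infinity>) W h" using Ck_onI_open[OF h(1,3)] by simp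
  have k1: "Ck_on \<infinity> W h1" unfolding h1_def by (rule Ck_on_vector_derivative(2)[OF k0 limW])
  then have k1': "Ck_on (eSuc \<infinity>) W h1" by simp
  have k2: "Ck_on \<infinity> W h2" unfolding h2_def by (rule Ck_on_vector_derivative(2)[OF k1' limW])
  have e1: "(h has_vector_derivative h1 s) (at s)" if "s \<in> W" for s
  proof -
    have "(h has_vector_derivative h1 s) (at s within W)"
      unfolding h1_def by (rule Ck_on_vector_derivative(1)[OF k0 limW that])
    then show ?thesis by (simp add: at_within_open[OF that h(1)])
  qed
  have e2: "(h1 has_vector_derivative h2 s) (at s)" if "s \<in> W" for s
  proof -
    have "(h1 has_vector_derivative h2 s) (at s within W)"
      unfolding h2_def by (rule Ck_on_vector_derivative(1)[OF k1' limW that])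
    then show ?thesis by (simp add: at_within_open[OF that h(1)])
  qed
  have transfer: "(f has_vector_derivative D) (at r within S)"
    if r: "r \<in> W" "r \<in> S" and eq: "\<And>s. s \<in> W \<Longrightarrow> s \<in> S \<Longrightarrow> f s = f' s"
      and d: "(f' has_vector_derivative D) (at r)" for f f' :: "real \<Rightarrow> 'a" and D r
  proof -
    have "\<forall>\<^sub>F s in nhds r. s \<in> S \<longrightarrow> f s = f' s"
      using eventually_nhds_in_open[OF h(1) r(1)] by eventually_elim (use eq in auto)
    from has_vector_derivative_cong_ev[OF this eq[OF r]] has_vector_derivative_at_within[OF d]
    show ?thesis by simp
  qed
  have h1: "h1 s = y1 s" if s: "s \<in> W" "s \<in> S" for s
    by (rule vector_derivative_unique_within[OF lim[OF s(2)] transfer[OF s h(4) e1[OF s(1)]] y1[OF s(2)]])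
  have "h2 t = y2"
  proof (rule vector_derivative_unique_within[OF lim[OF t] _ y2])
    show "(y1 has_vector_derivative h2 t) (at t within S)"
      by (rule transfer[OF h(2) t h1[symmetric] e2[OF h(2)]])
  qed
  from that[OF h(1,2,4) e1 e2 Ck_on_continuous_on[OF k2] h1[OF h(2) t] this] show thesis by blast
qed

context spline_problem
begin

context
  fixes x assumes ext: "extremizer A N T pt v0 vN (action A g nab \<sigma> V (T N)) x"
begin

text \<open>Smooth extensions of the arcs before and after the knot have the same value and the same first and
  second derivative there, so that gluing them gives a $C^2$ map.\<close>

lemma Ck_on_2_at_knot:
  assumes i: "1 \<le> i" "i < N" and c: "c \<in> A" "x (T i) \<in> dom_of c"
  shows "\<exists>W h. open W \<and> T i \<in> W \<and> (\<forall>j. enat j \<le> 2 \<longrightarrow> Ck_open j W h) \<and>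
    (\<forall>t\<in>W \<inter> ({0..T N} \<inter> x -` dom_of c). coords c (x t) = h t)"
proof -
  let ?y = "\<lambda>t. coords c (x t)" and ?\<tau> = "T i"
  have i1: "i \<in> {1..N}" "Suc i \<in> {1..N}" using i by auto
  note adm = x_adm[OF ext]
  have \<tau>: "T (i - 1) < ?\<tau>" "?\<tau> < T (Suc i)" using T_step[OF i1(1)] T_step[OF i1(2)] by auto
  have ex: "\<exists>W h h1 h2. open W \<and> ?\<tau> \<in> W \<and> (\<forall>s\<in>W. s \<in> cell k \<inter> x -` dom_of c \<longrightarrow> ?y s = h s)
    \<and> (\<forall>s\<in>W. (h has_vector_derivative h1 s) (at s)) \<and> (\<forall>s\<in>W. (h1 has_vector_derivative h2 s) (at s))
    \<and> continuous_on W h2 \<and> h1 ?\<tau> = velocity A {0..T N} x ?\<tau> c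
    \<and> h2 ?\<tau> = cpow x k c 2 ?\<tau>
       - Chr c (?y ?\<tau>) (velocity A {0..T N} x ?\<tau> c) (velocity A {0..T N} x ?\<tau> c)"
    if k: "k \<in> {1..N}" "?\<tau> \<in> cell k" for k
  proof -
    note xk = admissibleD(2)[OF adm k(1)]
    let ?S = "cell k \<inter> x -` dom_of c"
    have \<tau>S: "?\<tau> \<in> ?S" using k c by auto
    have lim: "at s within ?S \<noteq> bot" if "s \<in> ?S" for s
      using at_within_preimage[OF Ck_map_continuous[OF xk] c(1) that] at_within_cell[OF k(1)] that by auto
    note y = Ck_map_coords[OF xk c(1)]
    note y1 = velocity_chart(1)[OF xk c(1) at_within_cell[OF k(1)]]
    have y2: "((\<lambda>t. velocity A (cell k) x t c) has_vector_derivative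
       cpow x k c 2 ?\<tau> - Chr c (?y ?\<tau>) (velocity A (cell k) x ?\<tau> c) (velocity A (cell k) x ?\<tau> c))
       (at ?\<tau> within ?S)"
      using cov_power_has_derivative[OF xk c(1) at_within_cell[OF k(1)], of 1 ?\<tau>] \<tau>S
      by (simp add: cov_power_1[simplified] numeral_2_eq_2)
    show ?thesis
      using Ck_on_extension_2[OF y lim \<tau>S y1 y2] velocity_cell[OF ext k c] by (smt (verit))
  qed
  obtain U h h1 h2 where h: "open U" "?\<tau> \<in> U" "\<forall>s\<in>U. s \<in> cell i \<inter> x -` dom_of c \<longrightarrow> ?y s = h s"
    "\<forall>s\<in>U. (h has_vector_derivative h1 s) (at s)" "\<forall>s\<in>U. (h1 has_vector_derivative h2 s) (at s)"
    "continuous_on U h2" "h1 ?\<tau> = velocity A {0..T N} x ?\<tau> c"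
    "h2 ?\<tau> = cpow x i c 2 ?\<tau>
       - Chr c (?y ?\<tau>) (velocity A {0..T N} x ?\<tau> c) (velocity A {0..T N} x ?\<tau> c)"
    using ex[OF i1(1)] \<tau> by auto
  obtain W k k1 k2 where k: "open W" "?\<tau> \<in> W" "\<forall>s\<in>W. s \<in> cell (Suc i) \<inter> x -` dom_of c \<longrightarrow> ?y s = k s"
    "\<forall>s\<in>W. (k has_vector_derivative k1 s) (at s)" "\<forall>s\<in>W. (k1 has_vector_derivative k2 s) (at s)"
    "continuous_on W k2" "k1 ?\<tau> = velocity A {0..T N} x ?\<tau> c"
    "k2 ?\<tau> = cpow x (Suc i) c 2 ?\<tau>
       - Chr c (?y ?\<tau>) (velocity A {0..T N} x ?\<tau> c) (velocity A {0..T N} x ?\<tau> c)"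
    using ex[OF i1(2)] \<tau> by auto
  have eq0: "h ?\<tau> = k ?\<tau>"
  proof -
    have "?y ?\<tau> = h ?\<tau>" using h(2,3) \<tau> c by auto
    moreover have "?y ?\<tau> = k ?\<tau>" using k(2,3) \<tau> c by auto
    ultimately show ?thesis by simp
  qed
  have eq1: "h1 ?\<tau> = k1 ?\<tau>" using h(7) k(7) by simp
  have eq2: "h2 ?\<tau> = k2 ?\<tau>" using h(8) k(8) no_corner[OF ext i c] by simp
  define B where "B = U \<inter> W \<inter> {T (i - 1)<..<T (Suc i)}"
  have B: "open B" "?\<tau> \<in> B" "B \<subseteq> U" "B \<subseteq> W" using h(1,2) k(1,2) \<tau> by (auto simp: B_def open_Int)
  let ?f = "\<lambda>s. if s \<in> {..?\<tau>} then h s else k s" and ?f1 = "\<lambda>s. if s \<in> {..?\<tau>} then h1 s else k1 s"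
    and ?f2 = "\<lambda>s. if s \<in> {..?\<tau>} then h2 s else k2 s"
  have c2: "continuous_on B ?f2"
  proof -
    have "continuous_on B (\<lambda>s. if s \<le> ?\<tau> then h2 s else k2 s)"
    proof (rule continuous_on_cases_le)
      show "continuous_on {s \<in> B. s \<le> ?\<tau>} h2" by (rule continuous_on_subset[OF h(6)]) (use B in auto)
      show "continuous_on {s \<in> B. ?\<tau> \<le> s} k2" by (rule continuous_on_subset[OF k(6)]) (use B in auto)
    qed (use eq2 in \<open>auto intro: continuous_on_id\<close>)
    then show ?thesis by simp
  qed
  have "Ck_open (Suc (Suc 0)) B ?f"
  proof (rule Ck_open_SucI_vector[OF B(1), of _ ?f1], goal_cases)
    case (1 t)
    then show ?case using h(4) k(4) B(3,4) eq0 eq1 by (intro has_vector_derivative_glue) auto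
  next
    case 2
    show ?case
    proof (rule Ck_open_SucI_vector[OF B(1), of _ ?f2], goal_cases)
      case (1 t)
      then show ?case using h(5) k(5) B(3,4) eq1 eq2 by (intro has_vector_derivative_glue) auto
    qed (use c2 in simp)
  qed
  then have "Ck_open j B ?f" if "enat j \<le> 2" for j
    by (rule Ck_open_mono) (use that in \<open>simp add: numeral_eq_enat\<close>)
  moreover have "?y t = ?f t" if "t \<in> B" "t \<in> x -` dom_of c" for t
    using h(3) k(3) that by (auto simp: B_def)
  ultimately show ?thesis using B(1,2) by blast
qed

lemma extremizer_C2: "Ck_map A 2 {0..T N} x"
  unfolding Ck_map_def
proof (intro conjI ballI)
  note adm = x_adm[OF ext]
  show "continuous_on {0..T N} x" by (rule admissibleD(1)[OF adm])
  fix c assume c: "c \<in> A"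
  let ?S = "{0..T N} \<inter> x -` dom_of c"
  have inner: "\<exists>W h. open W \<and> t \<in> W \<and> (\<forall>j. enat j \<le> 2 \<longrightarrow> Ck_open j W h) \<and> (\<forall>s\<in>W \<inter> ?S. coords c (x s) = h s)"
    if i: "i \<in> {1..N}" and t: "t \<in> cell i" "x t \<in> dom_of c" and B: "open B" "t \<in> B" "{0..T N} \<inter> B \<subseteq> cell i" for i t B
  proof -
    have "t \<in> cell i \<inter> x -` dom_of c" using t by simp
    from Ck_onE[OF Ck_map_coords[OF admissibleD(2)[OF adm i] c] this]
    obtain W h where h: "open W" "t \<in> W" "\<And>j. Ck_open j W h"
      "\<And>s. s \<in> W \<Longrightarrow> s \<in> cell i \<inter> x -` dom_of c \<Longrightarrow> coords c (x s) = h s"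
      by (metis enat_ord_code(3))
    have "\<forall>s\<in>(W \<inter> B) \<inter> ?S. coords c (x s) = h s" using h(4) B(3) by blast
    moreover have "Ck_open j (W \<inter> B) h" for j by (rule Ck_open_subset[OF h(3)]) simp
    ultimately show ?thesis using h(1,2) B(1,2) by (intro exI[of _ "W \<inter> B"] exI[of _ h]) auto
  qed
  show "Ck_on 2 ?S (coords c \<circ> x)"
    unfolding comp_def
  proof (rule Ck_onI)
    fix t assume t: "t \<in> ?S"
    show "\<exists>W h. open W \<and> t \<in> W \<and> (\<forall>j. enat j \<le> 2 \<longrightarrow> Ck_open j W h) \<and> (\<forall>s\<in>W \<inter> ?S. coords c (x s) = h s)"
    \<comment> \<open>Each time before the last lies in a half-open cell \<open>[T (i - 1), T i)\<close>, and the cases are its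
      interior, the initial time and an interior knot.\<close>
    proof (cases "t = T N")
      case True
      have "N \<in> {1..N}" using N by simp
      moreover have "{0..T N} \<inter> {T (N - 1)<..} \<subseteq> cell N" by auto
      ultimately show ?thesis
        using T_step[of N] t True by (intro inner[OF _ _ _ open_greaterThan]) auto
    next
      case False
      with t obtain i where i: "i \<in> {1..N}" "T (i - 1) \<le> t" "t < T i" using knot_right[of t] by auto
      show ?thesis
      proof (cases "T (i - 1) = t")
        case False
        moreover have "{0..T N} \<inter> {T (i - 1)<..<T i} \<subseteq> cell i" by auto
        ultimately show ?thesis
          using i t by (intro inner[OF i(1) _ _ open_greaterThanLessThan]) auto
      next
        case knot: True
        show ?thesis
        proof (cases "i = 1")
          case True
          moreover from this have "{0..T N} \<inter> {..<T i} \<subseteq> cell i" using T0 by auto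
          ultimately show ?thesis
            using i t by (intro inner[OF i(1) _ _ open_lessThan]) auto
        next
          case False
          then have "1 \<le> i - 1" "i - 1 < N" using i(1) by auto
          from Ck_on_2_at_knot[OF this c] knot t show ?thesis by simp
        qed
      qed
    qed
  qed
qed

text \<open>The pairing of the left-hand side with every vector vanishes, and the metric is nondegenerate.  In
  charts that do not contain the point all terms are zero by definition.\<close>

lemma extremizer_equation:
  assumes i: "i \<in> {1..N}" and t: "t \<in> cell i"
  shows "cov_power A nab (cell i) x 4 t c
      + curvature A nab (x t) (cov_power A nab (cell i) x 2 t) (cov_power A nab (cell i) x 1 t)
          (cov_power A nab (cell i) x 1 t) c
      - \<sigma> *\<^sub>R cov_power A nab (cell i) x 2 t c + (1/2) *\<^sub>R grad A g V (x t) c = 0"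
proof (cases "c \<in> charts_at A (x t)")
  case True
  then have c: "c \<in> A" "x t \<in> dom_of c" by (auto simp: charts_at_def)
  interpret chart_geometry "coords c ` dom_of c" "Gc c" "Chr c" by (rule chart_geometry[OF c(1)])
  have q: "coords c (x t) \<in> coords c ` dom_of c" using c by blast
  have "(V \<circ> param c has_derivative dV c (coords c (x t))) (at (coords c (x t)))"
    using V_chart(1)[OF c(1) q] by (simp add: comp_def)
  note gr = grad_chart(2)[OF c this]
  show ?thesis
  proof (rule G_nondegenerate[OF q])
    fix w
    show "Gc c (coords c (x t)) (cov_power A nab (cell i) x 4 t c
      + curvature A nab (x t) (cov_power A nab (cell i) x 2 t) (cov_power A nab (cell i) x 1 t)
          (cov_power A nab (cell i) x 1 t) c
      - \<sigma> *\<^sub>R cov_power A nab (cell i) x 2 t c + (1/2) *\<^sub>R grad A g V (x t) c) w = 0"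
      using el_zero[OF ext i t c, of w] gr[of w]
      by (simp add: el_def EL_def G_simps[OF q] curvature_chart[OF c])
  qed
next
  case False
  obtain d where d: "d \<in> A" "x t \<in> dom_of d" using chart_at by blast
  have "(V \<circ> param d has_derivative dV d (coords d (x t))) (at (coords d (x t)))"
    using V_chart(1)[OF d(1)] d by (simp add: comp_def)
  from tangent_off[OF grad_chart(1)[OF d this] False] False
  show ?thesis by (simp add: cov_power_off curvature_def)
qed

end

end

theorem theorem3p1:
  fixes A :: "('m::{t2_space, second_countable_topology}, 'e::euclidean_space) chart set"
    and g :: "'m \<Rightarrow> ('m, 'e) tvec \<Rightarrow> ('m, 'e) tvec \<Rightarrow> real"
    and nab :: "('m \<Rightarrow> ('m, 'e) tvec) \<Rightarrow> ('m \<Rightarrow> ('m, 'e) tvec) \<Rightarrow> 'm \<Rightarrow> ('m, 'e) tvec"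
    and \<sigma> :: real and V :: "'m \<Rightarrow> real" and S :: "'m set"
    and N :: nat and T :: "nat \<Rightarrow> real" and pt :: "nat \<Rightarrow> 'm"
    and v0 vN :: "('m, 'e) tvec" and x :: "real \<Rightarrow> 'm"
  assumes "smooth_structure A"
    and "riemannian_metric A g"
    and "levi_civita A g nab"
    and "\<sigma> > 0"
    and "Ck_fun A 2 UNIV V"
    and "regular_submanifold A S"
    and "N \<ge> 1"
    and "inj_on pt {0..N}" and "\<forall>i\<in>{0..N}. pt i \<notin> S"
    and "T 0 = 0" and "\<forall>i\<in>{1..N}. T (i - 1) < T i"
    and "v0 \<in> tangent_space A (pt 0)" and "vN \<in> tangent_space A (pt N)"
    and "extremizer A N T pt v0 vN (action A g nab \<sigma> V (T N)) x"
  shows "Ck_map A 2 {0..T N} x \<and>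
    (\<forall>i\<in>{1..N}. \<forall>t\<in>{T (i - 1)..T i}.
       let D = (\<lambda>k. cov_power A nab {T (i - 1)..T i} x k t) in
       (\<lambda>c. D 4 c + curvature A nab (x t) (D 2) (D 1) (D 1) c
            - \<sigma> *\<^sub>R D 2 c + (1/2) *\<^sub>R grad A g V (x t) c) = (\<lambda>c. 0))"
proof -
  interpret spline_problem A g nab \<sigma> V N T pt v0 vN
    by unfold_locales (use assms in auto)
  show ?thesis
    unfolding Let_def
    using extremizer_C2[OF assms(14)] extremizer_equation[OF assms(14)] by blast
qed


end
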